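(* Let $s>0$ and $1\le p<\infty$ satisfy $sp<N$, and assume that it is not the case that both $p=1$ and $s$ is an integer $\ge 2$. Then there exists a finite constant $K=K_{s,p,N}$ such that $$\|f\|_{L^{Np/(N-sp)}(\mathbb{R}^N)}\le K\,\mathscr{E}_{s,p}(f)\qquad\text{for every } f\in \mathring{W}^{s,p}(\mathbb{R}^N).$$
   Context: $N\ge 2$ is an integer. For $f:\mathbb{R}^N\to\mathbb{R}$ measurable and $h\in\mathbb{R}^N$, $\Delta_h f(x)=f(x+h)-f(x)$ and $\Delta_h^{m+1}=\Delta_h\circ\Delta_h^m$. $\lfloor s\rfloor$ is the integer part of $s$, $\mathscr{H}^{N-1}$ is the $(N-1)$-dimensional Hausdorff measure, $\sigma_N=\mathscr{H}^{N-1}(\mathbb{S}^{N-1})$. Semi-norms. If $s>0$ is not an integer and $f\in L^1_{\mathrm{loc}}(\mathbb{R}^N)$, $|f|_{W^{s,p}}^p=\int_{\mathbb{R}^N}\frac{\|\Delta_h^{\lfloor s\rfloor+1}f\|_{L^p}^p}{|h|^{sp+N}}\,dh$. If $s\ge1$ is an integer and $f\in W^{s,1}_{\mathrm{loc}}(\mathbb{R}^N)$, $|f|_{W^{s,p}}^p=\int_{\mathbb{R}^N}\|D^s_xf\|^p\,dx$, where $D_x^sf$ is the $s$-linear form given by the $s$-th derivative of $f$ at $x$ and $\|\eta\|=\sup_{|x_1|\le1,\dots,|x_s|\le1}|\eta(x_1,\dots,x_s)|$. For $sp<N$, $\mathring{W}^{s,p}(\mathbb{R}^N)=\{f\in L^{Np/(N-sp)}(\mathbb{R}^N):\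 |f|_{W^{s,p}}<\infty\}$ (for $s$ an integer, $f$ is understood to belong to $W^{s,1}_{\mathrm{loc}}$). Affine energy. For $\xi\in\mathbb{S}^{N-1}$ put $I_f(\xi)=\int_0^\infty t^{-sp-1}\|\Delta^{\lfloor s\rfloor+1}_{t\xi}f\|_{L^p}^p\,dt$ if $s$ is not an integer, and $I_f(\xi)=\int_{\mathbb{R}^N}|\partial^s_\xi f(x)|^p\,dx$ if $s\ge1$ is an integer, where $\partial_\xi^sf(x)=D^s_xf(\xi,\dots,\xi)$. Then $$\mathscr{E}_{s,p}(f)=\sigma_N^{(N+sp)/(Np)}\Big(\int_{\mathbb{S}^{N-1}}I_f(\xi)^{-N/(sp)}\,d\mathscr{H}^{N-1}(\xi)\Big)^{-s/N},$$ with the conventions that a negative power of $0$ is $\infty$ and a negative power of $\infty$ is $0$. *)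

theory Defs
  imports "HOL-Analysis.Analysis"
begin

section \<open>Extended powers and Lebesgue norms\<close>

text \<open>Real powers on \<open>[0, \<infinity>]\<close>; a negative power of \<open>0\<close> is \<open>\<infinity>\<close>, a negative power of \<open>\<infinity>\<close> is \<open>0\<close>.\<close>

definition epowr :: "ennreal \<Rightarrow> real \<Rightarrow> ennreal" where
  "epowr x a =
     (if a = 0 then 1
      else if x = 0 then (if a > 0 then 0 else \<infinity>)
      else if x = \<infinity> then (if a > 0 then \<infinity> else 0)
      else ennreal (enn2real x powr a))"

definition Lp_energy :: "real \<Rightarrow> ('a::euclidean_space \<Rightarrow> real) \<Rightarrow> ennreal" where
  "Lp_energy p f = (\<integral>\<^sup>+x. ennreal (\<bar>f x\<bar> powr p) \<partial>lebesgue)"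

definition Lp_norm :: "real \<Rightarrow> ('a::euclidean_space \<Rightarrow> real) \<Rightarrow> ennreal" where
  "Lp_norm p f = epowr (Lp_energy p f) (1 / p)"

definition L1_loc :: "('a::euclidean_space \<Rightarrow> real) set" where
  "L1_loc = {f \<in> borel_measurable lebesgue. \<forall>K. compact K \<longrightarrow> f absolutely_integrable_on K}"


section \<open>Hausdorff measure\<close>

text \<open>
  The normalisation is the one for which the \<open>d\<close>-dimensional measure on \<open>\<real>\<^sup>d\<close> is Lebesgue measure.
  The separate clause for empty covering sets matters only for \<open>d = 0\<close>, where \<open>0 ^ 0 = 1\<close>.
\<close>

definition hausdorff_gauge :: "nat \<Rightarrow> 'a::metric_space set \<Rightarrow> ennreal" where
  "hausdorff_gauge d C =
     (if C = {} then 0 else ennreal (unit_ball_vol (real d) * (diameter C / 2) ^ d))"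

definition hausdorff_content :: "nat \<Rightarrow> real \<Rightarrow> 'a::metric_space set \<Rightarrow> ennreal" where
  "hausdorff_content d \<delta> A =
     (INF C \<in> {C :: nat \<Rightarrow> 'a set. A \<subseteq> (\<Union>i. C i) \<and> (\<forall>i. bounded (C i) \<and> diameter (C i) \<le> \<delta>)}.
        \<Sum>i. hausdorff_gauge d (C i))"

definition hausdorff_outer :: "nat \<Rightarrow> 'a::metric_space set \<Rightarrow> ennreal" where
  "hausdorff_outer d A = (SUP \<delta> \<in> {0<..}. hausdorff_content d \<delta> A)"

text \<open>
  \<open>hausdorff_outer d\<close> is a metric outer measure, hence countably additive on Borel sets, so that
  \<open>measure_of\<close> does not degenerate to the null measure.
\<close>

definition hausdorff_measure :: "nat \<Rightarrow> 'a::metric_space measure" where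
  "hausdorff_measure d = measure_of UNIV (sets borel) (hausdorff_outer d)"


section \<open>Weak derivatives\<close>

primrec iter_dderiv :: "'a::euclidean_space list \<Rightarrow> ('a \<Rightarrow> real) \<Rightarrow> 'a \<Rightarrow> real" where
  "iter_dderiv [] f = f"
| "iter_dderiv (v # vs) f = (\<lambda>x. frechet_derivative (iter_dderiv vs f) (at x) v)"

definition smooth_fun :: "('a::euclidean_space \<Rightarrow> real) \<Rightarrow> bool" where
  "smooth_fun f \<longleftrightarrow> (\<forall>vs x. iter_dderiv vs f differentiable (at x))"

definition test_function :: "('a::euclidean_space \<Rightarrow> real) \<Rightarrow> bool" where
  "test_function \<phi> \<longleftrightarrow> smooth_fun \<phi> \<and> compact (closure {x. \<phi> x \<noteq> 0})"

text \<open>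
  The list \<open>bs\<close> of basis vectors plays the role of a multi-index: \<open>g\<close> is the iterated weak partial
  derivative of \<open>f\<close> along the vectors in \<open>bs\<close>.
\<close>

definition has_weak_pderiv ::
  "('a::euclidean_space \<Rightarrow> real) \<Rightarrow> 'a list \<Rightarrow> ('a \<Rightarrow> real) \<Rightarrow> bool" where
  "has_weak_pderiv f bs g \<longleftrightarrow>
     g \<in> L1_loc \<and>
     (\<forall>\<phi>. test_function \<phi> \<longrightarrow>
        (LINT x|lebesgue. f x * iter_dderiv bs \<phi> x) =
          (-1) ^ length bs * (LINT x|lebesgue. g x * \<phi> x))"

definition weak_pderiv ::
  "('a::euclidean_space \<Rightarrow> real) \<Rightarrow> 'a list \<Rightarrow> 'a \<Rightarrow> real" where
  "weak_pderiv f bs = (SOME g. has_weak_pderiv f bs g)"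

definition basis_lists :: "nat \<Rightarrow> 'a::euclidean_space list set" where
  "basis_lists k = {bs. set bs \<subseteq> Basis \<and> length bs = k}"

definition Sobolev1_loc :: "nat \<Rightarrow> ('a::euclidean_space \<Rightarrow> real) set" where
  "Sobolev1_loc k =
     {f \<in> L1_loc. \<forall>j\<le>k. \<forall>bs \<in> basis_lists j. \<exists>g. has_weak_pderiv f bs g}"

text \<open>
  The \<open>k\<close>-linear form \<open>D\<^sup>k f(x)\<close>, evaluated at a list of \<open>k\<close> vectors. Weak partial derivatives are
  unique only almost everywhere; expanding in the basis makes the form \<open>k\<close>-linear at every \<open>x\<close>.
\<close>

definition weak_form ::
  "nat \<Rightarrow> ('a::euclidean_space \<Rightarrow> real) \<Rightarrow> 'a \<Rightarrow> 'a list \<Rightarrow> real" where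
  "weak_form k f x vs =
     (\<Sum>bs \<in> basis_lists k. (\<Prod>i<k. (vs ! i) \<bullet> (bs ! i)) * weak_pderiv f bs x)"

definition form_norm :: "nat \<Rightarrow> ('a::euclidean_space list \<Rightarrow> real) \<Rightarrow> real" where
  "form_norm k \<eta> = (SUP vs \<in> {vs. length vs = k \<and> (\<forall>v \<in> set vs. norm v \<le> 1)}. \<bar>\<eta> vs\<bar>)"


section \<open>Sobolev semi-norms and spaces\<close>

definition fdiff :: "'a::euclidean_space \<Rightarrow> ('a \<Rightarrow> real) \<Rightarrow> 'a \<Rightarrow> real" where
  "fdiff h f = (\<lambda>x. f (x + h) - f x)"

definition sobolev_seminorm :: "real \<Rightarrow> real \<Rightarrow> ('a::euclidean_space \<Rightarrow> real) \<Rightarrow> ennreal" where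
  "sobolev_seminorm s p f =
     epowr
       (if s \<in> \<int>
        then Lp_energy p (\<lambda>x. form_norm (nat \<lfloor>s\<rfloor>) (weak_form (nat \<lfloor>s\<rfloor>) f x))
        else \<integral>\<^sup>+h. Lp_energy p ((fdiff h ^^ (nat \<lfloor>s\<rfloor> + 1)) f)
                    / ennreal (norm h powr (s * p + real DIM('a))) \<partial>lebesgue)
       (1 / p)"

definition hom_sobolev :: "real \<Rightarrow> real \<Rightarrow> ('a::euclidean_space \<Rightarrow> real) set" where
  "hom_sobolev s p =
     {f \<in> borel_measurable lebesgue.
        Lp_norm (real DIM('a) * p / (real DIM('a) - s * p)) f < \<infinity> \<and>
        (s \<in> \<int> \<longrightarrow> f \<in> Sobolev1_loc (nat \<lfloor>s\<rfloor>)) \<and>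
        sobolev_seminorm s p f < \<infinity>}"


section \<open>Affine energy\<close>

definition directional_energy ::
  "real \<Rightarrow> real \<Rightarrow> ('a::euclidean_space \<Rightarrow> real) \<Rightarrow> 'a \<Rightarrow> ennreal" where
  "directional_energy s p f \<xi> =
     (if s \<in> \<int>
      then Lp_energy p (\<lambda>x. weak_form (nat \<lfloor>s\<rfloor>) f x (replicate (nat \<lfloor>s\<rfloor>) \<xi>))
      else \<integral>\<^sup>+t\<in>{0<..}. ennreal (t powr (- s * p - 1))
                  * Lp_energy p ((fdiff (t *\<^sub>R \<xi>) ^^ (nat \<lfloor>s\<rfloor> + 1)) f) \<partial>lebesgue)"

definition affine_energy :: "real \<Rightarrow> real \<Rightarrow> ('a::euclidean_space \<Rightarrow> real) \<Rightarrow> ennreal" where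
  "affine_energy s p f =
     (let N = real DIM('a);
          H = hausdorff_measure (DIM('a) - 1) :: 'a measure
      in epowr (emeasure H (sphere 0 1)) ((N + s * p) / (N * p))
         * epowr (\<integral>\<^sup>+\<xi>\<in>sphere 0 1. epowr (directional_energy s p f \<xi>) (- N / (s * p)) \<partial>H)
             (- s / N))"

end

theory Submission
  imports Defs
begin

text \<open>
  Write \<open>N\<close> for the dimension, \<open>q = N p / (N - s p)\<close>, \<open>A = \<integral> |f|\<^sup>q\<close>, and extend the directional energy from
  the sphere to a function \<open>I\<close> of all vectors \<open>h\<close>; it is homogeneous of degree \<open>s p\<close>, so
  \<open>S = {h. I h \<le> 1}\<close> is star-shaped, and in polar coordinates the integral of \<open>I\<close> to the power
  \<open>- N / (s p)\<close> over the unit sphere equals \<open>N |S|\<close>. The theorem therefore says that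
  \<open>|S|\<^sup>s\<^sup>p\<^sup>/\<^sup>N A\<^sup>1\<^sup>-\<^sup>s\<^sup>p\<^sup>/\<^sup>N\<close> is bounded by a constant that depends on \<open>s, p, N\<close> only.

  This can be shown by averaging over the dilates of \<open>S\<close>, a set of arbitrary shape. The value
  \<open>f x\<close> is, up to sign, the \<open>m\<close>-th difference of \<open>f\<close> at \<open>x\<close> with step \<open>t h\<close>, plus a combination of
  the values \<open>f (x + j t h)\<close> with \<open>1 \<le> j \<le> m\<close>. Averaged over \<open>h \<in> S\<close>, these values are controlled by
  \<open>(A / (t\<^sup>N |S|))\<^sup>1\<^sup>/\<^sup>q\<close>, which involves nothing but the volume of \<open>S\<close>. Suppose that for all dyadic \<open>t\<close> the
  average over \<open>h \<in> S\<close> of the \<open>p\<close>-th power of the \<open>m\<close>-th difference is at most \<open>t\<^sup>s\<^sup>p G x\<close>. Choosing \<open>t\<close> so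
  large that the average of the shifted values is at most half of \<open>|f x|\<close> gives the pointwise bound
  \<open>|f x|\<^sup>q \<le> C (A / |S|)\<^sup>s\<^sup>p\<^sup>/\<^sup>N G x\<close>; integrating it yields the claim as soon as \<open>\<integral> G\<close> is bounded
  (\<open>sobolev_from_scaled_differences\<close>). Everything is thus reduced to the construction of \<open>G\<close>.

  For fractional \<open>s\<close> one takes for \<open>G\<close> the average over \<open>S\<close> of the integrals that define \<open>I\<close>;
  star-shapedness makes a single scale comparable to the neighbouring ones (\<open>fractional_majorant\<close>).
  For integer \<open>s = k\<close> and \<open>p > 1\<close>, the \<open>k\<close>-th difference in direction \<open>h\<close> is a \<open>k\<close>-fold average of
  the \<open>k\<close>-th derivative along lines of direction \<open>h\<close>. One takes for \<open>G\<close> the average over \<open>S\<close> of the \<open>p\<close>-th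
  power of the \<open>k\<close>-fold iterated maximal function along these lines, whose norm does not depend on
  \<open>h\<close> (\<open>line_max_strong_type\<close>, \<open>integer_majorant\<close>). For \<open>s = p = 1\<close> the maximal function is only of
  weak type; there the averaging argument is applied to the level sets of \<open>f\<close>, each at its own
  scale, and a coarea inequality for differences puts them together (\<open>sobolev_from_level_sets\<close>).

  Two facts link this to the definitions. The \<open>k\<close>-th weak derivative of \<open>f\<close> in direction \<open>h\<close> bounds
  the differences of \<open>f\<close> (\<open>sobolev_directional_derivative\<close>): this is proved by duality, moving the
  differences to the test functions. And Hausdorff measure on the sphere is at most a multiple of
  the cone measure, whose value on \<open>A\<close> is the volume of the truncated cone over \<open>A\<close>
  (\<open>hausdorff_le_cone_measure\<close>, by a covering argument), and the sphere has positive measure. As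
  constants are immaterial, this one-sided comparison transfers the bound on \<open>|S|\<close> to the affine
  energy.
\<close>

section \<open>Dilations, extended powers and iterated differences\<close>

lemma nn_integral_lborel_affine:
  fixes g :: "'a::euclidean_space \<Rightarrow> ennreal"
  assumes [measurable]: "g \<in> borel_measurable borel" and "c > 0"
  shows "(\<integral>\<^sup>+x. g (a + c *\<^sub>R x) \<partial>lborel) = ennreal (1 / c ^ DIM('a)) * (\<integral>\<^sup>+x. g x \<partial>lborel)"
proof -
  have "(\<integral>\<^sup>+x. g x \<partial>lborel) = ennreal (c ^ DIM('a)) * (\<integral>\<^sup>+x. g (a + c *\<^sub>R x) \<partial>lborel)"
    by (subst lborel_affine[of c a])
       (use \<open>c > 0\<close> in \<open>simp_all add: nn_integral_density nn_integral_distr nn_integral_cmult\<close>)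
  then show ?thesis
    using \<open>c > 0\<close> by (simp add: mult.assoc[symmetric] ennreal_mult[symmetric])
qed

lemma nn_integral_lborel_translate:
  fixes g :: "'a::euclidean_space \<Rightarrow> ennreal"
  assumes "g \<in> borel_measurable borel"
  shows "(\<integral>\<^sup>+x. g (x + a) \<partial>lborel) = (\<integral>\<^sup>+x. g x \<partial>lborel)"
  using nn_integral_lborel_affine[OF assms, of 1 a] by (simp add: add.commute)

lemma epowr_ennreal: "0 \<le> r \<Longrightarrow> 0 < a \<Longrightarrow> epowr (ennreal r) a = ennreal (r powr a)"
  by (simp add: epowr_def)

lemma epowr_zero [simp]: "0 < a \<Longrightarrow> epowr 0 a = 0"
  and epowr_top [simp]: "0 < a \<Longrightarrow> epowr top a = top"
  by (simp_all add: epowr_def)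

lemma measurable_epowr [measurable]: "(\<lambda>x. epowr x a) \<in> borel_measurable borel"
  unfolding epowr_def by measurable

lemma epowr_mono:
  assumes "x \<le> y" "0 < a" shows "epowr x a \<le> epowr y a"
  using assms
  by (cases x; cases y) (auto simp: epowr_ennreal intro!: ennreal_leI powr_mono2 simp: top_unique)

lemma epowr_mult:
  assumes "0 < a" shows "epowr (x * y) a = epowr x a * epowr y a"
proof (cases x; cases y)
  fix r s assume "x = ennreal r" "y = ennreal s" "0 \<le> r" "0 \<le> s"
  then show ?thesis using assms
    by (simp add: epowr_ennreal ennreal_mult[symmetric] powr_mult)
next
  fix r assume "x = ennreal r" "0 \<le> r" "y = top"
  then show ?thesis using assms by (cases "r = 0") (simp_all add: epowr_ennreal ennreal_mult_top)
next
  fix r assume "y = ennreal r" "0 \<le> r" "x = top"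
  then show ?thesis using assms by (cases "r = 0") (simp_all add: epowr_ennreal ennreal_top_mult)
qed (use assms in simp)

text \<open>
  If \<open>u \<le> l\<close> the first summand suffices, and otherwise \<open>u = u\<^sup>1\<^sup>-\<^sup>q u\<^sup>q \<le> l\<^sup>1\<^sup>-\<^sup>q u\<^sup>q\<close>. Integrated over a set of
  finite measure and with a good choice of \<open>l\<close>, this does the work of the inequalities of Hoelder and
  Jensen, at the price of a factor.
\<close>

lemma le_cut_plus_epowr:
  assumes "l > 0" "q \<ge> 1"
  shows "u \<le> ennreal l + ennreal (l powr (1 - q)) * epowr u q"
proof (cases u)
  case (real r)
  have "r \<le> l + l powr (1 - q) * r powr q"
  proof (cases "r \<le> l")
    case False
    then have "r powr (1 - q) \<le> l powr (1 - q)"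
      using assms by (intro powr_mono2') auto
    then have "r powr (1 - q) * r powr q \<le> l powr (1 - q) * r powr q"
      by (rule mult_right_mono) simp
    then show ?thesis using False assms by (simp add: powr_add[symmetric])
  qed (use assms in \<open>simp add: add_increasing2\<close>)
  then show ?thesis using real assms
    by (simp add: epowr_ennreal ennreal_mult[symmetric] ennreal_plus[symmetric] ennreal_leI del: ennreal_plus)
qed (use assms in \<open>simp add: ennreal_mult_top\<close>)

lemma fdiff_iterate:
  "(fdiff h ^^ m) f x = (\<Sum>j\<le>m. (-1) ^ (m + j) * real (m choose j) * f (x + real j *\<^sub>R h))"
proof (induction m arbitrary: x)
  case (Suc m)
  let ?g = "\<lambda>j. f (x + real j *\<^sub>R h)"
  have "(fdiff h ^^ Suc m) f x =
      (\<Sum>j\<le>m. (-1) ^ (m + j) * real (m choose j) * ?g (Suc j))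
      - (\<Sum>j\<le>Suc m. (-1) ^ (m + j) * real (m choose j) * ?g j)"
    by (simp add: fdiff_def Suc.IH scaleR_left_distrib add.assoc add.left_commute)
  also have "\<dots> = (\<Sum>j\<le>m. (-1) ^ (m + j) * real (Suc m choose Suc j) * ?g (Suc j))
       - (-1) ^ m * ?g 0"
    by (subst sum.atMost_Suc_shift) (simp add: sum.distrib algebra_simps sum_negf)
  also have "\<dots> = (\<Sum>j\<le>Suc m. (-1) ^ (Suc m + j) * real (Suc m choose j) * ?g j)"
    by (subst sum.atMost_Suc_shift) (simp add: algebra_simps)
  finally show ?case .
qed simp

lemma abs_le_fdiff_iterate:
  "\<bar>f x\<bar> \<le> \<bar>(fdiff h ^^ m) f x\<bar> + (\<Sum>j\<in>{1..m}. real (m choose j) * \<bar>f (x + real j *\<^sub>R h)\<bar>)"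
proof -
  let ?t = "\<lambda>j. (-1) ^ (m + j) * real (m choose j) * f (x + real j *\<^sub>R h)"
  have "{..m} = insert 0 {1..m}" by auto
  then have "(fdiff h ^^ m) f x = ?t 0 + (\<Sum>j\<in>{1..m}. ?t j)"
    unfolding fdiff_iterate by simp
  moreover have "\<bar>?t 0\<bar> = \<bar>f x\<bar>" by (simp add: abs_mult power_abs)
  moreover have "\<bar>\<Sum>j\<in>{1..m}. ?t j\<bar> \<le> (\<Sum>j\<in>{1..m}. \<bar>?t j\<bar>)" by (rule sum_abs)
  moreover have "(\<Sum>j\<in>{1..m}. \<bar>?t j\<bar>) = (\<Sum>j\<in>{1..m}. real (m choose j) * \<bar>f (x + real j *\<^sub>R h)\<bar>)"
    by (intro sum.cong) (auto simp: abs_mult power_abs)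
  ultimately show ?thesis by linarith
qed

lemma sum_choose_le: "(\<Sum>j\<in>{1..m}. real (m choose j)) \<le> 2 ^ m"
proof -
  have "(\<Sum>j\<in>{1..m}. real (m choose j)) \<le> (\<Sum>j\<le>m. real (m choose j))"
    by (intro sum_mono2) auto
  also have "\<dots> = 2 ^ m"
    using choose_row_sum[of m] by (metis of_nat_numeral of_nat_power of_nat_sum)
  finally show ?thesis .
qed

lemma measurable_fdiff_iterate [measurable]:
  fixes f :: "'a::euclidean_space \<Rightarrow> real"
  assumes [measurable]: "f \<in> borel_measurable borel"
    and [measurable]: "u \<in> M \<rightarrow>\<^sub>M borel" "v \<in> M \<rightarrow>\<^sub>M borel"
  shows "(\<lambda>w. (fdiff (u w) ^^ m) f (v w)) \<in> borel_measurable M"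
  unfolding fdiff_iterate by measurable

section \<open>Averaging over dilates of a set\<close>

lemma nn_integral_cut_bound:
  fixes u :: "'b \<Rightarrow> ennreal"
  assumes [measurable]: "u \<in> borel_measurable M" and "l > 0" "q \<ge> 1"
  shows "(\<integral>\<^sup>+x. u x \<partial>M) \<le> ennreal l * emeasure M (space M)
           + ennreal (l powr (1 - q)) * (\<integral>\<^sup>+x. epowr (u x) q \<partial>M)"
proof -
  have "(\<integral>\<^sup>+x. u x \<partial>M) \<le> (\<integral>\<^sup>+x. ennreal l + ennreal (l powr (1 - q)) * epowr (u x) q \<partial>M)"
    using assms by (intro nn_integral_mono le_cut_plus_epowr)
  also have "\<dots> = ennreal l * emeasure M (space M) + ennreal (l powr (1 - q)) * (\<integral>\<^sup>+x. epowr (u x) q \<partial>M)"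
    by (simp add: nn_integral_add nn_integral_cmult)
  finally show ?thesis .
qed

lemma ex_dyadic_between:
  assumes "t0 > (0::real)" obtains i :: int where "t0 \<le> 2 powr i" "2 powr i \<le> 2 * t0"
proof
  let ?i = "\<lceil>log 2 t0\<rceil>"
  have "t0 = 2 powr (log 2 t0)" using assms by simp
  also have "\<dots> \<le> 2 powr ?i" by (intro powr_mono) auto
  finally show "t0 \<le> 2 powr ?i" .
  have "2 powr ?i \<le> 2 powr (log 2 t0 + 1)" by (intro powr_mono) linarith+
  also have "\<dots> = 2 * t0" using assms by (simp add: powr_add)
  finally show "2 powr ?i \<le> 2 * t0" .
qed

text \<open>
  Only the volume of \<open>S\<close> enters here: the substitution \<open>y = x + t h\<close> turns the integral of
  \<open>|f|\<^sup>q\<close> over the translated and dilated set into a part of \<open>A / t\<^sup>N\<close>. The last assumption says that \<open>t\<close> is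
  so large that the second term of the cut inequality is no larger than the first.
\<close>

lemma average_translates_bound:
  fixes f :: "'a::euclidean_space \<Rightarrow> real"
  assumes [measurable]: "f \<in> borel_measurable borel" "S \<in> sets borel"
    and S: "emeasure lborel S = ennreal V" "0 < V" and "1 \<le> q" "0 < t"
    and A: "Lp_energy q f = ennreal A" "0 \<le> A" and "l > 0"
    and t: "A * l powr (- q) / V \<le> t ^ DIM('a)"
  shows "(\<integral>\<^sup>+h\<in>S. ennreal \<bar>f (x + t *\<^sub>R h)\<bar> \<partial>lborel) \<le> ennreal (2 * l * V)"
proof -
  let ?D = "DIM('a)"
  have "(\<integral>\<^sup>+h\<in>S. ennreal \<bar>f (x + t *\<^sub>R h)\<bar> \<partial>lborel) = (\<integral>\<^sup>+h. ennreal \<bar>f (x + t *\<^sub>R h)\<bar> \<partial>restrict_space lborel S)"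
    by (simp add: nn_integral_restrict_space)
  also have "\<dots> \<le> ennreal l * ennreal V
      + ennreal (l powr (1 - q)) * (\<integral>\<^sup>+h. epowr (ennreal \<bar>f (x + t *\<^sub>R h)\<bar>) q \<partial>restrict_space lborel S)"
  proof -
    have "(\<lambda>h. ennreal \<bar>f (x + t *\<^sub>R h)\<bar>) \<in> borel_measurable (restrict_space lborel S)"
      by (intro measurable_restrict_space1) measurable
    from nn_integral_cut_bound[OF this \<open>l > 0\<close> \<open>1 \<le> q\<close>] show ?thesis
      using S by (simp add: emeasure_restrict_space)
  qed
  also have "(\<integral>\<^sup>+h. epowr (ennreal \<bar>f (x + t *\<^sub>R h)\<bar>) q \<partial>restrict_space lborel S)
      \<le> (\<integral>\<^sup>+h. ennreal (\<bar>f (x + t *\<^sub>R h)\<bar> powr q) \<partial>lborel)"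
    using \<open>1 \<le> q\<close>
    by (auto simp: nn_integral_restrict_space epowr_ennreal intro!: nn_integral_mono split: split_indicator)
  also have "\<dots> = ennreal (1 / t ^ ?D) * ennreal A"
    using \<open>0 < t\<close> A
    by (subst nn_integral_lborel_affine) (auto simp: Lp_energy_def nn_integral_completion)
  also have "ennreal l * ennreal V + ennreal (l powr (1 - q)) * (ennreal (1 / t ^ ?D) * ennreal A)
      = ennreal (l * V + l powr (1 - q) * (A / t ^ ?D))"
    using \<open>l > 0\<close> \<open>0 < t\<close> S A by (simp add: ennreal_mult[symmetric] ennreal_plus[symmetric] del: ennreal_plus)
  also have "\<dots> \<le> ennreal (2 * l * V)"
  proof (rule ennreal_leI)
    have "A * l powr (- q) \<le> V * t ^ ?D" using t S by (simp add: field_simps)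
    then have "l * (A * l powr (- q)) \<le> l * (V * t ^ ?D)" using \<open>l > 0\<close> by (intro mult_left_mono) auto
    moreover have "l powr (1 - q) = l * l powr (- q)" using \<open>l > 0\<close> by (simp add: powr_diff powr_minus field_simps)
    ultimately have "l powr (1 - q) * A \<le> l * V * t ^ ?D" by (simp add: algebra_simps)
    then have "l powr (1 - q) * (A / t ^ ?D) \<le> l * V" using \<open>0 < t\<close> by (simp add: divide_le_eq)
    then show "l * V + l powr (1 - q) * (A / t ^ ?D) \<le> 2 * l * V" by linarith
  qed
  finally show ?thesis by (auto simp: add_left_mono mult_left_mono)
qed

text \<open>
  The scale is chosen after the point: \<open>t\<close> is a dyadic number comparable to a scale at which the
  averages of the translates \<open>f (x + j t h)\<close> together amount to at most half of \<open>y = |f x|\<close>. The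
  other half has to come from the difference, which is at most \<open>t\<^sup>s\<^sup>p g\<close> in \<open>p\<close>-th power; inserting
  \<open>t\<^sup>N \<approx> C y\<^sup>-\<^sup>q A / V\<close> and using \<open>p + q s p / N = q\<close> gives the bound.
\<close>

lemma pointwise_bound_by_scaled_differences:
  fixes f :: "'a::euclidean_space \<Rightarrow> real"
  defines "N \<equiv> real DIM('a)"
  assumes f[measurable]: "f \<in> borel_measurable borel" and S[measurable]: "S \<in> sets borel"
    and V: "emeasure lborel S = ennreal V" "0 < V" and p: "1 \<le> p" and s: "0 < s" "s * p < N"
    and q: "q = N * p / (N - s * p)"
    and A: "Lp_energy q f = ennreal A" "0 < A"
    and G: "\<And>i::int. (\<integral>\<^sup>+h\<in>S. ennreal (\<bar>(fdiff ((2 powr i) *\<^sub>R h) ^^ m) f x\<bar> powr p) \<partial>lborel)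
              \<le> ennreal (V * (2 powr i) powr (s * p)) * g"
  shows "ennreal (\<bar>f x\<bar> powr q) \<le>
    ennreal (4 powr p * 2 powr (s * p) * (4 * 2 ^ m) powr (q * (s * p / N)) * (A / V) powr (s * p / N)) * g"
proof (cases "f x = 0 \<or> g = top")
  case True
  then show ?thesis using A V by (auto simp: ennreal_mult_top)
next
  case False
  then obtain g' where g': "g = ennreal g'" "0 \<le> g'" by (cases g) auto
  define y where "y = \<bar>f x\<bar>"
  have y: "0 < y" using False by (simp add: y_def)
  define c :: real where "c = 2 ^ m"
  have c: "0 < c" by (simp add: c_def)
  \<comment> \<open>\<open>c\<close> bounds the sum of the binomial coefficients; each translate may contribute \<open>2 l\<close>\<close>
  define l where "l = y / (4 * c)"
  have l: "0 < l" using y c by (simp add: l_def)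
  have "0 < N" by (simp add: N_def)
  have Nsp: "0 < N - s * p" using s by simp
  have "p * (N - s * p) \<le> N * p" using p s by (simp add: algebra_simps)
  then have "p \<le> q" using Nsp by (simp add: q field_simps)
  with p have "1 \<le> q" by simp
  \<comment> \<open>the scale at which the averages over translates are of size \<open>l\<close>\<close>
  define t0 where "t0 = (A * l powr (- q) / V) powr (1 / N)"
  have "t0 > 0" using A V l by (simp add: t0_def)
  then obtain i :: int where i: "t0 \<le> 2 powr i" "2 powr i \<le> 2 * t0" by (rule ex_dyadic_between)
  define t where "t = 2 powr real_of_int i"
  have t: "0 < t" "t0 \<le> t" "t \<le> 2 * t0" using i by (auto simp: t_def)
  have t0N: "t0 ^ DIM('a) = A * l powr (- q) / V"
    using A V l by (simp add: t0_def powr_powr N_def flip: powr_realpow)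
  have tN: "A * l powr (- q) / V \<le> t ^ DIM('a)"
    using t \<open>t0 > 0\<close> unfolding t0N[symmetric] by (intro power_mono) auto
  let ?F = "\<lambda>h. ennreal \<bar>(fdiff (t *\<^sub>R h) ^^ m) f x\<bar>"
  have "ennreal (V * y) = (\<integral>\<^sup>+h\<in>S. ennreal y \<partial>lborel)"
    using V y by (simp add: nn_integral_cmult_indicator ennreal_mult' mult.commute)
  also have "\<dots> \<le> (\<integral>\<^sup>+h. ?F h * indicator S h
      + (\<Sum>j\<in>{1..m}. ennreal (real (m choose j)) * (ennreal \<bar>f (x + (real j * t) *\<^sub>R h)\<bar> * indicator S h)) \<partial>lborel)"
  proof (rule nn_integral_mono)
    fix h
    have "ennreal y \<le> ennreal (\<bar>(fdiff (t *\<^sub>R h) ^^ m) f x\<bar> + (\<Sum>j\<in>{1..m}. real (m choose j) * \<bar>f (x + (real j * t) *\<^sub>R h)\<bar>))"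
      unfolding y_def using abs_le_fdiff_iterate[of f x m "t *\<^sub>R h"] by (intro ennreal_leI) simp
    also have "\<dots> = ?F h + (\<Sum>j\<in>{1..m}. ennreal (real (m choose j)) * ennreal \<bar>f (x + (real j * t) *\<^sub>R h)\<bar>)"
      by (simp add: sum_nonneg ennreal_mult' flip: sum_ennreal)
    finally show "ennreal y * indicator S h \<le> ?F h * indicator S h
      + (\<Sum>j\<in>{1..m}. ennreal (real (m choose j)) * (ennreal \<bar>f (x + (real j * t) *\<^sub>R h)\<bar> * indicator S h))"
      by (auto split: split_indicator)
  qed
  also have "\<dots> = (\<integral>\<^sup>+h\<in>S. ?F h \<partial>lborel)
      + (\<Sum>j\<in>{1..m}. ennreal (real (m choose j)) * (\<integral>\<^sup>+h\<in>S. ennreal \<bar>f (x + (real j * t) *\<^sub>R h)\<bar> \<partial>lborel))"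
    by (simp add: nn_integral_add nn_integral_sum nn_integral_cmult)
  also have "(\<Sum>j\<in>{1..m}. ennreal (real (m choose j)) * (\<integral>\<^sup>+h\<in>S. ennreal \<bar>f (x + (real j * t) *\<^sub>R h)\<bar> \<partial>lborel))
      \<le> (\<Sum>j\<in>{1..m}. ennreal (real (m choose j)) * ennreal (2 * l * V))"
  proof (intro sum_mono mult_left_mono)
    fix j assume "j \<in> {1..m}"
    then have j: "1 \<le> real j" by simp
    show "(\<integral>\<^sup>+h\<in>S. ennreal \<bar>f (x + (real j * t) *\<^sub>R h)\<bar> \<partial>lborel) \<le> ennreal (2 * l * V)"
    proof (rule average_translates_bound[OF f S V \<open>1 \<le> q\<close> _ A(1) _ l])
      have "t ^ DIM('a) \<le> (real j * t) ^ DIM('a)" using j t by (intro power_mono) auto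
      with tN show "A * l powr (- q) / V \<le> (real j * t) ^ DIM('a)" by simp
    qed (use j t A in auto)
  qed simp
  also have "\<dots> = ennreal ((\<Sum>j\<in>{1..m}. real (m choose j)) * (2 * l * V))"
    using l V by (simp add: ennreal_mult'[symmetric] sum_distrib_right)
  also have "\<dots> \<le> ennreal (c * (2 * l * V))"
    using sum_choose_le[of m] l V by (intro ennreal_leI mult_right_mono) (auto simp: c_def)
  \<comment> \<open>the translates account for half of the left-hand side\<close>
  also have "c * (2 * l * V) = V * y / 2" using c by (simp add: l_def)
  also have "(\<integral>\<^sup>+h\<in>S. ?F h \<partial>lborel) \<le> ennreal (y / 4 * V + (y / 4) powr (1 - p) * (V * t powr (s * p) * g'))"
  proof -
    have "(\<integral>\<^sup>+h\<in>S. ?F h \<partial>lborel) = (\<integral>\<^sup>+h. ?F h \<partial>restrict_space lborel S)"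
      by (simp add: nn_integral_restrict_space)
    also have "\<dots> \<le> ennreal (y / 4) * ennreal V
      + ennreal ((y / 4) powr (1 - p)) * (\<integral>\<^sup>+h. epowr (?F h) p \<partial>restrict_space lborel S)"
    proof -
      have "?F \<in> borel_measurable (restrict_space lborel S)"
        by (intro measurable_restrict_space1) measurable
      from nn_integral_cut_bound[OF this _ p, of "y / 4"] show ?thesis
        using V y by (simp add: emeasure_restrict_space)
    qed
    also have "(\<integral>\<^sup>+h. epowr (?F h) p \<partial>restrict_space lborel S)
        = (\<integral>\<^sup>+h\<in>S. ennreal (\<bar>(fdiff (t *\<^sub>R h) ^^ m) f x\<bar> powr p) \<partial>lborel)"
      using p by (simp add: nn_integral_restrict_space epowr_ennreal)
    also have "\<dots> \<le> ennreal (V * t powr (s * p)) * ennreal g'"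
      using G[of i] by (simp add: t_def g')
    finally show ?thesis using y V t g'
      by (simp add: ennreal_mult'[symmetric] ennreal_plus[symmetric] del: ennreal_plus)
        (simp add: add_left_mono mult_left_mono)
  qed
  finally have "ennreal (V * y) \<le> ennreal (y / 4 * V + (y / 4) powr (1 - p) * (V * t powr (s * p) * g') + V * y / 2)"
    using y V g' by (simp add: ennreal_plus[symmetric] add_mono del: ennreal_plus)
  then have "V * y \<le> y / 4 * V + (y / 4) powr (1 - p) * (V * t powr (s * p) * g') + V * y / 2"
    using y V g' by (subst (asm) ennreal_le_iff) auto
  then have "V * (y / 4) \<le> V * ((y / 4) powr (1 - p) * (t powr (s * p) * g'))"
    by (simp add: algebra_simps)
  then have "y / 4 \<le> (y / 4) powr (1 - p) * (t powr (s * p) * g')" using V by simp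
  then have "(y / 4) powr (p - 1) * (y / 4) \<le> (y / 4) powr (p - 1) * ((y / 4) powr (1 - p) * (t powr (s * p) * g'))"
    using y by (intro mult_left_mono) auto
  moreover have "(y / 4) powr (p - 1) * (y / 4) = (y / 4) powr p"
    using y by (simp add: powr_diff)
  moreover have "(y / 4) powr (p - 1) * ((y / 4) powr (1 - p) * (t powr (s * p) * g')) = t powr (s * p) * g'"
    using y by (simp add: mult.assoc[symmetric] powr_add[symmetric])
  ultimately have "(y / 4) powr p \<le> t powr (s * p) * g'" by simp
  also have "\<dots> \<le> (2 * t0) powr (s * p) * g'"
    using t s p g' by (intro mult_right_mono powr_mono2) auto
  also have "(2 * t0) powr (s * p) = 2 powr (s * p) * (A * l powr (- q) / V) powr (s * p / N)"
    using \<open>t0 > 0\<close> by (simp add: powr_mult t0_def powr_powr)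
  also have "(A * l powr (- q) / V) powr (s * p / N) = (A / V) powr (s * p / N) * l powr (- (q * (s * p / N)))"
    using A V l by (simp add: powr_mult powr_divide powr_powr)
  also have "l powr (- (q * (s * p / N))) = (4 * c) powr (q * (s * p / N)) * y powr (- (q * (s * p / N)))"
    using y c by (simp add: l_def powr_divide powr_minus field_simps)
  finally have "(y / 4) powr p * y powr (q * (s * p / N)) \<le>
      2 powr (s * p) * ((A / V) powr (s * p / N) * ((4 * c) powr (q * (s * p / N)) * y powr (- (q * (s * p / N))))) * g'
        * y powr (q * (s * p / N))"
    by (rule mult_right_mono) simp
  also have "\<dots> = 2 powr (s * p) * (A / V) powr (s * p / N) * (4 * c) powr (q * (s * p / N)) * g'"
    using y by (simp add: powr_minus field_simps)
  also have "(y / 4) powr p * y powr (q * (s * p / N)) = y powr q / 4 powr p"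
  proof -
    have "q * (N - s * p) = N * p" using Nsp by (simp add: q)
    then have "p + q * (s * p / N) = q" using \<open>0 < N\<close> by (simp add: field_simps)
    then show ?thesis using y by (simp add: powr_divide powr_add[symmetric])
  qed
  finally have "y powr q \<le> 4 powr p * (2 powr (s * p) * (A / V) powr (s * p / N) * (4 * c) powr (q * (s * p / N)) * g')"
    by (simp add: field_simps)
  then show ?thesis
    unfolding g' y_def[symmetric] c_def[symmetric] using g' 
    by (simp add: ennreal_mult'[symmetric] ennreal_leI mult_ac)
qed

lemma sobolev_from_scaled_differences:
  fixes f :: "'a::euclidean_space \<Rightarrow> real"
  defines "N \<equiv> real DIM('a)"
  assumes f[measurable]: "f \<in> borel_measurable borel" and S[measurable]: "S \<in> sets borel"
    and V: "emeasure lborel S = ennreal V" "0 < V" and p: "1 \<le> p" and s: "0 < s" "s * p < N"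
    and q: "q = N * p / (N - s * p)"
    and A: "Lp_energy q f = ennreal A" "0 < A"
    and G: "AE x in lborel. \<forall>i::int.
        (\<integral>\<^sup>+h\<in>S. ennreal (\<bar>(fdiff ((2 powr i) *\<^sub>R h) ^^ m) f x\<bar> powr p) \<partial>lborel)
              \<le> ennreal (V * (2 powr i) powr (s * p)) * G x"
    and Gm[measurable]: "G \<in> borel_measurable borel"
    and GB: "(\<integral>\<^sup>+x. G x \<partial>lborel) \<le> ennreal B" "0 \<le> B"
  shows "V powr (s * p / N) * A powr (1 - s * p / N) \<le>
    4 powr p * 2 powr (s * p) * (4 * 2 ^ m) powr (q * (s * p / N)) * B"
proof -
  let ?K = "4 powr p * 2 powr (s * p) * (4 * 2 ^ m) powr (q * (s * p / N))"
  have "ennreal A = (\<integral>\<^sup>+x. ennreal (\<bar>f x\<bar> powr q) \<partial>lborel)"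
    using A by (simp add: Lp_energy_def nn_integral_completion)
  also have "\<dots> \<le> (\<integral>\<^sup>+x. ennreal (?K * (A / V) powr (s * p / N)) * G x \<partial>lborel)"
  proof (rule nn_integral_mono_AE, use G in eventually_elim)
    case (elim x)
    then show ?case
      using pointwise_bound_by_scaled_differences[OF f S V p s[unfolded N_def] q[unfolded N_def] A, of m x "G x"]
      by (simp add: N_def)
  qed
  also have "\<dots> = ennreal (?K * (A / V) powr (s * p / N)) * (\<integral>\<^sup>+x. G x \<partial>lborel)"
    by (rule nn_integral_cmult) simp
  also have "\<dots> \<le> ennreal (?K * (A / V) powr (s * p / N)) * ennreal B"
    using GB by (intro mult_left_mono) auto
  finally have "A \<le> ?K * (A / V) powr (s * p / N) * B"
    using A V GB by (simp add: ennreal_mult'[symmetric])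
  then have "A * (A powr (- (s * p / N)) * V powr (s * p / N)) \<le>
      ?K * (A / V) powr (s * p / N) * B * (A powr (- (s * p / N)) * V powr (s * p / N))"
    by (rule mult_right_mono) simp
  also have "\<dots> = ?K * B * ((A / V) powr (s * p / N) * (A powr (- (s * p / N)) * V powr (s * p / N)))"
    by (simp only: mult_ac)
  also have "(A / V) powr (s * p / N) * (A powr (- (s * p / N)) * V powr (s * p / N)) = 1"
    using A V by (simp add: powr_divide powr_minus field_simps)
  also have "A * (A powr (- (s * p / N)) * V powr (s * p / N)) = V powr (s * p / N) * A powr (1 - s * p / N)"
    using A by (simp add: powr_diff powr_minus field_simps)
  finally show ?thesis by simp
qed

section \<open>Fractional order: the majorant\<close>

text \<open>
  Because \<open>S\<close> is star-shaped, \<open>t S \<subseteq> \<tau> S\<close>; the factor compares the volumes of the two dilates.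
\<close>

lemma scaled_average_mono:
  fixes S :: "'a::euclidean_space set" and \<phi> :: "'a \<Rightarrow> ennreal"
  assumes [measurable]: "\<phi> \<in> borel_measurable borel" "S \<in> sets borel"
    and star: "\<And>h r. h \<in> S \<Longrightarrow> 0 < r \<Longrightarrow> r \<le> 1 \<Longrightarrow> r *\<^sub>R h \<in> S"
    and t: "0 < t" "t \<le> \<tau>" "\<tau> \<le> 2 * t"
  shows "(\<integral>\<^sup>+h\<in>S. \<phi> (t *\<^sub>R h) \<partial>lborel) \<le> ennreal (2 ^ DIM('a)) * (\<integral>\<^sup>+h\<in>S. \<phi> (\<tau> *\<^sub>R h) \<partial>lborel)"
proof -
  let ?r = "t / \<tau>"
  have r: "0 < ?r" "?r \<le> 1" "1 / ?r \<le> 2" "0 < \<tau>" using t by (auto simp: field_simps)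
  have "(\<integral>\<^sup>+h\<in>S. \<phi> (t *\<^sub>R h) \<partial>lborel) \<le> (\<integral>\<^sup>+h. \<phi> (\<tau> *\<^sub>R (0 + ?r *\<^sub>R h)) * indicator S (0 + ?r *\<^sub>R h) \<partial>lborel)"
    using star r by (intro nn_integral_mono) (auto split: split_indicator)
  also have "\<dots> = ennreal (1 / ?r ^ DIM('a)) * (\<integral>\<^sup>+h\<in>S. \<phi> (\<tau> *\<^sub>R h) \<partial>lborel)"
    using r by (subst nn_integral_lborel_affine[where g = "\<lambda>h. \<phi> (\<tau> *\<^sub>R h) * indicator S h"]) auto
  also have "\<dots> \<le> ennreal (2 ^ DIM('a)) * (\<integral>\<^sup>+h\<in>S. \<phi> (\<tau> *\<^sub>R h) \<partial>lborel)"
  proof (intro mult_right_mono ennreal_leI)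
    have "1 / ?r ^ DIM('a) = (1 / ?r) ^ DIM('a)" by (simp add: power_divide)
    also have "\<dots> \<le> 2 ^ DIM('a)" using r t by (intro power_mono) auto
    finally show "1 / ?r ^ DIM('a) \<le> 2 ^ DIM('a)" .
  qed simp
  finally show ?thesis .
qed

text \<open>
  \<open>G x\<close> is a multiple of the average over \<open>S\<close> of the integral in \<open>\<tau>\<close> that, once integrated in
  \<open>x\<close>, gives \<open>I h\<close>; so its own integral is bounded by Fubini's theorem. A single scale \<open>t\<close> is
  controlled by the part \<open>t \<le> \<tau> \<le> 2 t\<close> of the integral.
\<close>

lemma fractional_majorant:
  fixes f :: "'a::euclidean_space \<Rightarrow> real" and S :: "'a set" and s p :: real and m :: nat
  defines "I \<equiv> \<lambda>h. \<integral>\<^sup>+\<tau>\<in>{0<..}. ennreal (\<tau> powr (- s * p - 1)) * 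
      (\<integral>\<^sup>+x. ennreal (\<bar>(fdiff (\<tau> *\<^sub>R h) ^^ m) f x\<bar> powr p) \<partial>lborel) \<partial>lborel"
  assumes [measurable]: "f \<in> borel_measurable borel" "S \<in> sets borel"
    and V: "emeasure lborel S = ennreal V" "0 < V"
    and star: "\<And>h r. h \<in> S \<Longrightarrow> 0 < r \<Longrightarrow> r \<le> 1 \<Longrightarrow> r *\<^sub>R h \<in> S"
    and I: "\<And>h. h \<in> S \<Longrightarrow> I h \<le> 1" and sp: "0 < s" "0 < p"
  obtains G where "G \<in> borel_measurable borel"
    "\<And>x t. 0 < t \<Longrightarrow> (\<integral>\<^sup>+h\<in>S. ennreal (\<bar>(fdiff (t *\<^sub>R h) ^^ m) f x\<bar> powr p) \<partial>lborel)
        \<le> ennreal (V * t powr (s * p)) * G x"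
    "(\<integral>\<^sup>+x. G x \<partial>lborel) \<le> ennreal (2 powr (s * p + 1) * 2 ^ DIM('a))"
proof -
  define c where "c = 2 powr (s * p + 1) * 2 ^ DIM('a)"
  have c: "0 < c" by (simp add: c_def)
  define D where "D t x = (\<integral>\<^sup>+h\<in>S. ennreal (\<bar>(fdiff (t *\<^sub>R h) ^^ m) f x\<bar> powr p) \<partial>lborel)" for t x
  have D_meas[measurable]: "(\<lambda>w. D (fst w) (snd w)) \<in> borel_measurable (lborel \<Otimes>\<^sub>M lborel)"
    unfolding D_def by measurable
  define G where "G x = ennreal (c / V) * (\<integral>\<^sup>+\<tau>\<in>{0<..}. ennreal (\<tau> powr (- s * p - 1)) * D \<tau> x \<partial>lborel)" for x
  have Dm1[measurable]: "(\<lambda>t. D t x) \<in> borel_measurable lborel" for x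
    using measurable_compose[OF _ D_meas, of "\<lambda>t. (t, x)" lborel] by simp
  have Dm2[measurable]: "(\<lambda>x. D t x) \<in> borel_measurable lborel" for t
    using measurable_compose[OF _ D_meas, of "\<lambda>x. (t, x)" lborel] by simp
  show thesis
  proof
    have "(\<lambda>x. \<integral>\<^sup>+\<tau>\<in>{0<..}. ennreal (\<tau> powr (- s * p - 1)) * D \<tau> x \<partial>lborel) \<in> borel_measurable lborel"
    proof (rule lborel.borel_measurable_nn_integral)
      have "(\<lambda>w. D (snd w) (fst w)) \<in> borel_measurable (lborel \<Otimes>\<^sub>M lborel)"
        using measurable_compose[OF _ D_meas, of "\<lambda>w. (snd w, fst w)" "lborel \<Otimes>\<^sub>M lborel"] by simp
      then show "(\<lambda>(x, \<tau>). ennreal (\<tau> powr (- s * p - 1)) * D \<tau> x * indicator {0<..} \<tau>)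
          \<in> borel_measurable (lborel \<Otimes>\<^sub>M lborel)"
        by (simp add: case_prod_beta')
    qed
    then show "G \<in> borel_measurable borel" unfolding G_def by simp
  next
    fix x :: 'a and t :: real assume t: "0 < t"
    have "ennreal (1 / c * t powr (- s * p)) * D t x =
        ennreal ((2 * t) powr (- s * p - 1) * (1 / 2 ^ DIM('a))) * D t x * emeasure lborel {t..2 * t}"
    proof -
      have "1 / c * t powr (- s * p) = (2 * t) powr (- s * p - 1) * (1 / 2 ^ DIM('a)) * t"
        using t by (simp add: c_def powr_diff powr_minus powr_add powr_mult field_simps)
      then have "ennreal (1 / c * t powr (- s * p)) =
          ennreal ((2 * t) powr (- s * p - 1) * (1 / 2 ^ DIM('a))) * ennreal t"
        using t by (simp add: ennreal_mult'[symmetric])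
      then show ?thesis using t by (simp add: mult_ac)
    qed
    also have "\<dots> = (\<integral>\<^sup>+\<tau>\<in>{t..2 * t}. ennreal ((2 * t) powr (- s * p - 1) * (1 / 2 ^ DIM('a))) * D t x \<partial>lborel)"
      by (subst nn_integral_cmult_indicator) auto
    also have "\<dots> \<le> (\<integral>\<^sup>+\<tau>\<in>{0<..}. ennreal (\<tau> powr (- s * p - 1)) * D \<tau> x \<partial>lborel)"
    proof (rule nn_integral_mono)
      fix \<tau> :: real
      have "ennreal ((2 * t) powr (- s * p - 1) * (1 / 2 ^ DIM('a))) * D t x \<le> ennreal (\<tau> powr (- s * p - 1)) * D \<tau> x"
        if "t \<le> \<tau>" "\<tau> \<le> 2 * t"
      proof -
        have "D t x \<le> ennreal (2 ^ DIM('a)) * D \<tau> x"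
          unfolding D_def using t that star
          by (intro scaled_average_mono[of "\<lambda>h. ennreal (\<bar>(fdiff h ^^ m) f x\<bar> powr p)"]) auto
        then have "ennreal (1 / 2 ^ DIM('a)) * D t x \<le> ennreal (1 / 2 ^ DIM('a)) * (ennreal (2 ^ DIM('a)) * D \<tau> x)"
          by (rule mult_left_mono) simp
        also have "\<dots> = D \<tau> x" by (simp add: mult.assoc[symmetric] ennreal_mult[symmetric])
        finally have "ennreal (1 / 2 ^ DIM('a)) * D t x \<le> D \<tau> x" .
        moreover have "(2 * t) powr (- s * p - 1) \<le> \<tau> powr (- s * p - 1)"
        proof -
          have "- s * p - 1 \<le> 0" using sp by (smt (verit) mult_pos_pos mult_minus_left)
          then show ?thesis using that t by (intro powr_mono2') auto
        qed
        ultimately show ?thesis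
          by (subst ennreal_mult', simp, subst mult.assoc, intro mult_mono ennreal_leI) auto
      qed
      then show "ennreal ((2 * t) powr (- s * p - 1) * (1 / 2 ^ DIM('a))) * D t x * indicator {t..2 * t} \<tau>
        \<le> ennreal (\<tau> powr (- s * p - 1)) * D \<tau> x * indicator {0<..} \<tau>"
        using t by (auto split: split_indicator)
    qed
    finally have "ennreal (c * t powr (s * p)) * (ennreal (1 / c * t powr (- s * p)) * D t x)
      \<le> ennreal (c * t powr (s * p)) * (\<integral>\<^sup>+\<tau>\<in>{0<..}. ennreal (\<tau> powr (- s * p - 1)) * D \<tau> x \<partial>lborel)"
      by (rule mult_left_mono) simp
    also have "ennreal (c * t powr (s * p)) * (ennreal (1 / c * t powr (- s * p)) * D t x) = D t x"
    proof -
      have "t powr (s * p) * t powr (- s * p) = 1" using t by (simp add: powr_add[symmetric])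
      then have "c * t powr (s * p) * (1 / c * t powr (- s * p)) = 1" using c by simp
      moreover have "ennreal (c * t powr (s * p)) * ennreal (1 / c * t powr (- s * p))
          = ennreal (c * t powr (s * p) * (1 / c * t powr (- s * p)))"
        using c by (intro ennreal_mult[symmetric]) auto
      ultimately show ?thesis by (simp add: mult.assoc[symmetric])
    qed
    also have "ennreal (c * t powr (s * p)) = ennreal (V * t powr (s * p)) * ennreal (c / V)"
      using c V by (simp add: ennreal_mult[symmetric])
    finally show "(\<integral>\<^sup>+h\<in>S. ennreal (\<bar>(fdiff (t *\<^sub>R h) ^^ m) f x\<bar> powr p) \<partial>lborel)
        \<le> ennreal (V * t powr (s * p)) * G x"
      by (simp add: D_def G_def mult.assoc)
  next
    let ?w = "\<lambda>\<tau>. ennreal (\<tau> powr (- s * p - 1)) * indicator {0<..} \<tau>"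
    let ?E = "\<lambda>\<tau> h x. ennreal (\<bar>(fdiff (\<tau> *\<^sub>R h) ^^ m) f x\<bar> powr p)"
    have [measurable]: "(\<lambda>w. D (snd w) (fst w)) \<in> borel_measurable (lborel \<Otimes>\<^sub>M lborel)"
      using measurable_compose[OF _ D_meas, of "\<lambda>w. (snd w, fst w)" "lborel \<Otimes>\<^sub>M lborel"] by simp
    have "(\<integral>\<^sup>+x. G x \<partial>lborel) = ennreal (c / V) * (\<integral>\<^sup>+x. \<integral>\<^sup>+\<tau>. ?w \<tau> * D \<tau> x \<partial>lborel \<partial>lborel)"
      unfolding G_def by (subst nn_integral_cmult) (auto simp: mult_ac case_prod_beta')
    also have "(\<integral>\<^sup>+x. \<integral>\<^sup>+\<tau>. ?w \<tau> * D \<tau> x \<partial>lborel \<partial>lborel) = (\<integral>\<^sup>+\<tau>. \<integral>\<^sup>+x. ?w \<tau> * D \<tau> x \<partial>lborel \<partial>lborel)"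
      by (rule lborel_pair.Fubini') (simp add: case_prod_beta')
    also have "\<dots> = (\<integral>\<^sup>+\<tau>. ?w \<tau> * (\<integral>\<^sup>+h. indicator S h * (\<integral>\<^sup>+x. ?E \<tau> h x \<partial>lborel) \<partial>lborel) \<partial>lborel)"
    proof (rule nn_integral_cong)
      fix \<tau>
      have "(\<integral>\<^sup>+x. ?w \<tau> * D \<tau> x \<partial>lborel) = ?w \<tau> * (\<integral>\<^sup>+x. D \<tau> x \<partial>lborel)"
        by (rule nn_integral_cmult) simp
      also have "(\<integral>\<^sup>+x. D \<tau> x \<partial>lborel) = (\<integral>\<^sup>+x. \<integral>\<^sup>+h. indicator S h * ?E \<tau> h x \<partial>lborel \<partial>lborel)"
        unfolding D_def by (simp add: mult_ac)
      also have "\<dots> = (\<integral>\<^sup>+h. \<integral>\<^sup>+x. indicator S h * ?E \<tau> h x \<partial>lborel \<partial>lborel)"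
        by (rule lborel_pair.Fubini') (simp add: case_prod_beta')
      also have "\<dots> = (\<integral>\<^sup>+h. indicator S h * (\<integral>\<^sup>+x. ?E \<tau> h x \<partial>lborel) \<partial>lborel)"
        by (simp add: nn_integral_cmult)
      finally show "(\<integral>\<^sup>+x. ?w \<tau> * D \<tau> x \<partial>lborel) = ?w \<tau> * (\<integral>\<^sup>+h. indicator S h * (\<integral>\<^sup>+x. ?E \<tau> h x \<partial>lborel) \<partial>lborel)" .
    qed
    also have "\<dots> = (\<integral>\<^sup>+\<tau>. \<integral>\<^sup>+h. ?w \<tau> * (indicator S h * (\<integral>\<^sup>+x. ?E \<tau> h x \<partial>lborel)) \<partial>lborel \<partial>lborel)"
      by (simp add: nn_integral_cmult)
    also have "\<dots> = (\<integral>\<^sup>+h. \<integral>\<^sup>+\<tau>. ?w \<tau> * (indicator S h * (\<integral>\<^sup>+x. ?E \<tau> h x \<partial>lborel)) \<partial>lborel \<partial>lborel)"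
      by (rule lborel_pair.Fubini') (simp add: case_prod_beta')
    also have "\<dots> = (\<integral>\<^sup>+h. indicator S h * I h \<partial>lborel)"
      unfolding I_def by (intro nn_integral_cong, subst nn_integral_cmult[symmetric]) (auto simp: mult_ac)
    also have "\<dots> \<le> (\<integral>\<^sup>+h. indicator S h \<partial>lborel)"
      using I by (intro nn_integral_mono) (auto split: split_indicator)
    also have "\<dots> = ennreal V" using V by simp
    finally have "(\<integral>\<^sup>+x. G x \<partial>lborel) \<le> ennreal (c / V) * ennreal V"
      by (simp add: mult_left_mono)
    then show "(\<integral>\<^sup>+x. G x \<partial>lborel) \<le> ennreal (2 powr (s * p + 1) * 2 ^ DIM('a))"
      using V c by (simp add: ennreal_mult[symmetric] c_def)
  qed
qed

section \<open>Maximal functions along lines\<close>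

text \<open>
  The interval is half-open so that intervals of integer length split into disjoint translates.
\<close>

definition line_avg :: "'a::euclidean_space \<Rightarrow> ('a \<Rightarrow> ennreal) \<Rightarrow> 'a \<Rightarrow> ennreal" where
  "line_avg h g x = (\<integral>\<^sup>+u\<in>{0..<1}. g (x + u *\<^sub>R h) \<partial>lborel)"

text \<open>
  A supremum over dyadic scales is countable, which keeps it measurable, and all scales down to
  \<open>2\<^sup>-\<^sup>M\<close> are multiples of a single one, which reduces it to a discrete maximal function.
\<close>

definition line_max :: "'a::euclidean_space \<Rightarrow> ('a \<Rightarrow> ennreal) \<Rightarrow> 'a \<Rightarrow> ennreal" where
  "line_max h g x = (SUP i::int. line_avg ((2 powr i) *\<^sub>R h) g x)"

lemma measurable_line_avg_pair:
  assumes [measurable]: "(\<lambda>(w, x). g w x) \<in> borel_measurable (M \<Otimes>\<^sub>M borel)" "k \<in> M \<rightarrow>\<^sub>M borel"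
  shows "(\<lambda>(w, x). line_avg (k w) (g w) x) \<in> borel_measurable (M \<Otimes>\<^sub>M borel)"
proof -
  have 1: "(\<lambda>z. (fst (fst z), snd (fst z) + snd z *\<^sub>R k (fst (fst z)))) \<in> (M \<Otimes>\<^sub>M borel) \<Otimes>\<^sub>M lborel \<rightarrow>\<^sub>M M \<Otimes>\<^sub>M borel"
    by measurable
  have "(\<lambda>z. g (fst (fst z)) (snd (fst z) + snd z *\<^sub>R k (fst (fst z)))) \<in> borel_measurable ((M \<Otimes>\<^sub>M borel) \<Otimes>\<^sub>M lborel)"
    using measurable_compose[OF 1 assms(1)] by simp
  then show ?thesis
    unfolding line_avg_def case_prod_beta'
    by (intro lborel.borel_measurable_nn_integral) (simp add: case_prod_beta')
qed

lemma measurable_line_avg [measurable]: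
  assumes "g \<in> borel_measurable borel" shows "line_avg h g \<in> borel_measurable borel"
proof -
  have "(\<lambda>(w::unit, x). line_avg h g x) \<in> borel_measurable (count_space UNIV \<Otimes>\<^sub>M borel)"
    using assms by (intro measurable_line_avg_pair) auto
  from measurable_compose[OF _ this, of "\<lambda>x. ((), x)" borel] show ?thesis by simp
qed

lemma measurable_line_max_pair:
  assumes "(\<lambda>(w, x). g w x) \<in> borel_measurable (M \<Otimes>\<^sub>M borel)" "k \<in> M \<rightarrow>\<^sub>M borel"
  shows "(\<lambda>(w, x). line_max (k w) (g w) x) \<in> borel_measurable (M \<Otimes>\<^sub>M borel)"
proof -
  have "(\<lambda>(w, x). line_avg ((2 powr real_of_int i) *\<^sub>R k w) (g w) x) \<in> borel_measurable (M \<Otimes>\<^sub>M borel)" for i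
    using assms by (intro measurable_line_avg_pair) auto
  then show ?thesis unfolding line_max_def case_prod_beta' by (intro borel_measurable_SUP) auto
qed

lemma measurable_line_max [measurable]:
  "g \<in> borel_measurable borel \<Longrightarrow> line_max h g \<in> borel_measurable borel"
  unfolding line_max_def[abs_def] by (intro borel_measurable_SUP measurable_line_avg) auto

lemma line_avg_mono: "(\<And>x. g x \<le> g' x) \<Longrightarrow> line_avg h g x \<le> line_avg h g' x"
  unfolding line_avg_def by (rule nn_integral_mono, rule mult_right_mono) auto

lemma line_avg_le_max: "line_avg ((2 powr real_of_int i) *\<^sub>R h) g x \<le> line_max h g x"
  unfolding line_max_def
  by (rule SUP_upper[of i UNIV "\<lambda>i. line_avg ((2 powr real_of_int i) *\<^sub>R h) g x"]) simp

lemma nn_integral_line_avg: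
  assumes [measurable]: "g \<in> borel_measurable borel"
  shows "(\<integral>\<^sup>+x. line_avg h g x \<partial>lborel) = (\<integral>\<^sup>+x. g x \<partial>lborel)"
proof -
  have "(\<integral>\<^sup>+x. line_avg h g x \<partial>lborel) = (\<integral>\<^sup>+u. \<integral>\<^sup>+x. g (x + u *\<^sub>R h) * indicator {0..<1} u \<partial>lborel \<partial>lborel)"
    unfolding line_avg_def by (rule lborel_pair.Fubini') simp
  also have "\<dots> = (\<integral>\<^sup>+u. (\<integral>\<^sup>+x. g x \<partial>lborel) * indicator {0..<1::real} u \<partial>lborel)"
    by (simp add: nn_integral_multc nn_integral_lborel_translate)
  also have "\<dots> = (\<integral>\<^sup>+x. g x \<partial>lborel)"
    by (simp add: nn_integral_cmult_indicator)
  finally show ?thesis .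
qed

text \<open>
  An average over \<open>n\<close> steps is the mean of \<open>n\<close> averages over one step, that is, an ergodic mean for
  the translation by \<open>h\<close>.
\<close>

lemma line_avg_multiple:
  assumes [measurable]: "g \<in> borel_measurable borel" and "0 < n"
  shows "ennreal (real n) * line_avg (real n *\<^sub>R h) g x = (\<Sum>l<n. line_avg h g (x + real l *\<^sub>R h))"
proof -
  have "line_avg (real n *\<^sub>R h) g x = (\<integral>\<^sup>+u. g (x + (0 + real n *\<^sub>R u) *\<^sub>R h) * indicator {0..<real n} (0 + real n *\<^sub>R u) \<partial>lborel)"
    unfolding line_avg_def using \<open>0 < n\<close>
    by (intro nn_integral_cong) (auto simp: mult.commute field_simps zero_le_mult_iff split: split_indicator)
  also have "\<dots> = ennreal (1 / real n ^ DIM(real)) * (\<integral>\<^sup>+u. g (x + u *\<^sub>R h) * indicator {0..<real n} u \<partial>lborel)"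
    using \<open>0 < n\<close> by (intro nn_integral_lborel_affine) auto
  finally have "ennreal (real n) * line_avg (real n *\<^sub>R h) g x = (\<integral>\<^sup>+u. g (x + u *\<^sub>R h) * indicator {0..<real n} u \<partial>lborel)"
    using \<open>0 < n\<close> by (simp add: mult.assoc[symmetric] ennreal_mult[symmetric])
  also have "\<dots> = (\<Sum>l<n. line_avg h g (x + real l *\<^sub>R h))"
  proof (induction n)
    case (Suc n)
    have "(\<integral>\<^sup>+u. g (x + u *\<^sub>R h) * indicator {0..<real (Suc n)} u \<partial>lborel) =
        (\<integral>\<^sup>+u. g (x + u *\<^sub>R h) * indicator {0..<real n} u + g (x + u *\<^sub>R h) * indicator {real n..<real n + 1} u \<partial>lborel)"
      by (intro nn_integral_cong) (auto split: split_indicator)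
    also have "\<dots> = (\<integral>\<^sup>+u. g (x + u *\<^sub>R h) * indicator {0..<real n} u \<partial>lborel)
         + (\<integral>\<^sup>+u. g (x + u *\<^sub>R h) * indicator {real n..<real n + 1} u \<partial>lborel)"
      by (rule nn_integral_add) auto
    also have "(\<integral>\<^sup>+u. g (x + u *\<^sub>R h) * indicator {real n..<real n + 1} u \<partial>lborel) =
        (\<integral>\<^sup>+u. g (x + (u + real n) *\<^sub>R h) * indicator {real n..<real n + 1} (u + real n) \<partial>lborel)"
      by (rule nn_integral_lborel_translate[symmetric]) auto
    also have "\<dots> = line_avg h g (x + real n *\<^sub>R h)"
      unfolding line_avg_def by (intro nn_integral_cong) (auto simp: algebra_simps split: split_indicator)
    finally show ?case using Suc by simp
  qed simp
  finally show ?thesis .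
qed

text \<open>
  Garsia's proof of the maximal ergodic inequality for the translation by \<open>a\<close>. With
  \<open>m = max\<^sub>k (S\<^sub>k - k l)\<^sub>+\<close>, the recursion \<open>S\<^sub>k\<^sub>+\<^sub>1 x = v x + S\<^sub>k (x + a)\<close> gives \<open>l + m x \<le> v x + m (x + a)\<close>
  on the set where \<open>m > 0\<close>, and the integrals of \<open>m\<close> and of its translate cancel.
  Truncated subtraction of extended nonnegative reals is exactly the positive part.
\<close>

lemma hopf_maximal:
  fixes v :: "'a::euclidean_space \<Rightarrow> ennreal" and a :: 'a
  assumes [measurable]: "v \<in> borel_measurable borel" and l: "0 \<le> l"
  defines "Sm \<equiv> \<lambda>k x. \<Sum>i<k. v (x + real i *\<^sub>R a)"
  shows "ennreal l * emeasure lborel {x. \<exists>k\<in>{1..n}. ennreal (real k * l) < Sm k x} \<le> (\<integral>\<^sup>+x. v x \<partial>lborel)"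
proof (cases "(\<integral>\<^sup>+x. v x \<partial>lborel) = top")
  case fin: False
  have [measurable]: "Sm k \<in> borel_measurable borel" for k unfolding Sm_def by measurable
  define m where "m x = (SUP k\<in>{1..n}. Sm k x - ennreal (real k * l))" for x
  have m_meas[measurable]: "m \<in> borel_measurable borel" unfolding m_def by measurable
  define E where "E = {x. \<exists>k\<in>{1..n}. ennreal (real k * l) < Sm k x}"
  have E_meas[measurable]: "E \<in> sets borel" unfolding E_def by measurable
  have m_off: "m x = 0" if "x \<notin> E" for x
  proof -
    have "m x \<le> 0" unfolding m_def
    proof (rule SUP_least)
      fix k assume "k \<in> {1..n}"
      then have "Sm k x \<le> ennreal (real k * l)" using that unfolding E_def by (auto simp: not_less)
      moreover have "Sm k x < top" using le_less_trans[OF calculation] by simp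
      ultimately show "Sm k x - ennreal (real k * l) \<le> 0" by (simp add: diff_eq_0_ennreal)
    qed
    then show ?thesis by simp
  qed
  have m_int: "(\<integral>\<^sup>+x. m x \<partial>lborel) < top"
  proof -
    have "m x \<le> Sm n x" for x unfolding m_def
    proof (rule SUP_least)
      fix k assume "k \<in> {1..n}"
      then have "Sm k x \<le> Sm n x" unfolding Sm_def by (intro sum_mono2) auto
      then show "Sm k x - ennreal (real k * l) \<le> Sm n x" by (meson diff_le_self_ennreal order_trans)
    qed
    then have "(\<integral>\<^sup>+x. m x \<partial>lborel) \<le> (\<integral>\<^sup>+x. Sm n x \<partial>lborel)" by (rule nn_integral_mono)
    also have "\<dots> = (\<Sum>i<n. \<integral>\<^sup>+x. v x \<partial>lborel)"
      unfolding Sm_def by (subst nn_integral_sum) (auto simp: nn_integral_lborel_translate)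
    also have "\<dots> < top" using fin by (simp add: ennreal_mult_less_top less_top of_nat_less_top)
    finally show ?thesis .
  qed
  have key: "ennreal l * indicator E x + m x \<le> v x + m (x + a)" for x
  proof (cases "x \<in> E")
    case True
    \<comment> \<open>a finite supremum is attained\<close>
    have ex: "\<exists>k\<in>{1..n}. m x = Sm k x - ennreal (real k * l)"
    proof -
      have "(SUP k\<in>{1..n}. Sm k x - ennreal (real k * l)) \<in> (\<lambda>k. Sm k x - ennreal (real k * l)) ` {1..n}"
        using True by (subst Max_Sup[symmetric]) (auto simp: E_def intro!: Max_in)
      then show ?thesis unfolding m_def by auto
    qed
    then obtain k where k: "k \<in> {1..n}" "m x = Sm k x - ennreal (real k * l)" by blast
    have pos: "0 < m x"
    proof -
      obtain j where j: "j \<in> {1..n}" "ennreal (real j * l) < Sm j x" using True by (auto simp: E_def)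
      then have "0 < Sm j x - ennreal (real j * l)" by (simp add: diff_gr0_ennreal)
      also have "\<dots> \<le> m x" unfolding m_def using j by (intro SUP_upper) auto
      finally show ?thesis .
    qed
    have kl: "ennreal (real k * l) \<le> Sm k x"
    proof (rule ccontr)
      assume "\<not> ?thesis"
      then have "Sm k x < ennreal (real k * l)" by simp
      then have "m x = 0" unfolding k(2)
        by (intro diff_eq_0_ennreal) (auto intro: less_trans[OF _ ennreal_less_top])
      with pos show False by simp
    qed
    define j where "j = k - 1"
    have j: "k = Suc j" using k(1) by (simp add: j_def)
    have Sk: "Sm k x = v x + Sm j (x + a)"
      unfolding Sm_def j by (subst sum.lessThan_Suc_shift) (simp add: algebra_simps)
    have "ennreal l + m x \<le> v x + (Sm j (x + a) - ennreal (real j * l))"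
    proof (cases "Sm k x = top")
      case True
      then have "v x = top \<or> Sm j (x + a) = top" unfolding Sk by (simp add: ennreal_add_eq_top)
      then show ?thesis by auto
    next
      case False
      then have vf: "v x \<noteq> top" "Sm j (x + a) \<noteq> top" unfolding Sk by auto
      then obtain v' s' where v': "v x = ennreal v'" "0 \<le> v'" "Sm j (x + a) = ennreal s'" "0 \<le> s'"
        by (metis ennreal_cases)
      have "real k * l \<le> v' + s'"
        using kl v' unfolding Sk by (simp add: ennreal_plus[symmetric] del: ennreal_plus)
      have "ennreal l + m x = ennreal (l + (v' + s' - real k * l))"
        unfolding k(2) Sk v' using v' l \<open>real k * l \<le> v' + s'\<close>
        by (simp add: ennreal_plus[symmetric] ennreal_minus del: ennreal_plus)
      also have "l + (v' + s' - real k * l) = v' + (s' - real j * l)" by (simp add: j algebra_simps)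
      also have "ennreal \<dots> \<le> ennreal v' + ennreal (s' - real j * l)"
        using v' by (cases "0 \<le> s' - real j * l") (auto simp: ennreal_neg intro!: ennreal_leI)
      also have "\<dots> = v x + (Sm j (x + a) - ennreal (real j * l))"
        using v' l by (simp add: ennreal_minus)
      finally show ?thesis .
    qed
    also have "Sm j (x + a) - ennreal (real j * l) \<le> m (x + a)"
    proof (cases "j = 0")
      case True then show ?thesis by (simp add: Sm_def)
    next
      case False then show ?thesis unfolding m_def using j k by (intro SUP_upper) auto
    qed
    finally show ?thesis using True by (simp add: add_left_mono)
  qed (simp add: m_off)
  have "ennreal l * emeasure lborel E + (\<integral>\<^sup>+x. m x \<partial>lborel) = (\<integral>\<^sup>+x. ennreal l * indicator E x + m x \<partial>lborel)"
    by (simp add: nn_integral_add nn_integral_cmult_indicator)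
  also have "\<dots> \<le> (\<integral>\<^sup>+x. v x + m (x + a) \<partial>lborel)" by (rule nn_integral_mono) (rule key)
  also have "\<dots> = (\<integral>\<^sup>+x. v x \<partial>lborel) + (\<integral>\<^sup>+x. m x \<partial>lborel)"
    by (simp add: nn_integral_add nn_integral_lborel_translate)
  finally show ?thesis
    using m_int unfolding E_def[symmetric]
    by (auto simp: ennreal_add_left_cancel_le add.commute[of _ "\<integral>\<^sup>+x. m x \<partial>lborel"])
qed simp

text \<open>
  For scales between \<open>2\<^sup>-\<^sup>M\<close> and \<open>2\<^sup>M\<close> all averages are ergodic means of the averages at the smallest scale, so
  that the maximal ergodic inequality applies with a constant that does not depend on \<open>M\<close>.
\<close>

lemma line_max_weak_type:
  assumes [measurable]: "g \<in> borel_measurable borel" and l: "0 < l"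
  shows "ennreal l * emeasure lborel {x. ennreal l < line_max h g x} \<le> (\<integral>\<^sup>+x. g x \<partial>lborel)"
proof -
  define E where "E M = {x. \<exists>i\<in>{- int M..int M}. ennreal l < line_avg ((2 powr real_of_int i) *\<^sub>R h) g x}" for M
  have E_meas[measurable]: "E M \<in> sets borel" for M unfolding E_def by measurable
  have "{x. ennreal l < line_max h g x} = (\<Union>M. E M)"
  proof -
    have "\<exists>M. i \<in> {- int M..int M}" for i by (rule exI[of _ "nat \<bar>i\<bar>"]) auto
    then show ?thesis unfolding line_max_def E_def less_SUP_iff by blast
  qed
  moreover have "incseq E" unfolding E_def incseq_def by fastforce
  ultimately have "emeasure lborel {x. ennreal l < line_max h g x} = (SUP M. emeasure lborel (E M))"
    by (simp add: SUP_emeasure_incseq image_subset_iff)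
  then have "ennreal l * emeasure lborel {x. ennreal l < line_max h g x} = (SUP M. ennreal l * emeasure lborel (E M))"
    by (simp add: SUP_mult_left_ennreal)
  also have "\<dots> \<le> (\<integral>\<^sup>+x. g x \<partial>lborel)"
  proof (rule SUP_least)
    fix M
    \<comment> \<open>all scales in \<open>E M\<close> are multiples of this step\<close>
    define k where "k = (2 powr (- real M)) *\<^sub>R h"
    define v where "v = line_avg k g"
    have [measurable]: "v \<in> borel_measurable borel" unfolding v_def by measurable
    have "E M \<subseteq> {x. \<exists>n\<in>{1..2 ^ (2 * M)}. ennreal (real n * l) < (\<Sum>i<n. v (x + real i *\<^sub>R k))}"
    proof
      fix x assume "x \<in> E M"
      then obtain i where i: "- int M \<le> i" "i \<le> int M" "ennreal l < line_avg ((2 powr real_of_int i) *\<^sub>R h) g x"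
        by (auto simp: E_def)
      define n :: nat where "n = 2 ^ nat (i + int M)"
      have "real n = 2 powr (real_of_int i + real M)"
        unfolding n_def using i by (simp add: powr_realpow[symmetric])
      then have nk: "real n *\<^sub>R k = (2 powr real_of_int i) *\<^sub>R h"
        by (simp add: k_def powr_add[symmetric])
      have "ennreal (real n * l) = ennreal (real n) * ennreal l" using l by (simp add: ennreal_mult')
      also have "\<dots> < ennreal (real n) * line_avg (real n *\<^sub>R k) g x"
        using i(3) unfolding nk by (intro ennreal_mult_strict_left_mono) (auto simp: n_def)
      also have "\<dots> = (\<Sum>i<n. v (x + real i *\<^sub>R k))"
        unfolding v_def by (rule line_avg_multiple) (auto simp: n_def)
      finally have "ennreal (real n * l) < (\<Sum>i<n. v (x + real i *\<^sub>R k))" .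
      moreover have "n \<in> {1..2 ^ (2 * M)}"
        unfolding n_def using i by (auto intro!: power_increasing)
      ultimately show "x \<in> {x. \<exists>n\<in>{1..2 ^ (2 * M)}. ennreal (real n * l) < (\<Sum>i<n. v (x + real i *\<^sub>R k))}" by blast
    qed
    then have "ennreal l * emeasure lborel (E M) \<le>
        ennreal l * emeasure lborel {x. \<exists>n\<in>{1..2 ^ (2 * M)}. ennreal (real n * l) < (\<Sum>i<n. v (x + real i *\<^sub>R k))}"
      by (intro mult_left_mono emeasure_mono) auto
    also have "\<dots> \<le> (\<integral>\<^sup>+x. v x \<partial>lborel)" using l by (intro hopf_maximal) auto
    also have "\<dots> = (\<integral>\<^sup>+x. g x \<partial>lborel)" unfolding v_def by (rule nn_integral_line_avg) simp
    finally show "ennreal l * emeasure lborel (E M) \<le> (\<integral>\<^sup>+x. g x \<partial>lborel)" .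
  qed
  finally show ?thesis .
qed

lemma nn_integral_powr_below:
  assumes "0 < a" "0 \<le> r"
  shows "(\<integral>\<^sup>+l\<in>{0<..<r}. ennreal (a * l powr (a - 1)) \<partial>lborel) = ennreal (r powr a)"
proof -
  have "((\<lambda>l. l powr (a - 1)) has_integral (r powr (a - 1 + 1) / (a - 1 + 1))) {0..r}"
    using assms by (intro has_integral_powr_from_0) auto
  then have "((\<lambda>l. a * l powr (a - 1)) has_integral (a * (r powr (a - 1 + 1) / (a - 1 + 1)))) {0..r}"
    by (rule has_integral_mult_right)
  then have "((\<lambda>l. a * l powr (a - 1)) has_integral (r powr a)) {0..r}" using assms by simp
  then have "(\<integral>\<^sup>+l. ennreal (a * l powr (a - 1)) * indicator {0..r} l \<partial>lborel) = ennreal (r powr a)"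
    using nn_integral_has_integral_lebesgue[of "{0..r}" "\<lambda>l. a * l powr (a - 1)"] assms
    by (simp add: ennreal_mult' ennreal_indicator mult.commute)
  moreover have "(\<integral>\<^sup>+l\<in>{0<..<r}. ennreal (a * l powr (a - 1)) \<partial>lborel) = (\<integral>\<^sup>+l\<in>{0..r}. ennreal (a * l powr (a - 1)) \<partial>lborel)"
  proof (rule nn_integral_cong_AE)
    have "AE l in lborel. l \<noteq> 0 \<and> l \<noteq> r" by (intro AE_conjI AE_lborel_singleton)
    then show "AE l in lborel. ennreal (a * l powr (a - 1)) * indicator {0<..<r} l = ennreal (a * l powr (a - 1)) * indicator {0..r} l"
      by eventually_elim (auto split: split_indicator)
  qed
  ultimately show ?thesis by simp
qed

lemma epowr_layer_cake:
  assumes "0 < a"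
  shows "(\<integral>\<^sup>+l. ennreal (a * l powr (a - 1)) * indicator {l. 0 < l \<and> ennreal l < y} l \<partial>lborel) = epowr y a"
proof (cases y)
  case (real r)
  then have "{l. 0 < l \<and> ennreal l < y} = {0<..<r}" by (auto simp: ennreal_less_iff)
  then show ?thesis using nn_integral_powr_below[OF assms, of r] real assms by (simp add: epowr_ennreal)
next
  case top
  have "ennreal (real n) \<le> (\<integral>\<^sup>+l. ennreal (a * l powr (a - 1)) * indicator {l. 0 < l \<and> ennreal l < y} l \<partial>lborel)" for n :: nat
  proof -
    have "ennreal (real n) = ennreal ((real n powr (1 / a)) powr a)" using assms by (simp add: powr_powr)
    also have "\<dots> = (\<integral>\<^sup>+l\<in>{0<..<real n powr (1 / a)}. ennreal (a * l powr (a - 1)) \<partial>lborel)"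
      by (rule nn_integral_powr_below[symmetric]) (use assms in auto)
    also have "\<dots> \<le> (\<integral>\<^sup>+l. ennreal (a * l powr (a - 1)) * indicator {l. 0 < l \<and> ennreal l < y} l \<partial>lborel)"
      using top by (intro nn_integral_mono) (auto split: split_indicator)
    finally show ?thesis .
  qed
  then have "(\<integral>\<^sup>+l. ennreal (a * l powr (a - 1)) * indicator {l. 0 < l \<and> ennreal l < y} l \<partial>lborel) = top"
    by (metis ennreal_Ex_less_of_nat ennreal_of_nat_eq_real_of_nat infinity_ennreal_def less_top not_less)
  then show ?thesis using top assms by simp
qed

lemma nn_integral_epowr_layer_cake:
  fixes F :: "'a::euclidean_space \<Rightarrow> ennreal"
  assumes [measurable]: "F \<in> borel_measurable borel" and a: "0 < a"
  shows "(\<integral>\<^sup>+x. epowr (F x) a \<partial>lborel) =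
    (\<integral>\<^sup>+l\<in>{0<..}. ennreal (a * l powr (a - 1)) * emeasure lborel {x. ennreal l < F x} \<partial>lborel)"
proof -
  let ?w = "\<lambda>l. ennreal (a * l powr (a - 1))"
  have [measurable]: "Measurable.pred (borel \<Otimes>\<^sub>M borel) (\<lambda>z. ennreal (snd z) < F (fst z))" by measurable
  have "(\<integral>\<^sup>+x. epowr (F x) a \<partial>lborel) = (\<integral>\<^sup>+x. \<integral>\<^sup>+l. ?w l * indicator {l. 0 < l \<and> ennreal l < F x} l \<partial>lborel \<partial>lborel)"
    by (simp add: epowr_layer_cake a)
  also have "\<dots> = (\<integral>\<^sup>+l. \<integral>\<^sup>+x. ?w l * indicator {l. 0 < l \<and> ennreal l < F x} l \<partial>lborel \<partial>lborel)"
    by (rule lborel_pair.Fubini') (simp add: case_prod_beta' indicator_def)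
  also have "\<dots> = (\<integral>\<^sup>+l\<in>{0<..}. ?w l * emeasure lborel {x. ennreal l < F x} \<partial>lborel)"
  proof (rule nn_integral_cong)
    fix l
    have "(\<integral>\<^sup>+x. ?w l * indicator {l. 0 < l \<and> ennreal l < F x} l \<partial>lborel) = 
       (\<integral>\<^sup>+x. (?w l * indicator {0<..} l) * indicator {x. ennreal l < F x} x \<partial>lborel)"
      by (intro nn_integral_cong) (auto split: split_indicator)
    also have "\<dots> = (?w l * indicator {0<..} l) * emeasure lborel {x. ennreal l < F x}"
      by (rule nn_integral_cmult_indicator) simp
    finally show "(\<integral>\<^sup>+x. ?w l * indicator {l. 0 < l \<and> ennreal l < F x} l \<partial>lborel) = 
       ?w l * emeasure lborel {x. ennreal l < F x} * indicator {0<..} l" by (simp add: mult_ac)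
  qed
  finally show ?thesis .
qed

text \<open>
  The part of \<open>g\<close> below \<open>l / 2\<close> contributes at most \<open>l / 2\<close> to every average.
\<close>

lemma line_max_truncate:
  assumes [measurable]: "g \<in> borel_measurable borel" and l: "0 < l" and "ennreal l < line_max h g x"
  shows "ennreal (l / 2) < line_max h (\<lambda>x. g x - ennreal (l / 2)) x"
proof (rule ccontr)
  assume "\<not> ?thesis"
  then have *: "line_max h (\<lambda>x. g x - ennreal (l / 2)) x \<le> ennreal (l / 2)" by simp
  have "line_max h g x \<le> ennreal l" unfolding line_max_def
  proof (rule SUP_least)
    fix i :: int
    let ?k = "(2 powr real_of_int i) *\<^sub>R h"
    have "line_avg ?k g x \<le> line_avg ?k (\<lambda>x. (g x - ennreal (l / 2)) + ennreal (l / 2)) x"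
    proof (rule line_avg_mono)
      fix y show "g y \<le> g y - ennreal (l / 2) + ennreal (l / 2)"
        by (cases "ennreal (l / 2) \<le> g y") (auto simp: diff_add_cancel_ennreal intro!: add_increasing)
    qed
    also have "\<dots> = line_avg ?k (\<lambda>x. g x - ennreal (l / 2)) x + ennreal (l / 2)"
      unfolding line_avg_def by (simp add: distrib_right nn_integral_add nn_integral_cmult_indicator)
    also have "\<dots> \<le> ennreal (l / 2) + ennreal (l / 2)"
      using order_trans[OF line_avg_le_max *] by (rule add_right_mono)
    also have "\<dots> = ennreal l" using l by (simp add: ennreal_plus[symmetric] del: ennreal_plus)
    finally show "line_avg ?k g x \<le> ennreal l" .
  qed
  with assms(3) show False by simp
qed

text \<open>
  Marcinkiewicz' argument: at height \<open>l\<close> the weak type inequality is applied to the part of \<open>g\<close> above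
  \<open>l / 2\<close>, and the layer cake formula integrates the result over \<open>l\<close>. The integral in \<open>l\<close> converges
  at \<open>0\<close> because \<open>p > 1\<close>.
\<close>

lemma line_max_strong_type:
  fixes g :: "'a::euclidean_space \<Rightarrow> ennreal"
  assumes [measurable]: "g \<in> borel_measurable borel" and p: "1 < p"
  shows "(\<integral>\<^sup>+x. epowr (line_max h g x) p \<partial>lborel) \<le> ennreal (2 powr p * p / (p - 1)) * (\<integral>\<^sup>+x. epowr (g x) p \<partial>lborel)"
proof -
  let ?w = "\<lambda>l. ennreal (2 * p * l powr (p - 2))"
  have "(\<integral>\<^sup>+x. epowr (line_max h g x) p \<partial>lborel) =
    (\<integral>\<^sup>+l\<in>{0<..}. ennreal (p * l powr (p - 1)) * emeasure lborel {x. ennreal l < line_max h g x} \<partial>lborel)"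
    using p by (intro nn_integral_epowr_layer_cake) auto
  also have "\<dots> \<le> (\<integral>\<^sup>+l\<in>{0<..}. ?w l * (\<integral>\<^sup>+x. (g x - ennreal (l / 2)) \<partial>lborel) \<partial>lborel)"
  proof (rule nn_integral_mono)
    fix l :: real
    have "ennreal (p * l powr (p - 1)) * emeasure lborel {x. ennreal l < line_max h g x} \<le>
        ?w l * (\<integral>\<^sup>+x. (g x - ennreal (l / 2)) \<partial>lborel)" if l: "0 < l"
    proof -
      have "p * l powr (p - 1) = 2 * p * l powr (p - 2) * (l / 2)"
        using l by (simp add: powr_diff power2_eq_square field_simps)
      then have "ennreal (p * l powr (p - 1)) = ?w l * ennreal (l / 2)"
        using l p by (subst ennreal_mult[symmetric]) auto
      then have "ennreal (p * l powr (p - 1)) * emeasure lborel {x. ennreal l < line_max h g x} =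
         ?w l * (ennreal (l / 2) * emeasure lborel {x. ennreal l < line_max h g x})"
        by (simp only: mult.assoc)
      also have "\<dots> \<le> ?w l * (ennreal (l / 2) * emeasure lborel {x. ennreal (l / 2) < line_max h (\<lambda>x. g x - ennreal (l / 2)) x})"
        using l by (intro mult_left_mono emeasure_mono) (auto simp: line_max_truncate)
      also have "\<dots> \<le> ?w l * (\<integral>\<^sup>+x. (g x - ennreal (l / 2)) \<partial>lborel)"
        using l by (intro mult_left_mono line_max_weak_type) auto
      finally show ?thesis .
    qed
    then show "ennreal (p * l powr (p - 1)) * emeasure lborel {x. ennreal l < line_max h g x} * indicator {0<..} l \<le>
        ?w l * (\<integral>\<^sup>+x. (g x - ennreal (l / 2)) \<partial>lborel) * indicator {0<..} l"
      by (auto split: split_indicator)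
  qed
  also have "\<dots> = (\<integral>\<^sup>+l. \<integral>\<^sup>+x. ?w l * indicator {0<..} l * (g x - ennreal (l / 2)) \<partial>lborel \<partial>lborel)"
    by (intro nn_integral_cong, subst nn_integral_cmult) (auto simp: mult_ac)
  also have "\<dots> = (\<integral>\<^sup>+x. \<integral>\<^sup>+l. ?w l * indicator {0<..} l * (g x - ennreal (l / 2)) \<partial>lborel \<partial>lborel)"
    by (rule lborel_pair.Fubini') (simp add: case_prod_beta')
  also have "\<dots> \<le> (\<integral>\<^sup>+x. ennreal (2 powr p * p / (p - 1)) * epowr (g x) p \<partial>lborel)"
  proof (rule nn_integral_mono)
    fix x
    show "(\<integral>\<^sup>+l. ?w l * indicator {0<..} l * (g x - ennreal (l / 2)) \<partial>lborel) \<le> ennreal (2 powr p * p / (p - 1)) * epowr (g x) p"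
    proof (cases "g x")
      case (real r)
      have "(\<integral>\<^sup>+l. ?w l * indicator {0<..} l * (g x - ennreal (l / 2)) \<partial>lborel) \<le>
         (\<integral>\<^sup>+l. ennreal (2 * p * r / (p - 1)) * (ennreal ((p - 1) * l powr (p - 1 - 1)) * indicator {0<..<2 * r} l) \<partial>lborel)"
      proof (rule nn_integral_mono)
        fix l
        have "?w l * (g x - ennreal (l / 2)) \<le> ennreal (2 * p * r / (p - 1)) * (ennreal ((p - 1) * l powr (p - 1 - 1)) * indicator {0<..<2 * r} l)"
          if l: "0 < l"
        proof (cases "l < 2 * r")
          case True
          have "?w l * (g x - ennreal (l / 2)) \<le> ?w l * ennreal r"
            using real by (intro mult_left_mono) auto
          also have "\<dots> = ennreal (2 * p * r / (p - 1)) * ennreal ((p - 1) * l powr (p - 1 - 1))"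
          proof -
            have "2 * p * l powr (p - 2) * r = 2 * p * r / (p - 1) * ((p - 1) * l powr (p - 1 - 1))"
              using p by simp
            then show ?thesis using p real by (subst (1 2) ennreal_mult[symmetric]) auto
          qed
          finally show ?thesis using True l by simp
        next
          case False
          then have "g x - ennreal (l / 2) = 0" using real l by (simp add: ennreal_minus ennreal_neg)
          then show ?thesis by simp
        qed
        then show "?w l * indicator {0<..} l * (g x - ennreal (l / 2)) \<le>
            ennreal (2 * p * r / (p - 1)) * (ennreal ((p - 1) * l powr (p - 1 - 1)) * indicator {0<..<2 * r} l)"
          by (auto split: split_indicator)
      qed
      also have "\<dots> = ennreal (2 * p * r / (p - 1)) * ennreal ((2 * r) powr (p - 1))"
        using p real nn_integral_powr_below[of "p - 1" "2 * r"] by (subst nn_integral_cmult) auto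
      also have "\<dots> = ennreal (2 powr p * p / (p - 1)) * epowr (g x) p"
        using p real by (cases "r = 0") (auto simp: epowr_ennreal ennreal_mult[symmetric] powr_mult powr_diff field_simps)
      finally show ?thesis .
    qed (use p in \<open>simp add: ennreal_mult_top\<close>)
  qed
  also have "\<dots> = ennreal (2 powr p * p / (p - 1)) * (\<integral>\<^sup>+x. epowr (g x) p \<partial>lborel)"
    by (rule nn_integral_cmult) simp
  finally show ?thesis .
qed

section \<open>Integer order: the majorant\<close>

lemma measurable_line_max_iterate:
  assumes "(\<lambda>(h, x). g h x) \<in> borel_measurable (borel \<Otimes>\<^sub>M borel)"
  shows "(\<lambda>(h::'a::euclidean_space, x). (line_max h ^^ k) (g h) x) \<in> borel_measurable (borel \<Otimes>\<^sub>M borel)"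
proof (induction k)
  case (Suc k)
  show ?case using measurable_line_max_pair[OF Suc, of "\<lambda>h. h"] by simp
qed (use assms in simp)

lemma line_avg_iterate_le_max:
  "(line_avg ((2 powr real_of_int i) *\<^sub>R h) ^^ k) g x \<le> (line_max h ^^ k) g x"
proof (induction k arbitrary: x)
  case (Suc k)
  show ?case using order_trans[OF line_avg_mono[OF Suc] line_avg_le_max] by simp
qed simp

lemma line_max_iterate_strong_type:
  fixes g :: "'a::euclidean_space \<Rightarrow> ennreal"
  assumes g[measurable]: "g \<in> borel_measurable borel" and p: "1 < p"
  shows "(\<integral>\<^sup>+x. epowr ((line_max h ^^ k) g x) p \<partial>lborel)
    \<le> ennreal ((2 powr p * p / (p - 1)) ^ k) * (\<integral>\<^sup>+x. epowr (g x) p \<partial>lborel)"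
proof (induction k)
  case (Suc k)
  have "(line_max h ^^ k) g \<in> borel_measurable borel" by (induction k) (use g in auto)
  then have "(\<integral>\<^sup>+x. epowr ((line_max h ^^ Suc k) g x) p \<partial>lborel) \<le>
      ennreal (2 powr p * p / (p - 1)) * (\<integral>\<^sup>+x. epowr ((line_max h ^^ k) g x) p \<partial>lborel)"
    using line_max_strong_type[OF _ p] by simp
  also have "\<dots> \<le> ennreal (2 powr p * p / (p - 1)) *
      (ennreal ((2 powr p * p / (p - 1)) ^ k) * (\<integral>\<^sup>+x. epowr (g x) p \<partial>lborel))"
    by (intro mult_left_mono Suc) simp
  also have "\<dots> = ennreal ((2 powr p * p / (p - 1)) ^ Suc k) * (\<integral>\<^sup>+x. epowr (g x) p \<partial>lborel)"
    using p by (simp add: mult.assoc[symmetric] ennreal_mult[symmetric])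
  finally show ?case .
qed simp

text \<open>
  \<open>g h\<close> stands for the absolute value of the \<open>k\<close>-th derivative in direction \<open>h\<close>. Its \<open>k\<close>-fold iterated
  maximal function dominates the \<open>k\<close>-fold averages at all dyadic scales at once, and the strong
  type inequality holds with the same constant in all directions.
\<close>

lemma integer_majorant:
  fixes f :: "'a::euclidean_space \<Rightarrow> real" and S :: "'a set" and g :: "'a \<Rightarrow> 'a \<Rightarrow> ennreal"
  assumes [measurable]: "f \<in> borel_measurable borel" "S \<in> sets borel"
    and V: "emeasure lborel S = ennreal V" "0 < V" and p: "1 < p"
    and g: "(\<lambda>(h, x). g h x) \<in> borel_measurable (borel \<Otimes>\<^sub>M borel)"
    and bd: "\<And>h t. 0 < t \<Longrightarrow> AE x in lborel. ennreal \<bar>(fdiff (t *\<^sub>R h) ^^ k) f x\<bar>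
      \<le> ennreal (t ^ k) * (line_avg (t *\<^sub>R h) ^^ k) (g h) x"
    and I: "\<And>h. h \<in> S \<Longrightarrow> (\<integral>\<^sup>+x. epowr (g h x) p \<partial>lborel) \<le> 1"
  obtains G where "G \<in> borel_measurable borel"
    "AE x in lborel. \<forall>i::int. (\<integral>\<^sup>+h\<in>S. ennreal (\<bar>(fdiff ((2 powr i) *\<^sub>R h) ^^ k) f x\<bar> powr p) \<partial>lborel)
        \<le> ennreal (V * (2 powr i) powr (real k * p)) * G x"
    "(\<integral>\<^sup>+x. G x \<partial>lborel) \<le> ennreal ((2 powr p * p / (p - 1)) ^ k)"
proof -
  define m where "m h = (line_max h ^^ k) (g h)" for h
  have m_pair: "(\<lambda>w. m (fst w) (snd w)) \<in> borel_measurable (borel \<Otimes>\<^sub>M borel)"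
    using measurable_line_max_iterate[OF g, of k] by (simp add: m_def case_prod_beta')
  then have [measurable]: "(\<lambda>w. m (fst w) (snd w)) \<in> borel_measurable (lborel \<Otimes>\<^sub>M lborel)" by simp
  have m_swap[measurable]: "(\<lambda>w. m (snd w) (fst w)) \<in> borel_measurable (lborel \<Otimes>\<^sub>M lborel)"
    using measurable_compose[OF _ m_pair, of "\<lambda>w. (snd w, fst w)" "lborel \<Otimes>\<^sub>M lborel"] by simp
  have m2[measurable]: "(\<lambda>h. m h x) \<in> borel_measurable lborel" for x
    using measurable_compose[OF _ m_pair, of "\<lambda>h. (h, x)" lborel] by simp
  have m1[measurable]: "m h \<in> borel_measurable lborel" for h
    using measurable_compose[OF _ m_pair, of "\<lambda>x. (h, x)" lborel] by simp
  have g1: "g h \<in> borel_measurable borel" for h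
    using measurable_compose[OF _ g, of "\<lambda>x. (h, x)" borel] by simp
  define G where "G x = ennreal (1 / V) * (\<integral>\<^sup>+h\<in>S. epowr (m h x) p \<partial>lborel)" for x
  let ?P = "\<lambda>h x. \<forall>i::int. ennreal \<bar>(fdiff ((2 powr i) *\<^sub>R h) ^^ k) f x\<bar> \<le> ennreal ((2 powr i) ^ k) * m h x"
  show thesis
  proof
    have "(\<lambda>x. \<integral>\<^sup>+h\<in>S. epowr (m h x) p \<partial>lborel) \<in> borel_measurable lborel"
      by (rule lborel.borel_measurable_nn_integral) (simp add: case_prod_beta')
    then show "G \<in> borel_measurable borel" unfolding G_def by simp
  next
    have hx: "AE h in lborel. AE x in lborel. ?P h x"
    proof (rule AE_I2)
      fix h :: 'a
      have "AE x in lborel. ennreal \<bar>(fdiff ((2 powr i) *\<^sub>R h) ^^ k) f x\<bar> \<le> ennreal ((2 powr i) ^ k) * m h x" for i :: int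
      proof (use bd[of "2 powr i" h] in \<open>simp, elim eventually_mono\<close>)
        fix x assume *: "ennreal \<bar>(fdiff ((2 powr i) *\<^sub>R h) ^^ k) f x\<bar> \<le> ennreal ((2 powr i) ^ k) * (line_avg ((2 powr i) *\<^sub>R h) ^^ k) (g h) x"
        also have "\<dots> \<le> ennreal ((2 powr i) ^ k) * m h x"
          unfolding m_def by (intro mult_left_mono line_avg_iterate_le_max) simp
        finally show "ennreal \<bar>(fdiff ((2 powr i) *\<^sub>R h) ^^ k) f x\<bar> \<le> ennreal ((2 powr i) ^ k) * m h x" .
      qed
      then show "AE x in lborel. ?P h x" by (simp add: AE_all_countable)
    qed
    have "{w \<in> space (lborel \<Otimes>\<^sub>M lborel). ?P (fst w) (snd w)} \<in> sets (lborel \<Otimes>\<^sub>M lborel)"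
    proof (intro sets.sets_Collect_countable_All borel_measurable_le)
      fix i :: int
      have "(\<lambda>w. (fdiff ((2 powr real_of_int i) *\<^sub>R fst w) ^^ k) f (snd w)) \<in> borel_measurable (lborel \<Otimes>\<^sub>M lborel)"
        by (rule measurable_fdiff_iterate) auto
      then show "(\<lambda>w. ennreal \<bar>(fdiff ((2 powr real_of_int i) *\<^sub>R fst w) ^^ k) f (snd w)\<bar>) \<in> borel_measurable (lborel \<Otimes>\<^sub>M lborel)"
        by simp
      show "(\<lambda>w. ennreal ((2 powr real_of_int i) ^ k) * m (fst w) (snd w)) \<in> borel_measurable (lborel \<Otimes>\<^sub>M lborel)"
        using m_pair by (intro borel_measurable_times_ennreal) simp_all
    qed
    from iffD1[OF lborel_pair.AE_commute[where P = ?P, OF this] hx]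
    have "AE x in lborel. AE h in lborel. ?P h x" .
    then show "AE x in lborel. \<forall>i::int. (\<integral>\<^sup>+h\<in>S. ennreal (\<bar>(fdiff ((2 powr i) *\<^sub>R h) ^^ k) f x\<bar> powr p) \<partial>lborel)
        \<le> ennreal (V * (2 powr i) powr (real k * p)) * G x"
    proof eventually_elim
      case (elim x)
      show ?case
      proof
        fix i :: int
        have "(\<integral>\<^sup>+h\<in>S. ennreal (\<bar>(fdiff ((2 powr i) *\<^sub>R h) ^^ k) f x\<bar> powr p) \<partial>lborel)
           \<le> (\<integral>\<^sup>+h. ennreal ((2 powr i) powr (real k * p)) * (epowr (m h x) p * indicator S h) \<partial>lborel)"
        proof (rule nn_integral_mono_AE, use elim in eventually_elim)
          case (elim h)
          have "ennreal (\<bar>(fdiff ((2 powr i) *\<^sub>R h) ^^ k) f x\<bar> powr p) = epowr (ennreal \<bar>(fdiff ((2 powr i) *\<^sub>R h) ^^ k) f x\<bar>) p"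
            using p by (simp add: epowr_ennreal)
          also have "\<dots> \<le> epowr (ennreal ((2 powr i) ^ k) * m h x) p"
            using elim p by (intro epowr_mono) auto
          also have "\<dots> = ennreal ((2 powr i) powr (real k * p)) * epowr (m h x) p"
            using p by (simp add: epowr_mult epowr_ennreal powr_powr flip: powr_realpow) (simp add: mult_ac)
          finally show ?case by (auto split: split_indicator)
        qed
        also have "\<dots> = ennreal ((2 powr i) powr (real k * p)) * (\<integral>\<^sup>+h\<in>S. epowr (m h x) p \<partial>lborel)"
          by (rule nn_integral_cmult) simp
        also have "\<dots> = ennreal (V * (2 powr i) powr (real k * p)) * G x"
        proof -
          have "ennreal (V * (2 powr i) powr (real k * p)) * ennreal (1 / V) = ennreal ((2 powr i) powr (real k * p))"
            using V by (simp add: ennreal_mult[symmetric])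
          then show ?thesis unfolding G_def by (simp only: mult.assoc[symmetric])
        qed
        finally show "(\<integral>\<^sup>+h\<in>S. ennreal (\<bar>(fdiff ((2 powr i) *\<^sub>R h) ^^ k) f x\<bar> powr p) \<partial>lborel)
            \<le> ennreal (V * (2 powr i) powr (real k * p)) * G x" .
      qed
    qed
  next
    let ?C = "(2 powr p * p / (p - 1)) ^ k"
    have "(\<integral>\<^sup>+x. G x \<partial>lborel) = ennreal (1 / V) * (\<integral>\<^sup>+x. \<integral>\<^sup>+h. epowr (m h x) p * indicator S h \<partial>lborel \<partial>lborel)"
      unfolding G_def by (rule nn_integral_cmult) (simp add: case_prod_beta')
    also have "(\<integral>\<^sup>+x. \<integral>\<^sup>+h. epowr (m h x) p * indicator S h \<partial>lborel \<partial>lborel) =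
        (\<integral>\<^sup>+h. \<integral>\<^sup>+x. epowr (m h x) p * indicator S h \<partial>lborel \<partial>lborel)"
      by (rule lborel_pair.Fubini') (simp add: case_prod_beta')
    also have "\<dots> \<le> (\<integral>\<^sup>+h. ennreal ?C * indicator S h \<partial>lborel)"
    proof (rule nn_integral_mono)
      fix h
      have "(\<integral>\<^sup>+x. epowr (m h x) p * indicator S h \<partial>lborel) = (\<integral>\<^sup>+x. epowr (m h x) p \<partial>lborel) * indicator S h"
        by (rule nn_integral_multc) simp
      also have "\<dots> \<le> (ennreal ?C * (\<integral>\<^sup>+x. epowr (g h x) p \<partial>lborel)) * indicator S h"
        unfolding m_def by (intro mult_right_mono line_max_iterate_strong_type g1 p) simp
      also have "\<dots> \<le> ennreal ?C * indicator S h"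
        using mult_left_mono[OF I[of h], of "ennreal ?C"] by (auto split: split_indicator)
      finally show "(\<integral>\<^sup>+x. epowr (m h x) p * indicator S h \<partial>lborel) \<le> ennreal ?C * indicator S h" .
    qed
    also have "\<dots> = ennreal ?C * ennreal V" using V by (simp add: nn_integral_cmult_indicator)
    finally have "(\<integral>\<^sup>+x. G x \<partial>lborel) \<le> ennreal (1 / V) * (ennreal ?C * ennreal V)"
      by (simp add: mult_left_mono)
    also have "\<dots> = ennreal ?C"
      using V p by (simp add: ennreal_mult[symmetric])
    finally show "(\<integral>\<^sup>+x. G x \<partial>lborel) \<le> ennreal ?C" .
  qed
qed

section \<open>Order one and exponent one: level sets\<close>

text \<open>
  The difference with step \<open>n h\<close> telescopes into \<open>n\<close> translates of the difference with step \<open>h\<close>.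
\<close>

lemma fdiff_subadditive:
  fixes g :: "'a::euclidean_space \<Rightarrow> real"
  assumes [measurable]: "g \<in> borel_measurable borel"
  shows "(\<integral>\<^sup>+x. ennreal \<bar>fdiff (real n *\<^sub>R h) g x\<bar> \<partial>lborel) \<le> ennreal (real n) * (\<integral>\<^sup>+x. ennreal \<bar>fdiff h g x\<bar> \<partial>lborel)"
proof (induction n)
  case (Suc n)
  have "(\<integral>\<^sup>+x. ennreal \<bar>fdiff (real (Suc n) *\<^sub>R h) g x\<bar> \<partial>lborel) \<le>
      (\<integral>\<^sup>+x. ennreal \<bar>fdiff (real n *\<^sub>R h) g (x + h)\<bar> + ennreal \<bar>fdiff h g x\<bar> \<partial>lborel)"
    by (intro nn_integral_mono)
       (auto simp: fdiff_def algebra_simps ennreal_plus[symmetric] simp del: ennreal_plus intro!: ennreal_leI)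
  also have "\<dots> = (\<integral>\<^sup>+x. ennreal \<bar>fdiff (real n *\<^sub>R h) g (x + h)\<bar> \<partial>lborel) + (\<integral>\<^sup>+x. ennreal \<bar>fdiff h g x\<bar> \<partial>lborel)"
    by (rule nn_integral_add) (auto simp: fdiff_def)
  also have "(\<integral>\<^sup>+x. ennreal \<bar>fdiff (real n *\<^sub>R h) g (x + h)\<bar> \<partial>lborel) = (\<integral>\<^sup>+x. ennreal \<bar>fdiff (real n *\<^sub>R h) g x\<bar> \<partial>lborel)"
    by (rule nn_integral_lborel_translate) (simp add: fdiff_def)
  also have "\<dots> \<le> ennreal (real n) * (\<integral>\<^sup>+x. ennreal \<bar>fdiff h g x\<bar> \<partial>lborel)" by (rule Suc)
  also have "ennreal (real n) * (\<integral>\<^sup>+x. ennreal \<bar>fdiff h g x\<bar> \<partial>lborel) + (\<integral>\<^sup>+x. ennreal \<bar>fdiff h g x\<bar> \<partial>lborel) =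
      ennreal (real (Suc n)) * (\<integral>\<^sup>+x. ennreal \<bar>fdiff h g x\<bar> \<partial>lborel)"
    by (simp add: distrib_right ennreal_plus[symmetric] add.commute del: ennreal_plus)
       (simp add: ennreal_plus distrib_right add.commute)
  finally show ?case by (simp add: add_right_mono)
qed (simp add: fdiff_def)

text \<open>
  The averaging argument for an indicator function, in the form of an isoperimetric inequality: at the
  scale where \<open>t S\<close> has at least twice the volume of \<open>E\<close>, on average at least half of the
  translates of a point of \<open>E\<close> leave \<open>E\<close>.
\<close>

lemma set_average_displacement:
  fixes E S :: "'a::euclidean_space set"
  assumes [measurable]: "E \<in> sets borel" "S \<in> sets borel"
    and V: "emeasure lborel S = ennreal V" "0 < V" and t: "0 < t"
    and e: "emeasure lborel E = ennreal e" "0 \<le> e" and te: "2 * e \<le> t ^ DIM('a) * V"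
  shows "ennreal (V * e) \<le> 2 * (\<integral>\<^sup>+h\<in>S. (\<integral>\<^sup>+x. ennreal \<bar>fdiff (t *\<^sub>R h) (indicat_real E) x\<bar> \<partial>lborel) \<partial>lborel)"
proof -
  let ?d = "\<lambda>h x. ennreal \<bar>fdiff (t *\<^sub>R h) (indicat_real E) x\<bar>"
  have [measurable]: "(\<lambda>w. ?d (fst w) (snd w)) \<in> borel_measurable (lborel \<Otimes>\<^sub>M lborel)"
    unfolding fdiff_def by measurable
  have "ennreal (V * e) = (\<integral>\<^sup>+x. ennreal V * indicator E x \<partial>lborel)"
    using V e by (simp add: nn_integral_cmult_indicator ennreal_mult)
  also have "\<dots> \<le> (\<integral>\<^sup>+x. (\<integral>\<^sup>+h\<in>S. ?d h x \<partial>lborel) + ennreal (V / 2) * indicator E x \<partial>lborel)"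
  proof (rule nn_integral_mono)
    fix x
    have "ennreal V \<le> (\<integral>\<^sup>+h\<in>S. ?d h x \<partial>lborel) + ennreal (V / 2)" if x: "x \<in> E"
    proof -
      have "ennreal V = (\<integral>\<^sup>+h. indicator S h \<partial>lborel)" using V by simp
      also have "\<dots> \<le> (\<integral>\<^sup>+h. ?d h x * indicator S h + indicator E (x + t *\<^sub>R h) \<partial>lborel)"
        using x by (intro nn_integral_mono) (auto simp: fdiff_def split: split_indicator)
      also have "\<dots> = (\<integral>\<^sup>+h\<in>S. ?d h x \<partial>lborel) + (\<integral>\<^sup>+h. indicator E (x + t *\<^sub>R h) \<partial>lborel)"
        by (rule nn_integral_add) (auto simp: fdiff_def)
      also have "(\<integral>\<^sup>+h. indicator E (x + t *\<^sub>R h) \<partial>lborel) = ennreal (1 / t ^ DIM('a)) * ennreal e"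
        using t e by (subst nn_integral_lborel_affine) auto
      also have "\<dots> \<le> ennreal (V / 2)"
        using t e te by (auto simp: ennreal_mult[symmetric] field_simps intro!: ennreal_leI)
      finally show ?thesis by (simp add: add_left_mono)
    qed
    then show "ennreal V * indicator E x \<le> (\<integral>\<^sup>+h\<in>S. ?d h x \<partial>lborel) + ennreal (V / 2) * indicator E x"
      by (auto split: split_indicator)
  qed
  also have "\<dots> = (\<integral>\<^sup>+x. \<integral>\<^sup>+h. ?d h x * indicator S h \<partial>lborel \<partial>lborel) + ennreal (V / 2) * ennreal e"
    using e by (subst nn_integral_add) (auto simp: nn_integral_cmult_indicator fdiff_def)
  also have "(\<integral>\<^sup>+x. \<integral>\<^sup>+h. ?d h x * indicator S h \<partial>lborel \<partial>lborel) = (\<integral>\<^sup>+h. \<integral>\<^sup>+x. ?d h x * indicator S h \<partial>lborel \<partial>lborel)"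
    by (rule lborel_pair.Fubini') (simp add: case_prod_beta' fdiff_def)
  also have "\<dots> = (\<integral>\<^sup>+h\<in>S. (\<integral>\<^sup>+x. ?d h x \<partial>lborel) \<partial>lborel)"
    by (subst nn_integral_multc) (auto simp: fdiff_def)
  finally have le: "ennreal (V * e) \<le> (\<integral>\<^sup>+h\<in>S. (\<integral>\<^sup>+x. ?d h x \<partial>lborel) \<partial>lborel) + ennreal (V * e / 2)"
    using V e by (simp add: ennreal_mult[symmetric])
  show ?thesis
  proof (cases "(\<integral>\<^sup>+h\<in>S. (\<integral>\<^sup>+x. ?d h x \<partial>lborel) \<partial>lborel)")
    case (real r)
    have "V * e \<le> r + V * e / 2"
      using le V e real by (simp add: ennreal_plus[symmetric] del: ennreal_plus)
    then have "ennreal (V * e) \<le> ennreal (2 * r)" by (intro ennreal_leI) simp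
    then show ?thesis using real by (simp add: ennreal_mult)
  qed simp
qed

lemma nn_integral_level_sets_abs_diff:
  fixes a b :: real
  assumes "0 \<le> a" "0 \<le> b"
  shows "(\<integral>\<^sup>+l\<in>{0<..}. ennreal \<bar>indicat_real {l<..} b - indicat_real {l<..} a\<bar> \<partial>lborel) = ennreal \<bar>b - a\<bar>"
proof -
  have "(\<integral>\<^sup>+l\<in>{0<..}. ennreal \<bar>indicat_real {l<..} b - indicat_real {l<..} a\<bar> \<partial>lborel)
    = (\<integral>\<^sup>+l. indicator {min a b..<max a b} l \<partial>lborel)"
  proof (rule nn_integral_cong_AE)
    have "AE l in lborel. l \<noteq> (0::real)" by (rule AE_lborel_singleton)
    then show "AE l in lborel. ennreal \<bar>indicat_real {l<..} b - indicat_real {l<..} a\<bar> * indicator {0<..} l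
        = indicator {min a b..<max a b} l"
      by eventually_elim (use assms in \<open>auto split: split_indicator\<close>)
  qed
  also have "\<dots> = ennreal \<bar>b - a\<bar>" by (simp add: abs_if max_def min_def)
  finally show ?thesis .
qed

text \<open>
  \<open>||u| - |v||\<close> is the length of the set of levels that separate \<open>|u|\<close> from \<open>|v|\<close>.
\<close>

lemma coarea_fdiff:
  fixes f :: "'a::euclidean_space \<Rightarrow> real"
  assumes [measurable]: "f \<in> borel_measurable borel"
  shows "(\<integral>\<^sup>+l\<in>{0<..}. (\<integral>\<^sup>+x. ennreal \<bar>fdiff h (indicat_real {x. l < \<bar>f x\<bar>}) x\<bar> \<partial>lborel) \<partial>lborel)
     \<le> (\<integral>\<^sup>+x. ennreal \<bar>fdiff h f x\<bar> \<partial>lborel)"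
proof -
  let ?d = "\<lambda>l x. ennreal \<bar>fdiff h (indicat_real {x. l < \<bar>f x\<bar>}) x\<bar>"
  have m[measurable]: "(\<lambda>w. ?d (fst w) (snd w)) \<in> borel_measurable (lborel \<Otimes>\<^sub>M lborel)"
    unfolding fdiff_def indicator_def by measurable
  have [measurable]: "?d l \<in> borel_measurable lborel" for l
    unfolding fdiff_def indicator_def by measurable
  have "(\<integral>\<^sup>+l\<in>{0<..}. (\<integral>\<^sup>+x. ?d l x \<partial>lborel) \<partial>lborel) = (\<integral>\<^sup>+l. \<integral>\<^sup>+x. ?d l x * indicator {0<..} l \<partial>lborel \<partial>lborel)"
    by (intro nn_integral_cong nn_integral_multc[symmetric]) measurable
  also have "\<dots> = (\<integral>\<^sup>+x. \<integral>\<^sup>+l. ?d l x * indicator {0<..} l \<partial>lborel \<partial>lborel)"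
    by (rule lborel_pair.Fubini'[symmetric]) (simp add: case_prod_beta')
  also have "\<dots> = (\<integral>\<^sup>+x. ennreal \<bar>\<bar>f (x + h)\<bar> - \<bar>f x\<bar>\<bar> \<partial>lborel)"
  proof (rule nn_integral_cong)
    fix x
    have "(\<integral>\<^sup>+l. ?d l x * indicator {0<..} l \<partial>lborel) =
      (\<integral>\<^sup>+l\<in>{0<..}. ennreal \<bar>indicat_real {l<..} \<bar>f (x + h)\<bar> - indicat_real {l<..} \<bar>f x\<bar>\<bar> \<partial>lborel)"
      by (intro nn_integral_cong) (simp add: fdiff_def indicator_def)
    also have "\<dots> = ennreal \<bar>\<bar>f (x + h)\<bar> - \<bar>f x\<bar>\<bar>" by (rule nn_integral_level_sets_abs_diff) auto
    finally show "(\<integral>\<^sup>+l. ?d l x * indicator {0<..} l \<partial>lborel) = ennreal \<bar>\<bar>f (x + h)\<bar> - \<bar>f x\<bar>\<bar>" .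
  qed
  also have "\<dots> \<le> (\<integral>\<^sup>+x. ennreal \<bar>fdiff h f x\<bar> \<partial>lborel)"
    by (intro nn_integral_mono ennreal_leI) (simp add: fdiff_def abs_triangle_ineq3)
  finally show ?thesis .
qed

lemma level_set_measure:
  fixes f :: "'a::euclidean_space \<Rightarrow> real"
  assumes [measurable]: "f \<in> borel_measurable borel" and q: "0 < q" and A: "Lp_energy q f = ennreal A" "0 \<le> A" and l: "0 < l"
  shows "ennreal (l powr q) * emeasure lborel {x. l < \<bar>f x\<bar>} \<le> ennreal A"
proof -
  have "ennreal (l powr q) * emeasure lborel {x. l < \<bar>f x\<bar>} = (\<integral>\<^sup>+x. ennreal (l powr q) * indicator {x. l < \<bar>f x\<bar>} x \<partial>lborel)"
    by (rule nn_integral_cmult_indicator[symmetric]) simp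
  also have "\<dots> \<le> (\<integral>\<^sup>+x. ennreal (\<bar>f x\<bar> powr q) \<partial>lborel)"
    using l q by (intro nn_integral_mono) (auto split: split_indicator intro!: ennreal_leI powr_mono2)
  also have "\<dots> = ennreal A" using A by (simp add: Lp_energy_def nn_integral_completion)
  finally show ?thesis .
qed

text \<open>
  Every level set needs a scale of its own. The scale for level \<open>l\<close> is rounded up to a multiple \<open>n r\<close>
  of a common step \<open>r\<close>; by subadditivity the difference with step \<open>n r h\<close> is at most \<open>n\<close> times the one
  with step \<open>r h\<close>, so that the integral over \<open>l\<close> can be estimated by the coarea inequality for a
  single step. Rounding costs at most \<open>r\<close> in the denominator.
\<close>

lemma level_sets_regularized:
  fixes f :: "'a::euclidean_space \<Rightarrow> real" and S :: "'a set" 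
  defines "N \<equiv> real DIM('a)"
  assumes f[measurable]: "f \<in> borel_measurable borel" and S[measurable]: "S \<in> sets borel"
    and V: "emeasure lborel S = ennreal V" "0 < V" and q: "0 < q"
    and A: "Lp_energy q f = ennreal A" "0 \<le> A"
    and I: "\<And>h r. h \<in> S \<Longrightarrow> 0 < r \<Longrightarrow> (\<integral>\<^sup>+x. ennreal \<bar>fdiff (r *\<^sub>R h) f x\<bar> \<partial>lborel) \<le> ennreal r"
    and r: "0 < r"
  defines "e \<equiv> \<lambda>l. measure lborel {x. l < \<bar>f x\<bar>}"
  shows "(\<integral>\<^sup>+l\<in>{0<..}. ennreal (e l / ((2 * e l / V) powr (1 / N) + r)) \<partial>lborel) \<le> 2"
proof -
  let ?E = "\<lambda>l. {x. l < \<bar>f x\<bar>}"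
  let ?d = "\<lambda>t h l x. ennreal \<bar>fdiff (t *\<^sub>R h) (indicat_real (?E l)) x\<bar>"
  have N: "0 < N" by (simp add: N_def)
  have fin: "emeasure lborel (?E l) = ennreal (e l)" if "0 < l" for l
  proof -
    have "emeasure lborel (?E l) \<noteq> top"
      using level_set_measure[OF f q A that] that q by (auto simp: ennreal_mult_top top_unique)
    then show ?thesis unfolding e_def by (simp add: emeasure_eq_ennreal_measure)
  qed
  have e0: "0 \<le> e l" for l by (simp add: e_def)
  have [measurable]: "Measurable.pred (borel \<Otimes>\<^sub>M borel) (\<lambda>z. fst z < \<bar>f (snd z)\<bar>)" by measurable
  have "(\<integral>\<^sup>+l\<in>{0<..}. ennreal (V * (e l / ((2 * e l / V) powr (1 / N) + r))) \<partial>lborel)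
      \<le> (\<integral>\<^sup>+l. ennreal (2 / r) * ((\<integral>\<^sup>+h\<in>S. (\<integral>\<^sup>+x. ?d r h l x \<partial>lborel) \<partial>lborel) * indicator {0<..} l) \<partial>lborel)"
  proof (rule nn_integral_mono)
    fix l :: real
    have "ennreal (V * (e l / ((2 * e l / V) powr (1 / N) + r))) \<le>
        ennreal (2 / r) * (\<integral>\<^sup>+h\<in>S. (\<integral>\<^sup>+x. ?d r h l x \<partial>lborel) \<partial>lborel)" if l: "0 < l"
    proof (cases "e l = 0")
      case False
      then have el: "0 < e l" using e0[of l] by simp
      define t0 where "t0 = (2 * e l / V) powr (1 / N)"
      have t0: "0 < t0" using el V by (simp add: t0_def)
      \<comment> \<open>the ideal scale \<open>t0\<close> rounded up to a multiple of \<open>r\<close>\<close>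
      define n where "n = nat \<lceil>t0 / r\<rceil>"
      have n: "t0 \<le> real n * r" "real n * r \<le> t0 + r" "0 < n"
      proof -
        have "0 < t0 / r" using t0 r by simp
        then show "0 < n" by (simp add: n_def)
        have "t0 / r \<le> real n" unfolding n_def by (rule real_nat_ceiling_ge)
        then show "t0 \<le> real n * r" using r by (simp add: field_simps)
        have "real n \<le> t0 / r + 1" using \<open>0 < t0 / r\<close> unfolding n_def by linarith
        then show "real n * r \<le> t0 + r" using r by (simp add: field_simps)
      qed
      \<comment> \<open>at scale \<open>t0\<close> the dilate of \<open>S\<close> has twice the volume of the level set\<close>
      have "t0 ^ DIM('a) = 2 * e l / V"
        using el V by (simp add: t0_def powr_powr N_def flip: powr_realpow)
      then have "2 * e l = t0 ^ DIM('a) * V" using V by simp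
      also have "\<dots> \<le> (real n * r) ^ DIM('a) * V"
        using n t0 V by (intro mult_right_mono power_mono) auto
      finally have te: "2 * e l \<le> (real n * r) ^ DIM('a) * V" .
      have "ennreal (V * e l) \<le> 2 * (\<integral>\<^sup>+h\<in>S. (\<integral>\<^sup>+x. ?d (real n * r) h l x \<partial>lborel) \<partial>lborel)"
        using n r by (intro set_average_displacement[OF _ S V _ fin[OF l] e0 te]) auto
      also have "\<dots> \<le> 2 * (\<integral>\<^sup>+h. ennreal (real n) * ((\<integral>\<^sup>+x. ?d r h l x \<partial>lborel) * indicator S h) \<partial>lborel)"
      proof (intro mult_left_mono nn_integral_mono)
        fix h
        show "(\<integral>\<^sup>+x. ?d (real n * r) h l x \<partial>lborel) * indicator S h \<le> ennreal (real n) * ((\<integral>\<^sup>+x. ?d r h l x \<partial>lborel) * indicator S h)"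
          using fdiff_subadditive[of "indicat_real (?E l)" n "r *\<^sub>R h"] by (auto split: split_indicator)
      qed simp
      also have "\<dots> = 2 * (ennreal (real n) * (\<integral>\<^sup>+h\<in>S. (\<integral>\<^sup>+x. ?d r h l x \<partial>lborel) \<partial>lborel))"
        by (subst nn_integral_cmult) (auto simp: fdiff_def indicator_def)
      finally have le: "ennreal (V * e l) \<le> 2 * (ennreal (real n) * (\<integral>\<^sup>+h\<in>S. (\<integral>\<^sup>+x. ?d r h l x \<partial>lborel) \<partial>lborel))" .
      have "V * (e l / (t0 + r)) \<le> 1 / (real n * r) * (V * e l)"
        using divide_left_mono[of "real n * r" "t0 + r" "V * e l"] n r V el t0 by simp
      then have "ennreal (V * (e l / (t0 + r))) \<le> ennreal (1 / (real n * r)) * ennreal (V * e l)"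
        using n r V e0[of l] by (subst ennreal_mult[symmetric]) (auto intro!: ennreal_leI)
      also have "\<dots> \<le> ennreal (1 / (real n * r)) * (2 * (ennreal (real n) * (\<integral>\<^sup>+h\<in>S. (\<integral>\<^sup>+x. ?d r h l x \<partial>lborel) \<partial>lborel)))"
        by (intro mult_left_mono le) simp
      also have "\<dots> = (ennreal (1 / (real n * r)) * (ennreal 2 * ennreal (real n))) * (\<integral>\<^sup>+h\<in>S. (\<integral>\<^sup>+x. ?d r h l x \<partial>lborel) \<partial>lborel)"
        by (simp add: mult.assoc)
      also have "ennreal (1 / (real n * r)) * (ennreal 2 * ennreal (real n)) = ennreal (2 / r)"
      proof -
        have "ennreal (2 / r) = ennreal (1 / (real n * r) * (2 * real n))" using n r by simp
        also have "\<dots> = ennreal (1 / (real n * r)) * ennreal (2 * real n)"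
          using n r by (intro ennreal_mult) auto
        also have "ennreal (2 * real n) = ennreal 2 * ennreal (real n)" by (intro ennreal_mult) auto
        finally show ?thesis by simp
      qed
      finally show ?thesis unfolding t0_def .
    qed simp
    then show "ennreal (V * (e l / ((2 * e l / V) powr (1 / N) + r))) * indicator {0<..} l \<le>
        ennreal (2 / r) * ((\<integral>\<^sup>+h\<in>S. (\<integral>\<^sup>+x. ?d r h l x \<partial>lborel) \<partial>lborel) * indicator {0<..} l)"
      by (auto split: split_indicator)
  qed
  also have "\<dots> = ennreal (2 / r) * (\<integral>\<^sup>+l. \<integral>\<^sup>+h. (\<integral>\<^sup>+x. ?d r h l x \<partial>lborel) * indicator S h * indicator {0<..} l \<partial>lborel \<partial>lborel)"
    by (subst nn_integral_cmult) (auto simp: fdiff_def indicator_def nn_integral_multc)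
  also have "(\<integral>\<^sup>+l. \<integral>\<^sup>+h. (\<integral>\<^sup>+x. ?d r h l x \<partial>lborel) * indicator S h * indicator {0<..} l \<partial>lborel \<partial>lborel)
      = (\<integral>\<^sup>+h. \<integral>\<^sup>+l. (\<integral>\<^sup>+x. ?d r h l x \<partial>lborel) * indicator S h * indicator {0<..} l \<partial>lborel \<partial>lborel)"
    by (rule lborel_pair.Fubini') (simp add: case_prod_beta' fdiff_def indicator_def)
  also have "\<dots> \<le> (\<integral>\<^sup>+h. ennreal r * indicator S h \<partial>lborel)"
  proof (rule nn_integral_mono)
    fix h
    have "(\<integral>\<^sup>+l. (\<integral>\<^sup>+x. ?d r h l x \<partial>lborel) * indicator S h * indicator {0<..} l \<partial>lborel) =
      (\<integral>\<^sup>+l\<in>{0<..}. (\<integral>\<^sup>+x. ?d r h l x \<partial>lborel) \<partial>lborel) * indicator S h"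
      by (subst nn_integral_multc[symmetric]) (auto simp: mult_ac fdiff_def indicator_def)
    also have "\<dots> \<le> ennreal r * indicator S h"
      using order_trans[OF coarea_fdiff[OF f, of "r *\<^sub>R h"] I[of h r]] r by (auto split: split_indicator)
    finally show "(\<integral>\<^sup>+l. (\<integral>\<^sup>+x. ?d r h l x \<partial>lborel) * indicator S h * indicator {0<..} l \<partial>lborel) \<le> ennreal r * indicator S h" .
  qed
  also have "\<dots> = ennreal r * ennreal V" using V by (simp add: nn_integral_cmult_indicator)
  finally have "(\<integral>\<^sup>+l\<in>{0<..}. ennreal (V * (e l / ((2 * e l / V) powr (1 / N) + r))) \<partial>lborel) \<le> ennreal (2 / r) * (ennreal r * ennreal V)"
    by (simp add: mult_left_mono)
  also have "\<dots> = ennreal V * 2" using r V by (simp add: ennreal_mult[symmetric] mult.assoc[symmetric])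
      (simp add: ennreal_mult mult.commute)
  finally have "(\<integral>\<^sup>+l\<in>{0<..}. ennreal (V * (e l / ((2 * e l / V) powr (1 / N) + r))) \<partial>lborel) \<le> ennreal V * 2" .
  moreover have "(\<integral>\<^sup>+l\<in>{0<..}. ennreal (V * (e l / ((2 * e l / V) powr (1 / N) + r))) \<partial>lborel) =
      ennreal V * (\<integral>\<^sup>+l\<in>{0<..}. ennreal (e l / ((2 * e l / V) powr (1 / N) + r)) \<partial>lborel)"
  proof -
    have [measurable]: "e \<in> borel_measurable borel"
      unfolding e_def measure_def by measurable
    have "(\<integral>\<^sup>+l\<in>{0<..}. ennreal (V * (e l / ((2 * e l / V) powr (1 / N) + r))) \<partial>lborel) =
       (\<integral>\<^sup>+l. ennreal V * (ennreal (e l / ((2 * e l / V) powr (1 / N) + r)) * indicator {0<..} l) \<partial>lborel)"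
      by (simp only: ennreal_mult'[OF less_imp_le[OF V(2)]] mult.assoc)
    also have "\<dots> = ennreal V * (\<integral>\<^sup>+l\<in>{0<..}. ennreal (e l / ((2 * e l / V) powr (1 / N) + r)) \<partial>lborel)"
      by (rule nn_integral_cmult) simp
    finally show ?thesis .
  qed
  ultimately have "ennreal V * (\<integral>\<^sup>+l\<in>{0<..}. ennreal (e l / ((2 * e l / V) powr (1 / N) + r)) \<partial>lborel) \<le> ennreal V * 2" by simp
  then show ?thesis using V by (simp add: ennreal_mult_le_mult_iff)
qed

text \<open>
  This is the limit \<open>r \<rightarrow> 0\<close> in the regularized inequality, by Fatou's lemma.
\<close>

lemma level_sets_integrated:
  fixes f :: "'a::euclidean_space \<Rightarrow> real" and S :: "'a set" 
  defines "N \<equiv> real DIM('a)"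
  assumes f[measurable]: "f \<in> borel_measurable borel" and S[measurable]: "S \<in> sets borel"
    and V: "emeasure lborel S = ennreal V" "0 < V" and q: "0 < q"
    and A: "Lp_energy q f = ennreal A" "0 \<le> A"
    and I: "\<And>h r. h \<in> S \<Longrightarrow> 0 < r \<Longrightarrow> (\<integral>\<^sup>+x. ennreal \<bar>fdiff (r *\<^sub>R h) f x\<bar> \<partial>lborel) \<le> ennreal r"
  defines "e \<equiv> \<lambda>l. measure lborel {x. l < \<bar>f x\<bar>}"
  shows "(\<integral>\<^sup>+l\<in>{0<..}. ennreal (e l powr (1 - 1 / N)) \<partial>lborel) \<le> ennreal (2 * (2 / V) powr (1 / N))"
proof -
  have N: "0 < N" by (simp add: N_def)
  have e0: "0 \<le> e l" for l by (simp add: e_def)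
  have [measurable]: "Measurable.pred (borel \<Otimes>\<^sub>M borel) (\<lambda>z. fst z < \<bar>f (snd z)\<bar>)" by measurable
  have [measurable]: "e \<in> borel_measurable borel" unfolding e_def measure_def by measurable
  define F where "F n l = ennreal (e l / ((2 * e l / V) powr (1 / N) + 1 / real (Suc n))) * indicator {0<..} l" for n l
  have lim: "(\<lambda>n. F n l) \<longlonglongrightarrow> ennreal (e l / ((2 * e l / V) powr (1 / N))) * indicator {0<..} l" for l
  proof (cases "e l = 0")
    case False
    then have "(2 * e l / V) powr (1 / N) + 0 \<noteq> 0" using V by simp
    then have "(\<lambda>n. e l / ((2 * e l / V) powr (1 / N) + 1 / real (Suc n))) \<longlonglongrightarrow> e l / ((2 * e l / V) powr (1 / N) + 0)"
      by (intro tendsto_intros LIMSEQ_inverse_real_of_nat[unfolded inverse_eq_divide])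
    then have "(\<lambda>n. ennreal (e l / ((2 * e l / V) powr (1 / N) + 1 / real (Suc n)))) \<longlonglongrightarrow> ennreal (e l / ((2 * e l / V) powr (1 / N)))"
      by (intro tendsto_ennrealI) simp
    then show ?thesis unfolding F_def by (auto split: split_indicator)
  qed (simp add: F_def)
  have "(\<integral>\<^sup>+l\<in>{0<..}. ennreal (e l / ((2 * e l / V) powr (1 / N))) \<partial>lborel) = (\<integral>\<^sup>+l. liminf (\<lambda>n. F n l) \<partial>lborel)"
    by (intro nn_integral_cong) (simp add: lim_imp_Liminf[OF _ lim])
  also have "\<dots> \<le> liminf (\<lambda>n. \<integral>\<^sup>+l. F n l \<partial>lborel)"
    by (rule nn_integral_liminf) (simp add: F_def)
  also have "\<dots> \<le> liminf (\<lambda>n. 2)"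
    unfolding F_def e_def N_def
    by (intro Liminf_mono always_eventually allI level_sets_regularized[OF f S V q A I]) auto
  also have "\<dots> = 2" by (simp add: Liminf_const)
  finally have le: "(\<integral>\<^sup>+l\<in>{0<..}. ennreal (e l / ((2 * e l / V) powr (1 / N))) \<partial>lborel) \<le> 2" .
  have eq: "e l powr (1 - 1 / N) = (2 / V) powr (1 / N) * (e l / ((2 * e l / V) powr (1 / N)))" for l
  proof (cases "e l = 0")
    case False
    then have "0 < e l" using e0[of l] by simp
    then show ?thesis using V by (simp add: powr_diff powr_mult powr_divide field_simps)
  qed simp
  have "(\<integral>\<^sup>+l\<in>{0<..}. ennreal (e l powr (1 - 1 / N)) \<partial>lborel) =
      (\<integral>\<^sup>+l. ennreal ((2 / V) powr (1 / N)) * (ennreal (e l / ((2 * e l / V) powr (1 / N))) * indicator {0<..} l) \<partial>lborel)"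
    unfolding eq by (simp only: ennreal_mult'[OF powr_ge_zero] mult.assoc)
  also have "\<dots> = ennreal ((2 / V) powr (1 / N)) * (\<integral>\<^sup>+l\<in>{0<..}. ennreal (e l / ((2 * e l / V) powr (1 / N))) \<partial>lborel)"
    by (rule nn_integral_cmult) simp
  also have "\<dots> \<le> ennreal ((2 / V) powr (1 / N)) * 2" by (intro mult_left_mono le) simp
  also have "\<dots> = ennreal (2 * (2 / V) powr (1 / N))" by (simp add: ennreal_mult mult.commute)
  finally show ?thesis .
qed

text \<open>
  By Chebyshev's inequality \<open>l e(l)\<^sup>1\<^sup>/\<^sup>q \<le> A\<^sup>1\<^sup>/\<^sup>q\<close>, where \<open>e(l)\<close> is the measure of the level set, so that
  \<open>l\<^sup>q\<^sup>-\<^sup>1 e(l) \<le> A\<^sup>1\<^sup>/\<^sup>N e(l)\<^sup>1\<^sup>-\<^sup>1\<^sup>/\<^sup>N\<close>; the layer cake formula turns the bound on the integral of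
  \<open>e(l)\<^sup>1\<^sup>-\<^sup>1\<^sup>/\<^sup>N\<close> into a bound on \<open>A\<close>.
\<close>

lemma sobolev_from_level_sets:
  fixes f :: "'a::euclidean_space \<Rightarrow> real" and S :: "'a set" 
  defines "N \<equiv> real DIM('a)"
  assumes f[measurable]: "f \<in> borel_measurable borel" and S[measurable]: "S \<in> sets borel"
    and V: "emeasure lborel S = ennreal V" "0 < V" and N: "1 < N" and q: "q = N / (N - 1)"
    and A: "Lp_energy q f = ennreal A" "0 < A"
    and I: "\<And>h r. h \<in> S \<Longrightarrow> 0 < r \<Longrightarrow> (\<integral>\<^sup>+x. ennreal \<bar>fdiff (r *\<^sub>R h) f x\<bar> \<partial>lborel) \<le> ennreal r"
  shows "V powr (1 / N) * A powr (1 - 1 / N) \<le> 2 * q * 2 powr (1 / N)"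
proof -
  define e where "e l = measure lborel {x. l < \<bar>f x\<bar>}" for l
  have q1: "1 < q" using N by (simp add: q field_simps)
  have e0: "0 \<le> e l" for l by (simp add: e_def)
  have A0: "0 \<le> A" using A by simp
  have fin: "emeasure lborel {x. l < \<bar>f x\<bar>} = ennreal (e l)" if "0 < l" for l
  proof -
    have "emeasure lborel {x. l < \<bar>f x\<bar>} \<noteq> top"
      using level_set_measure[OF f _ A(1) A0 that] that q1 by (auto simp: ennreal_mult_top top_unique)
    then show ?thesis unfolding e_def by (simp add: emeasure_eq_ennreal_measure)
  qed
  have [measurable]: "Measurable.pred (borel \<Otimes>\<^sub>M borel) (\<lambda>z. fst z < \<bar>f (snd z)\<bar>)" by measurable
  have [measurable]: "e \<in> borel_measurable borel" unfolding e_def measure_def by measurable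
  have bd: "q * l powr (q - 1) * e l \<le> q * A powr (1 / N) * e l powr (1 - 1 / N)" if l: "0 < l" for l
  proof (cases "e l = 0")
    case False
    then have el: "0 < e l" using e0[of l] by simp
    have "l powr q * e l \<le> A"
      using level_set_measure[OF f _ A(1) A0 l] q1 A e0[of l] fin[OF l] by (simp add: ennreal_mult[symmetric])
    then have "(l powr q * e l) powr (1 / N) \<le> A powr (1 / N)"
      using el l N by (intro powr_mono2) auto
    moreover have "(l powr q * e l) powr (1 / N) = l powr (q - 1) * e l powr (1 / N)"
    proof -
      have "q * (1 / N) = q - 1" using N by (simp add: q field_simps)
      then show ?thesis using l el by (simp add: powr_mult powr_powr)
    qed
    ultimately have "l powr (q - 1) * e l powr (1 / N) * e l powr (1 - 1 / N) \<le> A powr (1 / N) * e l powr (1 - 1 / N)"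
      by (intro mult_right_mono) auto
    moreover have "e l powr (1 / N) * e l powr (1 - 1 / N) = e l"
      using el by (simp add: powr_add[symmetric])
    ultimately show ?thesis using q1 by (simp add: mult.assoc)
  qed simp
  have "ennreal A = (\<integral>\<^sup>+x. epowr (ennreal \<bar>f x\<bar>) q \<partial>lborel)"
    using A q1 by (simp add: Lp_energy_def nn_integral_completion epowr_ennreal)
  also have "\<dots> = (\<integral>\<^sup>+l\<in>{0<..}. ennreal (q * l powr (q - 1)) * emeasure lborel {x. ennreal l < ennreal \<bar>f x\<bar>} \<partial>lborel)"
    using q1 by (intro nn_integral_epowr_layer_cake) auto
  also have "\<dots> \<le> (\<integral>\<^sup>+l. ennreal (q * A powr (1 / N)) * (ennreal (e l powr (1 - 1 / N)) * indicator {0<..} l) \<partial>lborel)"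
  proof (rule nn_integral_mono)
    fix l :: real
    have "ennreal (q * l powr (q - 1)) * emeasure lborel {x. ennreal l < ennreal \<bar>f x\<bar>}
        \<le> ennreal (q * A powr (1 / N)) * ennreal (e l powr (1 - 1 / N))" if "0 < l"
      using bd[OF that] that q1 e0[of l] fin[OF that]
      by (simp add: ennreal_less_iff ennreal_mult[symmetric])
    then show "ennreal (q * l powr (q - 1)) * emeasure lborel {x. ennreal l < ennreal \<bar>f x\<bar>} * indicator {0<..} l
        \<le> ennreal (q * A powr (1 / N)) * (ennreal (e l powr (1 - 1 / N)) * indicator {0<..} l)"
      by (auto split: split_indicator)
  qed
  also have "\<dots> = ennreal (q * A powr (1 / N)) * (\<integral>\<^sup>+l\<in>{0<..}. ennreal (e l powr (1 - 1 / N)) \<partial>lborel)"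
    by (rule nn_integral_cmult) simp
  also have "\<dots> \<le> ennreal (q * A powr (1 / N)) * ennreal (2 * (2 / V) powr (1 / N))"
    unfolding e_def N_def
    by (intro mult_left_mono level_sets_integrated[OF f S V _ A(1) A0 I]) (use q1 in auto)
  also have "\<dots> = ennreal (q * A powr (1 / N) * (2 * (2 / V) powr (1 / N)))"
    using q1 by (intro ennreal_mult[symmetric]) auto
  finally have "A \<le> q * A powr (1 / N) * (2 * (2 / V) powr (1 / N))"
    using q1 by (subst (asm) ennreal_le_iff) auto
  then have "A * (V powr (1 / N) * A powr (- (1 / N))) \<le>
      q * A powr (1 / N) * (2 * (2 / V) powr (1 / N)) * (V powr (1 / N) * A powr (- (1 / N)))"
    by (rule mult_right_mono) simp
  also have "\<dots> = 2 * q * 2 powr (1 / N)"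
    using A V by (simp add: powr_divide powr_minus field_simps)
  also have "A * (V powr (1 / N) * A powr (- (1 / N))) = V powr (1 / N) * A powr (1 - 1 / N)"
    using A by (simp add: powr_diff powr_minus field_simps)
  finally show ?thesis .
qed

section \<open>Smooth bumps and test functions\<close>

text \<open>
  The functions that occur in the derivatives of \<open>exp (- 1 / t)\<close>, extended by \<open>0\<close>: the derivative
  of each is a linear combination of two others.
\<close>

definition flat :: "nat \<Rightarrow> real \<Rightarrow> real" where
  "flat j t = (if 0 < t then exp (- 1 / t) / t ^ j else 0)"

lemma flat_nonneg: "0 \<le> flat j t" by (simp add: flat_def)

lemma flat_le_square: "\<bar>flat j t\<bar> \<le> real (j + 2) ^ (j + 2) * t\<^sup>2"
proof (cases "0 < t")
  case True
  let ?n = "j + 2"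
  have "(1 / (real ?n * t)) ^ ?n \<le> (1 + (1 / t) / real ?n) ^ ?n"
    using True by (intro power_mono) (auto simp: field_simps)
  also have "\<dots> \<le> exp (1 / t)"
    using True by (intro exp_ge_one_plus_x_over_n_power_n) (auto intro: order_trans[of _ 0])
  finally have "1 / (real ?n * t) ^ ?n \<le> exp (1 / t)" by (simp only: power_one_over)
  moreover have "0 < (real ?n * t) ^ ?n" using True by simp
  ultimately have "1 \<le> exp (1 / t) * (real ?n * t) ^ ?n" by (simp only: pos_divide_le_eq)
  then have "exp (- 1 / t) * 1 \<le> exp (- 1 / t) * (exp (1 / t) * (real ?n * t) ^ ?n)"
    by (intro mult_left_mono) auto
  also have "\<dots> = (real ?n * t) ^ ?n" by (simp add: mult.assoc[symmetric] exp_add[symmetric])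
  finally have "exp (- 1 / t) \<le> real ?n ^ ?n * t\<^sup>2 * t ^ j"
    by (simp add: power_mult_distrib power_add mult_ac power2_eq_square)
  then show ?thesis using True by (simp add: flat_def divide_le_eq)
qed (simp add: flat_def)

lemma flat_has_derivative:
  "(flat j has_real_derivative (flat (j + 2) t - real j * flat (j + 1) t)) (at t)"
proof -
  consider "0 < t" | "t < 0" | "t = 0" by linarith
  then show ?thesis
  proof cases
    case 1
    have "((\<lambda>t. exp (- 1 / t) / t ^ j) has_real_derivative (flat (j + 2) t - real j * flat (j + 1) t)) (at t)"
    proof -
      have d1: "((\<lambda>t. exp (- 1 / t)) has_real_derivative exp (- 1 / t) / t\<^sup>2) (at t)"
        using 1 by (auto intro!: derivative_eq_intros simp: power2_eq_square)
      have d2: "((\<lambda>t. t ^ j) has_real_derivative real j * t ^ (j - 1)) (at t)"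
        using DERIV_pow[of j t] by simp
      have "(exp (- 1 / t) / t\<^sup>2 * t ^ j - exp (- 1 / t) * (real j * t ^ (j - 1))) / (t ^ j * t ^ j)
          = flat (j + 2) t - real j * flat (j + 1) t"
        using 1 by (cases j) (simp_all add: flat_def field_simps power2_eq_square)
      then show ?thesis using DERIV_divide[OF d1 d2] 1 by simp
    qed
    then show ?thesis
      by (rule DERIV_cong_ev[THEN iffD1, rotated -1, OF _ refl])
         (use 1 in \<open>auto simp: flat_def eventually_nhds intro!: exI[of _ "{0<..}"]\<close>)
  next
    case 2
    have "((\<lambda>t. 0) has_real_derivative (flat (j + 2) t - real j * flat (j + 1) t)) (at t)"
      using 2 by (auto intro!: derivative_eq_intros simp: flat_def)
    then show ?thesis
      by (rule DERIV_cong_ev[THEN iffD1, rotated -1, OF _ refl])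
         (use 2 in \<open>auto simp: flat_def eventually_nhds intro!: exI[of _ "{..<0}"]\<close>)
  next
    case 3
    have "(\<lambda>x. flat j x / x) \<midarrow>0\<rightarrow> 0"
    proof (rule Lim_null_comparison)
      show "\<forall>\<^sub>F x in at 0. norm (flat j x / x) \<le> real (j + 2) ^ (j + 2) * \<bar>x\<bar>"
      proof (intro always_eventually allI)
        fix x
        show "norm (flat j x / x) \<le> real (j + 2) ^ (j + 2) * \<bar>x\<bar>"
        proof (cases "x = 0")
          case False
          then show ?thesis using flat_le_square[of j x] by (simp add: divide_le_eq power2_eq_square abs_mult_self_eq mult.assoc)
        qed simp
      qed
      have "((\<lambda>x. real (j + 2) ^ (j + 2) * \<bar>x\<bar>) \<longlongrightarrow> real (j + 2) ^ (j + 2) * \<bar>0\<bar>) (at 0)"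
        by (intro tendsto_intros)
      then show "((\<lambda>x. real (j + 2) ^ (j + 2) * \<bar>x\<bar>) \<longlongrightarrow> 0) (at 0)" by simp
    qed
    then show ?thesis using 3 by (simp add: DERIV_def flat_def[of _ 0])
  qed
qed

text \<open>
  An algebra of functions that is closed under directional derivatives by construction, so that all its
  members are smooth and no partial derivative has to be computed.
\<close>

inductive flat_algebra :: "('a::euclidean_space \<Rightarrow> real) \<Rightarrow> bool" where
  flat: "flat_algebra (\<lambda>x. flat j (x \<bullet> v + c))"
| const: "flat_algebra (\<lambda>x. c)"
| add: "flat_algebra f \<Longrightarrow> flat_algebra g \<Longrightarrow> flat_algebra (\<lambda>x. f x + g x)"
| mult: "flat_algebra f \<Longrightarrow> flat_algebra g \<Longrightarrow> flat_algebra (\<lambda>x. f x * g x)"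

lemma flat_algebra_derivative:
  "flat_algebra f \<Longrightarrow> \<exists>D. (\<forall>x. (f has_derivative D x) (at x)) \<and> (\<forall>v. flat_algebra (\<lambda>x. D x v))"
proof (induction rule: flat_algebra.induct)
  case (flat j v c)
  let ?D = "\<lambda>x u. (flat (j + 2) (x \<bullet> v + c) + (- real j) * flat (j + 1) (x \<bullet> v + c)) * (u \<bullet> v)"
  have "((\<lambda>x. flat j (x \<bullet> v + c)) has_derivative ?D x) (at x)" for x
  proof -
    have "(flat j has_derivative (\<lambda>u. (flat (j + 2) (x \<bullet> v + c) - real j * flat (j + 1) (x \<bullet> v + c)) * u)) (at (x \<bullet> v + c))"
      using flat_has_derivative[of j "x \<bullet> v + c"] by (simp add: has_field_derivative_def)
    from has_derivative_compose[of "\<lambda>x. x \<bullet> v + c" "\<lambda>u. u \<bullet> v" x UNIV, OF _ this]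
    have "((\<lambda>x. x \<bullet> v + c) has_derivative (\<lambda>u. u \<bullet> v)) (at x) \<Longrightarrow> ?thesis" by simp
    moreover have "((\<lambda>x. x \<bullet> v + c) has_derivative (\<lambda>u. u \<bullet> v)) (at x)"
      by (auto intro!: derivative_eq_intros)
    ultimately show ?thesis by blast
  qed
  moreover have "flat_algebra (\<lambda>x. ?D x u)" for u
    by (intro flat_algebra.intros)
  ultimately show ?case by (intro exI[of _ ?D]) auto
next
  case (const c)
  show ?case by (intro exI[of _ "\<lambda>x u. 0"]) (auto intro: flat_algebra.const)
next
  case (add f g)
  then obtain D E where "\<forall>x. (f has_derivative D x) (at x)" "\<forall>v. flat_algebra (\<lambda>x. D x v)"
    "\<forall>x. (g has_derivative E x) (at x)" "\<forall>v. flat_algebra (\<lambda>x. E x v)" by blast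
  then show ?case
    by (intro exI[of _ "\<lambda>x u. D x u + E x u"]) (auto intro: flat_algebra.add has_derivative_add)
next
  case (mult f g)
  then obtain D E where "\<forall>x. (f has_derivative D x) (at x)" "\<forall>v. flat_algebra (\<lambda>x. D x v)"
    "\<forall>x. (g has_derivative E x) (at x)" "\<forall>v. flat_algebra (\<lambda>x. E x v)" by blast
  then show ?case using mult.hyps
    by (intro exI[of _ "\<lambda>x u. f x * E x u + D x u * g x"])
       (auto intro!: flat_algebra.add flat_algebra.mult has_derivative_mult)
qed

lemma flat_algebra_iter: "flat_algebra f \<Longrightarrow> flat_algebra (iter_dderiv vs f)"
proof (induction vs)
  case (Cons v vs)
  then obtain D where D: "\<forall>x. (iter_dderiv vs f has_derivative D x) (at x)" "\<forall>v. flat_algebra (\<lambda>x. D x v)"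
    using flat_algebra_derivative by blast
  then have "frechet_derivative (iter_dderiv vs f) (at x) = D x" for x
    by (metis frechet_derivative_at)
  then show ?case using D by simp
qed simp

lemma smooth_flat_algebra: "flat_algebra f \<Longrightarrow> smooth_fun f"
  unfolding smooth_fun_def differentiable_def
  using flat_algebra_iter flat_algebra_derivative by blast

lemma flat_algebra_prod:
  "finite B \<Longrightarrow> (\<And>i. i \<in> B \<Longrightarrow> flat_algebra (F i)) \<Longrightarrow> flat_algebra (\<lambda>x. \<Prod>i\<in>B. F i x)"
  by (induction B rule: finite_induct) (auto intro: flat_algebra.intros)

text \<open>
  As \<open>n\<close> grows, these bumps increase to the indicator function of the box.
\<close>

definition box_bump :: "'a::euclidean_space \<Rightarrow> 'a \<Rightarrow> real \<Rightarrow> 'a \<Rightarrow> real" where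
  "box_bump a b n x = (\<Prod>i\<in>Basis. flat 0 (n * (x \<bullet> i - a \<bullet> i)) * flat 0 (n * (b \<bullet> i - x \<bullet> i)))"

lemma box_bump_zero: "0 < n \<Longrightarrow> x \<notin> box a b \<Longrightarrow> box_bump a b n x = 0"
  by (auto simp: box_bump_def flat_def mem_box zero_less_mult_iff intro!: prod_zero)

lemma box_bump_le_1: "0 < n \<Longrightarrow> \<bar>box_bump a b n x\<bar> \<le> 1"
proof -
  assume "0 < n"
  have "flat 0 t \<le> 1" for t by (simp add: flat_def)
  then show ?thesis unfolding box_bump_def abs_prod
    by (intro prod_le_1) (auto simp: abs_mult flat_nonneg intro!: mult_le_one)
qed

lemma box_bump_tendsto:
  fixes a b x :: "'a::euclidean_space"
  shows "(\<lambda>n. box_bump a b (real (Suc n)) x) \<longlonglongrightarrow> indicator (box a b) x"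
proof (cases "x \<in> box a b")
  case False
  then have "(\<lambda>n. box_bump a b (real (Suc n)) x) = (\<lambda>n. 0)" by (intro ext box_bump_zero) auto
  then show ?thesis using False by simp
next
  case True
  have lim: "(\<lambda>n. flat 0 (real (Suc n) * d)) \<longlonglongrightarrow> 1" if "0 < d" for d
  proof -
    have "(\<lambda>n. exp (- ((1 / d) * inverse (real (Suc n))))) \<longlonglongrightarrow> exp (- ((1 / d) * 0))"
      by (intro tendsto_intros LIMSEQ_inverse_real_of_nat)
    moreover have "(\<lambda>n. flat 0 (real (Suc n) * d)) = (\<lambda>n. exp (- ((1 / d) * inverse (real (Suc n)))))"
      using that by (auto simp: flat_def fun_eq_iff field_simps simp del: of_nat_Suc)
    ultimately show ?thesis by simp
  qed
  have "(\<lambda>n. box_bump a b (real (Suc n)) x) \<longlonglongrightarrow> (\<Prod>i\<in>(Basis :: 'a set). 1 * 1)"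
    unfolding box_bump_def
    by (rule tendsto_prod, rule tendsto_mult; rule lim) (use True in \<open>auto simp: mem_box\<close>)
  then show ?thesis using True by simp
qed

lemma test_function_box_bump:
  assumes "0 < n" shows "test_function (box_bump a b n)"
proof -
  have "flat_algebra (\<lambda>x. flat 0 (x \<bullet> (n *\<^sub>R i) + (- n * (a \<bullet> i))) * flat 0 (x \<bullet> ((- n) *\<^sub>R i) + n * (b \<bullet> i)))" for i
    by (intro flat_algebra.intros)
  then have "flat_algebra (\<lambda>x. flat 0 (n * (x \<bullet> i - a \<bullet> i)) * flat 0 (n * (b \<bullet> i - x \<bullet> i)))" for i
    by (simp add: algebra_simps)
  then have "flat_algebra (box_bump a b n)"
    unfolding box_bump_def[abs_def] by (intro flat_algebra_prod) auto
  moreover have "compact (closure {x. box_bump a b n x \<noteq> 0})"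
  proof -
    have "{x. box_bump a b n x \<noteq> 0} \<subseteq> box a b" using box_bump_zero[OF assms] by blast
    then show ?thesis using bounded_box bounded_subset by (metis compact_closure)
  qed
  ultimately show ?thesis by (simp add: test_function_def smooth_flat_algebra)
qed

lemma iter_dderiv_append: "iter_dderiv (vs @ ws) f = iter_dderiv vs (iter_dderiv ws f)"
  by (induction vs) auto

lemma smooth_fun_iter: "smooth_fun f \<Longrightarrow> smooth_fun (iter_dderiv vs f)"
  unfolding smooth_fun_def by (metis iter_dderiv_append)

lemma smooth_fun_differentiable: "smooth_fun f \<Longrightarrow> iter_dderiv vs f differentiable (at x)"
  by (simp add: smooth_fun_def)

lemma smooth_fun_has_derivative:
  assumes "smooth_fun f"
  shows "(f has_derivative (\<lambda>v. iter_dderiv [v] f x)) (at x)"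
proof -
  have "f differentiable (at x)" using smooth_fun_differentiable[OF assms, of "[]" x] by simp
  then have "(f has_derivative frechet_derivative f (at x)) (at x)" by (simp add: frechet_derivative_works)
  then show ?thesis by simp
qed

lemma continuous_smooth_fun: "smooth_fun f \<Longrightarrow> continuous_on UNIV f"
  by (meson smooth_fun_has_derivative has_derivative_continuous continuous_at_imp_continuous_on)

lemma test_function_support:
  assumes "test_function \<phi>" obtains R where "0 < R" "\<And>x. R \<le> norm x \<Longrightarrow> \<phi> x = 0"
proof -
  have "bounded (closure {x. \<phi> x \<noteq> 0})" using assms by (simp add: test_function_def compact_imp_bounded)
  then obtain R where R: "0 < R" "\<forall>x\<in>closure {x. \<phi> x \<noteq> 0}. norm x < R" unfolding bounded_pos_less by blast
  have "\<phi> x = 0" if "R \<le> norm x" for x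
    using R that closure_subset[of "{x. \<phi> x \<noteq> 0}"] by force
  then show thesis using that[OF R(1)] by blast
qed

lemma test_functionI:
  assumes "smooth_fun \<phi>" "\<And>x. R \<le> norm x \<Longrightarrow> \<phi> x = 0"
  shows "test_function \<phi>"
proof -
  have "{x. \<phi> x \<noteq> 0} \<subseteq> ball 0 R" using assms(2) by force
  then show ?thesis using assms(1) bounded_ball bounded_subset by (auto simp: test_function_def compact_closure)
qed

text \<open>
  The inequality \<open>R < norm x\<close> is strict because a derivative needs a neighbourhood on which the
  function vanishes.
\<close>

lemma iter_dderiv_eq_0:
  assumes "\<And>x. R \<le> norm x \<Longrightarrow> f x = 0" "R < norm x"
  shows "iter_dderiv vs f x = 0"
  using assms(2)
proof (induction vs arbitrary: x)
  case (Cons v vs)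
  have "((\<lambda>x. 0) has_derivative (\<lambda>v. 0)) (at x)" by (rule has_derivative_const)
  then have "(iter_dderiv vs f has_derivative (\<lambda>v. 0)) (at x)"
  proof (rule has_derivative_transform_within_open)
    show "open {x. R < norm x}" by (intro open_Collect_less continuous_intros)
  qed (use Cons in auto)
  then show ?case by (simp add: frechet_derivative_at[symmetric])
qed (use assms in auto)

lemma test_function_iter:
  assumes "test_function \<phi>" shows "test_function (iter_dderiv vs \<phi>)"
proof -
  obtain R where R: "0 < R" "\<And>x. R \<le> norm x \<Longrightarrow> \<phi> x = 0" using test_function_support[OF assms] by metis
  show ?thesis
  proof (rule test_functionI[of _ "R + 1"])
    show "smooth_fun (iter_dderiv vs \<phi>)" using assms by (simp add: test_function_def smooth_fun_iter)
    show "iter_dderiv vs \<phi> x = 0" if "R + 1 \<le> norm x" for x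
      using R(2) that by (intro iter_dderiv_eq_0[of R]) auto
  qed
qed

lemma iter_dderiv_translate:
  assumes "smooth_fun f"
  shows "iter_dderiv vs (\<lambda>x. f (x - a)) = (\<lambda>x. iter_dderiv vs f (x - a))"
proof (induction vs)
  case (Cons v vs)
  have "frechet_derivative (\<lambda>x. iter_dderiv vs f (x - a)) (at x) = frechet_derivative (iter_dderiv vs f) (at (x - a))" for x
  proof -
    have "(iter_dderiv vs f has_derivative frechet_derivative (iter_dderiv vs f) (at (x - a))) (at (x - a))"
      using smooth_fun_differentiable[OF assms] frechet_derivative_works by blast
    from has_derivative_compose[of "\<lambda>x. x - a" "\<lambda>v. v" x UNIV, OF _ this]
    have "((\<lambda>x. x - a) has_derivative (\<lambda>v. v)) (at x) \<Longrightarrow>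
      ((\<lambda>x. iter_dderiv vs f (x - a)) has_derivative frechet_derivative (iter_dderiv vs f) (at (x - a))) (at x)" .
    moreover have "((\<lambda>x. x - a) has_derivative (\<lambda>v. v)) (at x)"
      by (auto intro!: derivative_eq_intros)
    ultimately have "((\<lambda>x. iter_dderiv vs f (x - a)) has_derivative frechet_derivative (iter_dderiv vs f) (at (x - a))) (at x)"
      by blast
    then show ?thesis by (metis frechet_derivative_at)
  qed
  then show ?case using Cons by simp
qed simp

lemma test_function_translate:
  assumes "test_function \<phi>" shows "test_function (\<lambda>x. \<phi> (x - a))"
proof -
  obtain R where R: "0 < R" "\<And>x. R \<le> norm x \<Longrightarrow> \<phi> x = 0" using test_function_support[OF assms] by metis
  have sm: "smooth_fun \<phi>" using assms by (simp add: test_function_def)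
  show ?thesis
  proof (rule test_functionI[of _ "R + norm a"])
    show "smooth_fun (\<lambda>x. \<phi> (x - a))"
      unfolding smooth_fun_def iter_dderiv_translate[OF sm]
    proof (intro allI)
      fix vs x
      have "iter_dderiv vs \<phi> differentiable at (x - a)" using smooth_fun_differentiable[OF sm] .
      then show "(\<lambda>x. iter_dderiv vs \<phi> (x - a)) differentiable at x"
        by (intro differentiable_compose[of "iter_dderiv vs \<phi>" "\<lambda>x. x - a"] derivative_intros) auto
    qed
    show "\<phi> (x - a) = 0" if "R + norm a \<le> norm x" for x
      using that norm_triangle_sub[of x a] by (intro R(2)) linarith
  qed
qed

lemma iter_dderiv_linear:
  assumes "smooth_fun f" shows "linear (\<lambda>v. iter_dderiv [v] f x)"
  using smooth_fun_has_derivative[OF assms, of x] by (rule has_derivative_linear)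

lemma test_function_bounded:
  assumes "test_function \<phi>"
  obtains C R where "0 \<le> C" "0 < R" "\<And>x. \<bar>\<phi> x\<bar> \<le> C * indicator (cball 0 R) x"
proof -
  obtain R where R: "0 < R" "\<And>x. R \<le> norm x \<Longrightarrow> \<phi> x = 0" using test_function_support[OF assms] by metis
  have "continuous_on (cball 0 R) \<phi>"
    using assms continuous_smooth_fun continuous_on_subset unfolding test_function_def by blast
  then have "bounded (\<phi> ` cball 0 R)" by (intro compact_imp_bounded compact_continuous_image) auto
  then obtain C where C: "0 < C" "\<forall>x\<in>cball 0 R. \<bar>\<phi> x\<bar> \<le> C" by (auto simp: bounded_pos)
  have "\<bar>\<phi> x\<bar> \<le> C * indicator (cball 0 R) x" for x
    using C R(2)[of x] by (auto simp: indicator_def)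
  then show thesis using that[of C R] C(1) R(1) by simp
qed

section \<open>Locally integrable functions and test functions\<close>

lemma cball_borel_measurable [measurable]: "cball a r \<in> sets borel" by simp

text \<open>
  Local integrability for Borel functions, in terms of the nonnegative integral, so that
  Tonelli's theorem and translations apply without side conditions.
\<close>

definition locally_integrable :: "('a::euclidean_space \<Rightarrow> real) \<Rightarrow> bool" where
  "locally_integrable f \<longleftrightarrow> f \<in> borel_measurable borel \<and>
     (\<forall>R. (\<integral>\<^sup>+x. ennreal \<bar>f x\<bar> * indicator (cball 0 R) x \<partial>lborel) < \<infinity>)"

lemma locally_integrable_measurable: "locally_integrable f \<Longrightarrow> f \<in> borel_measurable borel"
  by (simp add: locally_integrable_def)

lemma integral_lborel_translate:
  fixes F :: "'a::euclidean_space \<Rightarrow> real"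
  assumes [measurable]: "F \<in> borel_measurable borel"
  shows "(LINT x|lborel. F (x + a)) = (LINT x|lborel. F x)"
proof -
  have "(LINT x|lborel. F x) = (LINT x|distr lborel borel ((+) a). F x)" by (simp add: lborel_distr_plus)
  also have "\<dots> = (LINT x|lborel. F (a + x))" by (rule integral_distr) auto
  finally show ?thesis by (simp add: add.commute)
qed

lemma locally_integrable_mult_integrable:
  assumes "locally_integrable f" and [measurable]: "\<psi> \<in> borel_measurable borel"
    and bd: "\<And>x. \<bar>\<psi> x\<bar> \<le> C * indicator (cball 0 R) x"
  shows "integrable lborel (\<lambda>x. f x * \<psi> x)"
proof (rule integrableI_bounded)
  have [measurable]: "f \<in> borel_measurable borel" using assms(1) by (rule locally_integrable_measurable)
  show "(\<lambda>x. f x * \<psi> x) \<in> borel_measurable lborel" by measurable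
  have "(\<integral>\<^sup>+x. ennreal (norm (f x * \<psi> x)) \<partial>lborel) \<le> (\<integral>\<^sup>+x. ennreal \<bar>C\<bar> * (ennreal \<bar>f x\<bar> * indicator (cball 0 R) x) \<partial>lborel)"
  proof (rule nn_integral_mono)
    fix x
    have "\<bar>f x * \<psi> x\<bar> \<le> \<bar>C\<bar> * (\<bar>f x\<bar> * indicator (cball 0 R) x)"
      using bd[of x] by (auto simp: abs_mult indicator_def mult.commute intro!: mult_right_mono split: if_splits)
    then show "ennreal (norm (f x * \<psi> x)) \<le> ennreal \<bar>C\<bar> * (ennreal \<bar>f x\<bar> * indicator (cball 0 R) x)"
      by (auto simp: ennreal_mult'[symmetric] intro!: ennreal_leI split: split_indicator split_indicator_asm)
  qed
  also have "\<dots> = ennreal \<bar>C\<bar> * (\<integral>\<^sup>+x. ennreal \<bar>f x\<bar> * indicator (cball 0 R) x \<partial>lborel)"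
    by (rule nn_integral_cmult) measurable
  also have "\<dots> < \<infinity>" using assms(1) by (auto simp: locally_integrable_def ennreal_mult_less_top)
  finally show "(\<integral>\<^sup>+x. ennreal (norm (f x * \<psi> x)) \<partial>lborel) < \<infinity>" .
qed

lemma locally_integrable_integrable_test:
  assumes "locally_integrable f" "test_function \<phi>"
  shows "integrable lborel (\<lambda>x. f x * \<phi> x)"
proof -
  obtain C R where "0 \<le> C" "0 < R" "\<And>x. \<bar>\<phi> x\<bar> \<le> C * indicator (cball 0 R) x"
    using test_function_bounded[OF assms(2)] by metis
  moreover have "\<phi> \<in> borel_measurable borel"
    using assms(2) continuous_smooth_fun unfolding test_function_def
    by (blast intro: borel_measurable_continuous_onI)
  ultimately show ?thesis using locally_integrable_mult_integrable[OF assms(1)] by blast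
qed

lemma test_function_measurable: "test_function \<phi> \<Longrightarrow> \<phi> \<in> borel_measurable borel"
  using continuous_smooth_fun unfolding test_function_def
  by (blast intro: borel_measurable_continuous_onI)

lemma nn_integral_translate_cball:
  assumes [measurable]: "f \<in> borel_measurable (borel :: 'a::euclidean_space measure)" and "norm a \<le> r"
  shows "(\<integral>\<^sup>+x. ennreal \<bar>f (x + a)\<bar> * indicator (cball 0 R) x \<partial>lborel)
    \<le> (\<integral>\<^sup>+x. ennreal \<bar>f x\<bar> * indicator (cball 0 (R + r)) x \<partial>lborel)"
proof -
  have "(\<integral>\<^sup>+x. ennreal \<bar>f (x + a)\<bar> * indicator (cball 0 R) x \<partial>lborel)
    \<le> (\<integral>\<^sup>+x. ennreal \<bar>f (x + a)\<bar> * indicator (cball 0 (R + r)) (x + a) \<partial>lborel)"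
  proof (rule nn_integral_mono)
    fix x
    have "norm (x + a) \<le> R + r" if "norm x \<le> R"
      using that norm_triangle_ineq[of x a] assms(2) by linarith
    then show "ennreal \<bar>f (x + a)\<bar> * indicator (cball 0 R) x \<le> ennreal \<bar>f (x + a)\<bar> * indicator (cball 0 (R + r)) (x + a)"
      by (auto split: split_indicator)
  qed
  also have "\<dots> = (\<integral>\<^sup>+x. ennreal \<bar>f x\<bar> * indicator (cball 0 (R + r)) x \<partial>lborel)"
    by (rule nn_integral_lborel_translate[where g = "\<lambda>x. ennreal \<bar>f x\<bar> * indicator (cball 0 (R + r)) x"]) measurable
  finally show ?thesis .
qed

lemma locally_integrable_translate: "locally_integrable f \<Longrightarrow> locally_integrable (\<lambda>x. f (x + a))"
  unfolding locally_integrable_def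
  by (auto intro: le_less_trans[OF nn_integral_translate_cball[OF _ order_refl]])

lemma locally_integrable_diff: assumes "locally_integrable f" "locally_integrable g" shows "locally_integrable (\<lambda>x. f x - g x)"
proof -
  have [measurable]: "f \<in> borel_measurable borel" "g \<in> borel_measurable borel"
    using assms by (auto simp: locally_integrable_def)
  have "(\<integral>\<^sup>+x. ennreal \<bar>f x - g x\<bar> * indicator (cball 0 R) x \<partial>lborel) < \<infinity>" for R
  proof -
    have "(\<integral>\<^sup>+x. ennreal \<bar>f x - g x\<bar> * indicator (cball 0 R) x \<partial>lborel) \<le>
       (\<integral>\<^sup>+x. ennreal \<bar>f x\<bar> * indicator (cball 0 R) x + ennreal \<bar>g x\<bar> * indicator (cball 0 R) x \<partial>lborel)"
      by (intro nn_integral_mono) (auto simp: ennreal_plus[symmetric] simp del: ennreal_plus intro!: ennreal_leI split: split_indicator)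
    also have "\<dots> = (\<integral>\<^sup>+x. ennreal \<bar>f x\<bar> * indicator (cball 0 R) x \<partial>lborel) + (\<integral>\<^sup>+x. ennreal \<bar>g x\<bar> * indicator (cball 0 R) x \<partial>lborel)"
      by (rule nn_integral_add) measurable
    also have "\<dots> < \<infinity>" using assms by (simp add: locally_integrable_def)
    finally show ?thesis .
  qed
  then show ?thesis by (simp add: locally_integrable_def)
qed

lemma locally_integrable_cmult: assumes "locally_integrable f" shows "locally_integrable (\<lambda>x. c * f x)"
proof -
  have [measurable]: "f \<in> borel_measurable borel" using assms by (auto simp: locally_integrable_def)
  have "(\<integral>\<^sup>+x. ennreal \<bar>c * f x\<bar> * indicator (cball 0 R) x \<partial>lborel) =
      ennreal \<bar>c\<bar> * (\<integral>\<^sup>+x. ennreal \<bar>f x\<bar> * indicator (cball 0 R) x \<partial>lborel)" for R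
  proof -
    have "(\<integral>\<^sup>+x. ennreal \<bar>c * f x\<bar> * indicator (cball 0 R) x \<partial>lborel) =
      (\<integral>\<^sup>+x. ennreal \<bar>c\<bar> * (ennreal \<bar>f x\<bar> * indicator (cball 0 R) x) \<partial>lborel)"
      by (simp add: abs_mult ennreal_mult mult.assoc)
    also have "\<dots> = ennreal \<bar>c\<bar> * (\<integral>\<^sup>+x. ennreal \<bar>f x\<bar> * indicator (cball 0 R) x \<partial>lborel)"
      by (rule nn_integral_cmult) measurable
    finally show ?thesis .
  qed
  then show ?thesis using assms by (auto simp: locally_integrable_def ennreal_mult_less_top)
qed

lemma locally_integrable_sum: "finite B \<Longrightarrow> (\<And>i. i \<in> B \<Longrightarrow> locally_integrable (F i)) \<Longrightarrow> locally_integrable (\<lambda>x. \<Sum>i\<in>B. F i x)"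
proof (induction B rule: finite_induct)
  case empty then show ?case by (simp add: locally_integrable_def)
next
  case (insert i B)
  then have "locally_integrable (\<lambda>x. F i x - (-1) * (\<Sum>i\<in>B. F i x))" by (intro locally_integrable_diff locally_integrable_cmult) auto
  then show ?case using insert by simp
qed

text \<open>
  The fundamental lemma of the calculus of variations. Bumps approximate indicator functions of boxes,
  boxes generate the Borel sets and are stable under intersection, and the sets on which \<open>w\<close> is positive
  or negative are Borel sets.
\<close>

lemma locally_integrable_zero_AE:
  fixes w :: "'a::euclidean_space \<Rightarrow> real"
  assumes w: "locally_integrable w" and test: "\<And>\<phi>. test_function \<phi> \<Longrightarrow> (LINT x|lborel. w x * \<phi> x) = 0"
  shows "AE x in lborel. w x = 0"
proof -
  have [measurable]: "w \<in> borel_measurable borel" using w by (rule locally_integrable_measurable)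
  have int_bdd: "integrable lborel (\<lambda>x. w x * indicator B x)" if b: "bounded B" and [measurable]: "B \<in> sets borel" for B
  proof -
    obtain R where "\<forall>x\<in>B. norm x \<le> R" using b unfolding bounded_iff by blast
    then have "B \<subseteq> cball 0 R" by auto
    then show ?thesis
      by (intro locally_integrable_mult_integrable[OF w, of _ 1 R]) (auto split: split_indicator)
  qed
  have bb: "bounded (B \<inter> box a b)" for B and a b :: 'a
    by (rule bounded_subset[OF bounded_box[of a b]]) auto
  have box: "(LINT x|lborel. w x * indicator (box a b) x) = 0" for a b
  proof -
    have "(\<lambda>n. LINT x|lborel. w x * box_bump a b (real (Suc n)) x) \<longlonglongrightarrow> (LINT x|lborel. w x * indicator (box a b) x)"
    proof (rule integral_dominated_convergence[where w = "\<lambda>x. \<bar>w x * indicator (box a b) x\<bar>"])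
      show "integrable lborel (\<lambda>x. \<bar>w x * indicator (box a b) x\<bar>)"
        by (intro integrable_abs int_bdd) auto
      show "AE x in lborel. (\<lambda>n. w x * box_bump a b (real (Suc n)) x) \<longlonglongrightarrow> w x * indicator (box a b) x"
        by (intro AE_I2 tendsto_intros box_bump_tendsto)
      show "(\<lambda>x. w x * box_bump a b (real (Suc n)) x) \<in> borel_measurable lborel" for n
        using test_function_measurable[OF test_function_box_bump[of "real (Suc n)" a b]] by simp
      show "AE x in lborel. norm (w x * box_bump a b (real (Suc n)) x) \<le> \<bar>w x * indicator (box a b) x\<bar>" for n
      proof (rule AE_I2)
        fix x
        show "norm (w x * box_bump a b (real (Suc n)) x) \<le> \<bar>w x * indicator (box a b) x\<bar>"
          using box_bump_le_1[of "real (Suc n)" a b x] box_bump_zero[of "real (Suc n)" x a b]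
          by (cases "x \<in> box a b") (auto simp: abs_mult mult_left_le)
      qed
    qed simp
    moreover have "(LINT x|lborel. w x * box_bump a b (real (Suc n)) x) = 0" for n
      by (intro test test_function_box_bump) simp
    ultimately show ?thesis by (simp add: LIMSEQ_const_iff)
  qed
  have zero: "(LINT x|lborel. w x * indicator (B \<inter> box a b) x) = 0" if "B \<in> sets borel" for B a b
  proof -
    let ?G = "range (\<lambda>(a, b). box a b :: 'a set)"
    have int: "Int_stable ?G" by (auto simp: Int_stable_def box_Int_box)
    have B: "B \<in> sigma_sets UNIV ?G" using that by (simp add: borel_eq_box)
    have sub: "?G \<subseteq> Pow UNIV" by simp
    show ?thesis using int sub B
    proof (induct rule: sigma_sets_induct_disjoint)
      case (basic B)
      then show ?case using box by (auto simp: box_Int_box)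
    next
      case (compl B)
      then have [measurable]: "B \<in> sets borel" by (simp add: borel_eq_box)
      have "(LINT x|lborel. w x * indicator ((UNIV - B) \<inter> box a b) x) =
          (LINT x|lborel. w x * indicator (box a b) x - w x * indicator (B \<inter> box a b) x)"
        by (intro Bochner_Integration.integral_cong) (auto split: split_indicator)
      also have "\<dots> = (LINT x|lborel. w x * indicator (box a b) x) - (LINT x|lborel. w x * indicator (B \<inter> box a b) x)"
        by (intro Bochner_Integration.integral_diff int_bdd) (auto simp: bb)
      finally show ?case using box compl by simp
    next
      case (union A)
      then have A[measurable]: "A i \<in> sets borel" for i by (auto simp: borel_eq_box)
      have "(LINT x:(\<Union>i. A i \<inter> box a b)|lborel. w x) = (\<Sum>i. LINT x:(A i \<inter> box a b)|lborel. w x)"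
      proof (rule lebesgue_integral_countable_add)
        show "A i \<inter> box a b \<inter> (A j \<inter> box a b) = {}" if "i \<noteq> j" for i j
          using union(1) that by (auto simp: disjoint_family_on_def)
        show "set_integrable lborel (\<Union>i. A i \<inter> box a b) w"
        proof -
          have "bounded (\<Union>i. A i \<inter> box a b)" by (rule bounded_subset[OF bounded_box[of a b]]) auto
          moreover have "(\<Union>i. A i \<inter> box a b) \<in> sets borel" by measurable
          ultimately show ?thesis using int_bdd by (simp add: set_integrable_def mult.commute)
        qed
      qed auto
      also have "\<dots> = 0" using union by (simp add: set_lebesgue_integral_def mult.commute)
      finally show ?case by (simp add: set_lebesgue_integral_def mult.commute)
    qed simp
  qed
  have "AE x in lborel. w x * indicator (box a b) x = 0" for a b
  proof -
    have pos: "AE x in lborel. v x * indicator ({x. 0 < v x} \<inter> box a b) x = 0"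
      if [measurable]: "v \<in> borel_measurable borel"
        and "integrable lborel (\<lambda>x. v x * indicator ({x. 0 < v x} \<inter> box a b) x)"
        and "(LINT x|lborel. v x * indicator ({x. 0 < v x} \<inter> box a b) x) = 0" for v :: "'a \<Rightarrow> real"
      using that by (subst (asm) integral_nonneg_eq_0_iff_AE) (auto split: split_indicator)
    have 1: "AE x in lborel. w x * indicator ({x. 0 < w x} \<inter> box a b) x = 0"
      by (intro pos zero int_bdd) (auto simp: bb)
    have i2: "integrable lborel (\<lambda>x. w x * indicator ({x. 0 < - w x} \<inter> box a b) x)"
      by (intro int_bdd) (auto simp: bb)
    have 2: "AE x in lborel. (- w x) * indicator ({x. 0 < - w x} \<inter> box a b) x = 0"
    proof (rule pos)
      show "integrable lborel (\<lambda>x. - w x * indicator ({x. 0 < - w x} \<inter> box a b) x)"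
        using i2 by simp
      show "(LINT x|lborel. - w x * indicator ({x. 0 < - w x} \<inter> box a b) x) = 0"
        using zero[of "{x. 0 < - w x}" a b] by simp
    qed simp
    show ?thesis using 1 2 by eventually_elim (auto split: split_indicator split_indicator_asm)
  qed
  then have "AE x in lborel. \<forall>n::nat. w x * indicator (box (- real n *\<^sub>R One) (real n *\<^sub>R One)) x = 0"
    by (subst AE_all_countable) blast
  then show ?thesis
  proof eventually_elim
    case (elim x)
    obtain n :: nat where "norm x < real n" using reals_Archimedean2 by blast
    then have "x \<in> box (- real n *\<^sub>R One) (real n *\<^sub>R One)"
      using Basis_le_norm[of _ x] by (fastforce simp: mem_box abs_less_iff)
    then show ?case using elim by (metis indicator_simps(1) mult.right_neutral)
  qed
qed

section \<open>Weak directional derivatives\<close>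

definition weak_dderiv :: "'a::euclidean_space \<Rightarrow> ('a \<Rightarrow> real) \<Rightarrow> ('a \<Rightarrow> real) \<Rightarrow> bool" where
  "weak_dderiv h f g \<longleftrightarrow> locally_integrable f \<and> locally_integrable g \<and>
     (\<forall>\<phi>. test_function \<phi> \<longrightarrow> (LINT x|lborel. f x * iter_dderiv [h] \<phi> x) = - (LINT x|lborel. g x * \<phi> x))"

text \<open>
  This justifies Fubini's theorem for signed integrands of the form \<open>f (x + u h) \<phi> x\<close> on
  \<open>[0, 1] \<times> \<real>\<^sup>N\<close>.
\<close>

lemma integrable_unit_interval_times:
  fixes F :: "real \<Rightarrow> 'a::euclidean_space \<Rightarrow> real"
  assumes [measurable]: "(\<lambda>(u, x). F u x) \<in> borel_measurable (borel \<Otimes>\<^sub>M borel)"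
    and bd: "\<And>u. 0 \<le> u \<Longrightarrow> u \<le> 1 \<Longrightarrow> (\<integral>\<^sup>+x. ennreal \<bar>F u x\<bar> \<partial>lborel) \<le> B" and B: "B < \<infinity>"
  shows "integrable (lborel \<Otimes>\<^sub>M lborel) (\<lambda>(u, x). indicator {0..1} u * F u x)"
proof (rule integrableI_bounded)
  have [measurable]: "(\<lambda>z. F (fst z) (snd z)) \<in> borel_measurable (lborel \<Otimes>\<^sub>M lborel)"
    using assms(1) by (simp add: case_prod_beta')
  have F1: "(\<lambda>x. F u x) \<in> borel_measurable borel" for u
    using measurable_compose[OF _ assms(1), of "\<lambda>x. (u, x)" borel] by simp
  show "(\<lambda>(u, x). indicator {0..1} u * F u x) \<in> borel_measurable (lborel \<Otimes>\<^sub>M lborel)"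
    by (simp add: case_prod_beta')
  have "(\<integral>\<^sup>+z. ennreal (norm (case z of (u, x) \<Rightarrow> indicator {0..1} u * F u x)) \<partial>(lborel \<Otimes>\<^sub>M lborel)) =
     (\<integral>\<^sup>+u. \<integral>\<^sup>+x. ennreal \<bar>indicator {0..1} u * F u x\<bar> \<partial>lborel \<partial>lborel)"
    by (subst lborel.nn_integral_fst[symmetric]) (auto simp: case_prod_beta')
  also have "\<dots> \<le> (\<integral>\<^sup>+u. B * indicator {0..1::real} u \<partial>lborel)"
    using bd by (intro nn_integral_mono) (auto split: split_indicator)
  also have "\<dots> = B" by (subst nn_integral_cmult_indicator) auto
  finally show "(\<integral>\<^sup>+z. ennreal (norm (case z of (u, x) \<Rightarrow> indicator {0..1} u * F u x)) \<partial>(lborel \<Otimes>\<^sub>M lborel)) < \<infinity>"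
    using B by (rule le_less_trans)
qed

lemma integral_swap_unit_interval:
  fixes F :: "real \<Rightarrow> 'a::euclidean_space \<Rightarrow> real"
  assumes "(\<lambda>(u, x). F u x) \<in> borel_measurable (borel \<Otimes>\<^sub>M borel)"
    and "\<And>u. 0 \<le> u \<Longrightarrow> u \<le> 1 \<Longrightarrow> (\<integral>\<^sup>+x. ennreal \<bar>F u x\<bar> \<partial>lborel) \<le> B" and "B < \<infinity>"
  shows "(LINT x|lborel. LINT u|lborel. indicator {0..1} u * F u x) = (LINT u|lborel. indicator {0..1} u * (LINT x|lborel. F u x))"
  using lborel_pair.Fubini_integral[OF integrable_unit_interval_times[OF assms]] by simp

lemma fdiff_test_function:
  assumes "smooth_fun \<phi>"
  shows "(LINT u|lborel. indicator {0..1} u * iter_dderiv [h] \<phi> (x - u *\<^sub>R h)) = \<phi> x - \<phi> (x - h)"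
proof -
  have "((\<lambda>u. - \<phi> (x - u *\<^sub>R h)) has_real_derivative iter_dderiv [h] \<phi> (x - u *\<^sub>R h)) (at u)" for u
  proof -
    let ?D = "\<lambda>v. iter_dderiv [v] \<phi> (x - u *\<^sub>R h)"
    have lin: "linear ?D" by (rule iter_dderiv_linear[OF assms])
    have "(\<phi> has_derivative ?D) (at (x - u *\<^sub>R h))" by (rule smooth_fun_has_derivative[OF assms])
    from has_derivative_compose[of "\<lambda>u. x - u *\<^sub>R h" "\<lambda>v. - (v *\<^sub>R h)" u UNIV, OF _ this]
    have "((\<lambda>u. x - u *\<^sub>R h) has_derivative (\<lambda>v. - (v *\<^sub>R h))) (at u) \<Longrightarrow>
       ((\<lambda>u. \<phi> (x - u *\<^sub>R h)) has_derivative (\<lambda>v. ?D (- (v *\<^sub>R h)))) (at u)" .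
    moreover have "((\<lambda>u. x - u *\<^sub>R h) has_derivative (\<lambda>v. - (v *\<^sub>R h))) (at u)"
      by (auto intro!: derivative_eq_intros)
    ultimately have "((\<lambda>u. \<phi> (x - u *\<^sub>R h)) has_derivative (\<lambda>v. ?D (- (v *\<^sub>R h)))) (at u)" by blast
    moreover have "(\<lambda>v. ?D (- (v *\<^sub>R h))) = (\<lambda>v. - ?D h * v)"
    proof
      fix v
      have "?D (- (v *\<^sub>R h)) = - (v *\<^sub>R ?D h)" by (simp only: linear_neg[OF lin] linear_scale[OF lin])
      then show "?D (- (v *\<^sub>R h)) = - ?D h * v" by simp
    qed
    ultimately have "((\<lambda>u. \<phi> (x - u *\<^sub>R h)) has_real_derivative - ?D h) (at u)"
      by (simp only: has_field_derivative_def)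
    then show ?thesis using DERIV_minus by fastforce
  qed
  moreover have "isCont (\<lambda>u. iter_dderiv [h] \<phi> (x - u *\<^sub>R h)) u" for u
  proof -
    have "continuous_on UNIV (iter_dderiv [h] \<phi>)" using smooth_fun_iter[OF assms] by (rule continuous_smooth_fun)
    then have "continuous_on UNIV (\<lambda>u. iter_dderiv [h] \<phi> (x - u *\<^sub>R h))"
      by (rule continuous_on_compose2) (auto intro!: continuous_intros)
    then show ?thesis by (simp add: continuous_on_eq_continuous_at)
  qed
  ultimately have "(LINT u|lborel. iter_dderiv [h] \<phi> (x - u *\<^sub>R h) * indicator {0..1} u) = - \<phi> (x - 1 *\<^sub>R h) - - \<phi> (x - 0 *\<^sub>R h)"
    by (intro integral_FTC_Icc_real) auto
  then show ?thesis by (simp add: mult.commute)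
qed

text \<open>
  The fundamental theorem of calculus for weak derivatives, by duality: the difference is moved to the
  test function, where it is the integral of the classical derivative; the definition of the weak
  derivative is applied to each translate of the test function; and the translation is moved back.
\<close>

lemma weak_dderiv_fdiff_AE:
  fixes f g :: "'a::euclidean_space \<Rightarrow> real"
  assumes w: "weak_dderiv h f g"
  shows "AE x in lborel. fdiff h f x = (LINT u|lborel. indicator {0..1} u * g (x + u *\<^sub>R h))"
proof -
  have f: "locally_integrable f" and g: "locally_integrable g" using w by (auto simp: weak_dderiv_def)
  have [measurable]: "f \<in> borel_measurable borel" "g \<in> borel_measurable borel" using f g by (auto simp: locally_integrable_def)
  define A where "A x = (LINT u|lborel. indicator {0..1} u * g (x + u *\<^sub>R h))" for x
  have Am[measurable]: "A \<in> borel_measurable borel"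
  proof -
    have "(\<lambda>x. LINT u|lborel. indicator {0..1} u * g (x + u *\<^sub>R h)) \<in> borel_measurable lborel"
      by (rule lborel.borel_measurable_lebesgue_integral) (simp add: case_prod_beta')
    then show ?thesis unfolding A_def by simp
  qed
  have A_le: "ennreal \<bar>A x\<bar> \<le> (\<integral>\<^sup>+u. indicator {0..1} u * ennreal \<bar>g (x + u *\<^sub>R h)\<bar> \<partial>lborel)" for x
  proof (cases "integrable lborel (\<lambda>u. indicator {0..1} u * g (x + u *\<^sub>R h))")
    case True
    from integral_norm_bound_ennreal[OF this] show ?thesis
      by (simp add: A_def abs_mult ennreal_mult ennreal_indicator)
  qed (simp add: A_def not_integrable_integral_eq)
  have A: "locally_integrable A"
  proof -
    have "(\<integral>\<^sup>+x. ennreal \<bar>A x\<bar> * indicator (cball 0 R) x \<partial>lborel) < \<infinity>" for R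
    proof -
      have "(\<integral>\<^sup>+x. ennreal \<bar>A x\<bar> * indicator (cball 0 R) x \<partial>lborel) \<le>
        (\<integral>\<^sup>+x. (\<integral>\<^sup>+u. indicator {0..1} u * (ennreal \<bar>g (x + u *\<^sub>R h)\<bar> * indicator (cball 0 R) x) \<partial>lborel) \<partial>lborel)"
        using A_le by (intro nn_integral_mono) (auto split: split_indicator)
      also have "\<dots> = (\<integral>\<^sup>+u. (\<integral>\<^sup>+x. indicator {0..1} u * (ennreal \<bar>g (x + u *\<^sub>R h)\<bar> * indicator (cball 0 R) x) \<partial>lborel) \<partial>lborel)"
        by (rule lborel_pair.Fubini') (simp only: case_prod_beta', measurable)
      also have "\<dots> \<le> (\<integral>\<^sup>+u. (\<integral>\<^sup>+x. ennreal \<bar>g x\<bar> * indicator (cball 0 (R + norm h)) x \<partial>lborel) * indicator {0..1::real} u \<partial>lborel)"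
      proof (rule nn_integral_mono)
        fix u :: real
        have "(\<integral>\<^sup>+x. ennreal \<bar>g (x + u *\<^sub>R h)\<bar> * indicator (cball 0 R) x \<partial>lborel)
            \<le> (\<integral>\<^sup>+x. ennreal \<bar>g x\<bar> * indicator (cball 0 (R + norm h)) x \<partial>lborel)" if "0 \<le> u" "u \<le> 1"
          using that by (intro nn_integral_translate_cball) (auto simp: mult_left_le_one_le)
        then show "(\<integral>\<^sup>+x. indicator {0..1} u * (ennreal \<bar>g (x + u *\<^sub>R h)\<bar> * indicator (cball 0 R) x) \<partial>lborel)
            \<le> (\<integral>\<^sup>+x. ennreal \<bar>g x\<bar> * indicator (cball 0 (R + norm h)) x \<partial>lborel) * indicator {0..1::real} u"
          by (auto split: split_indicator)
      qed
      also have "\<dots> = (\<integral>\<^sup>+x. ennreal \<bar>g x\<bar> * indicator (cball 0 (R + norm h)) x \<partial>lborel)"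
        by (subst nn_integral_cmult_indicator) auto
      also have "\<dots> < \<infinity>" using g by (simp add: locally_integrable_def)
      finally show ?thesis .
    qed
    then show ?thesis by (simp add: locally_integrable_def)
  qed
  have "AE x in lborel. fdiff h f x - A x = 0"
  proof (rule locally_integrable_zero_AE)
    show "locally_integrable (\<lambda>x. fdiff h f x - A x)"
      unfolding fdiff_def by (intro locally_integrable_diff locally_integrable_translate f A)
  next
    fix \<phi> :: "'a \<Rightarrow> real" assume t: "test_function \<phi>"
    then have sm: "smooth_fun \<phi>" by (simp add: test_function_def)
    have [measurable]: "\<phi> \<in> borel_measurable borel" using t by (rule test_function_measurable)
    define d where "d = iter_dderiv [h] \<phi>"
    have td: "test_function d" unfolding d_def using t by (rule test_function_iter)
    have [measurable]: "d \<in> borel_measurable borel" using td by (rule test_function_measurable)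
    note tr = test_function_translate[OF t]
    \<comment> \<open>a bound on these integrals that is uniform in \<open>u\<close>, to exchange the integrals in \<open>x\<close> and \<open>u\<close>\<close>
    have bound: "\<exists>B<\<infinity>. \<forall>u. 0 \<le> u \<longrightarrow> u \<le> 1 \<longrightarrow> (\<integral>\<^sup>+x. ennreal \<bar>F (x + u *\<^sub>R h) * \<psi> x\<bar> \<partial>lborel) \<le> B"
      if F: "locally_integrable F" and \<psi>: "test_function \<psi>" for F \<psi>
    proof -
      obtain C R where CR: "0 \<le> C" "0 < R" "\<And>x. \<bar>\<psi> x\<bar> \<le> C * indicator (cball 0 R) x"
        using test_function_bounded[OF \<psi>] by metis
      have [measurable]: "F \<in> borel_measurable borel" using F by (rule locally_integrable_measurable)
      let ?B = "ennreal C * (\<integral>\<^sup>+x. ennreal \<bar>F x\<bar> * indicator (cball 0 (R + norm h)) x \<partial>lborel)"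
      have "(\<integral>\<^sup>+x. ennreal \<bar>F (x + u *\<^sub>R h) * \<psi> x\<bar> \<partial>lborel) \<le> ?B" if u: "0 \<le> u" "u \<le> 1" for u
      proof -
        have "(\<integral>\<^sup>+x. ennreal \<bar>F (x + u *\<^sub>R h) * \<psi> x\<bar> \<partial>lborel) \<le>
          (\<integral>\<^sup>+x. ennreal C * (ennreal \<bar>F (x + u *\<^sub>R h)\<bar> * indicator (cball 0 R) x) \<partial>lborel)"
        proof (rule nn_integral_mono)
          fix x
          have "\<bar>F (x + u *\<^sub>R h) * \<psi> x\<bar> \<le> C * (\<bar>F (x + u *\<^sub>R h)\<bar> * indicator (cball 0 R) x)"
            using mult_left_mono[OF CR(3)[of x], of "\<bar>F (x + u *\<^sub>R h)\<bar>"] by (simp add: abs_mult mult_ac)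
          then have "ennreal \<bar>F (x + u *\<^sub>R h) * \<psi> x\<bar> \<le> ennreal (C * (\<bar>F (x + u *\<^sub>R h)\<bar> * indicator (cball 0 R) x))"
            by (rule ennreal_leI)
          also have "\<dots> = ennreal C * (ennreal \<bar>F (x + u *\<^sub>R h)\<bar> * indicator (cball 0 R) x)"
            using CR by (simp add: ennreal_mult ennreal_indicator)
          finally show "ennreal \<bar>F (x + u *\<^sub>R h) * \<psi> x\<bar> \<le> ennreal C * (ennreal \<bar>F (x + u *\<^sub>R h)\<bar> * indicator (cball 0 R) x)" .
        qed
        also have "\<dots> = ennreal C * (\<integral>\<^sup>+x. ennreal \<bar>F (x + u *\<^sub>R h)\<bar> * indicator (cball 0 R) x \<partial>lborel)"
          by (rule nn_integral_cmult) measurable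
        also have "\<dots> \<le> ?B"
          using u by (intro mult_left_mono nn_integral_translate_cball) (auto simp: mult_left_le_one_le)
        finally show ?thesis .
      qed
      moreover have "?B < \<infinity>" using F by (auto simp: locally_integrable_def ennreal_mult_less_top)
      ultimately show ?thesis by blast
    qed
    have shift: "(LINT x|lborel. F x * \<psi> (x - a)) = (LINT x|lborel. F (x + a) * \<psi> x)"
      if [measurable]: "F \<in> borel_measurable borel" "\<psi> \<in> borel_measurable borel" for F \<psi> :: "'a \<Rightarrow> real" and a
      using integral_lborel_translate[of "\<lambda>x. F x * \<psi> (x - a)" a] by simp
    have fint: "integrable lborel (\<lambda>x. f x * \<phi> (x - h))" "integrable lborel (\<lambda>x. f x * \<phi> x)"
      by (auto intro: locally_integrable_integrable_test[OF f] t tr)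
    have fint': "integrable lborel (\<lambda>x. f (x + h) * \<phi> x)"
      by (rule locally_integrable_integrable_test[OF locally_integrable_translate[OF f] t])
    have "(LINT x|lborel. fdiff h f x * \<phi> x) = (LINT x|lborel. f (x + h) * \<phi> x) - (LINT x|lborel. f x * \<phi> x)"
      using fint fint' by (simp add: fdiff_def left_diff_distrib)
    also have "(LINT x|lborel. f (x + h) * \<phi> x) = (LINT x|lborel. f x * \<phi> (x - h))" by (simp add: shift)
    also have "(LINT x|lborel. f x * \<phi> (x - h)) - (LINT x|lborel. f x * \<phi> x) = (LINT x|lborel. f x * (\<phi> (x - h) - \<phi> x))"
      using fint by (simp add: right_diff_distrib)
    also have "\<dots> = - (LINT x|lborel. LINT u|lborel. indicator {0..1} u * (f x * d (x - u *\<^sub>R h)))"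
    proof -
      have "f x * (\<phi> (x - h) - \<phi> x) = - (LINT u|lborel. indicator {0..1} u * (f x * d (x - u *\<^sub>R h)))" for x
      proof -
        have "(LINT u|lborel. indicator {0..1} u * (f x * d (x - u *\<^sub>R h))) = (LINT u|lborel. f x * (indicator {0..1} u * d (x - u *\<^sub>R h)))"
          by (intro Bochner_Integration.integral_cong) auto
        also have "\<dots> = f x * (\<phi> x - \<phi> (x - h))" using fdiff_test_function[OF sm, of h x, folded d_def] by simp
        finally show ?thesis by (simp add: algebra_simps)
      qed
      then show ?thesis by simp
    qed
    also have "(LINT x|lborel. LINT u|lborel. indicator {0..1} u * (f x * d (x - u *\<^sub>R h)))
       = (LINT u|lborel. indicator {0..1} u * (LINT x|lborel. f x * d (x - u *\<^sub>R h)))"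
    proof -
      obtain B where B: "B < \<infinity>" "\<And>u. 0 \<le> u \<Longrightarrow> u \<le> 1 \<Longrightarrow> (\<integral>\<^sup>+x. ennreal \<bar>f (x + u *\<^sub>R h) * d x\<bar> \<partial>lborel) \<le> B"
        using bound[OF f td] by blast
      have "(\<integral>\<^sup>+x. ennreal \<bar>f x * d (x - u *\<^sub>R h)\<bar> \<partial>lborel) \<le> B" if "0 \<le> u" "u \<le> 1" for u
        using B(2)[OF that] nn_integral_lborel_translate[of "\<lambda>x. ennreal \<bar>f x * d (x - u *\<^sub>R h)\<bar>" "u *\<^sub>R h"] by simp
      then show ?thesis using B(1)
        by (intro integral_swap_unit_interval[of "\<lambda>u x. f x * d (x - u *\<^sub>R h)"]) (simp_all only: case_prod_beta', measurable)
    qed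
    also have "(\<lambda>u. LINT x|lborel. f x * d (x - u *\<^sub>R h)) = (\<lambda>u. - (LINT x|lborel. g (x + u *\<^sub>R h) * \<phi> x))"
    proof
      fix u :: real
      have "(LINT x|lborel. f x * d (x - u *\<^sub>R h)) = (LINT x|lborel. f x * iter_dderiv [h] (\<lambda>x. \<phi> (x - u *\<^sub>R h)) x)"
        by (simp only: d_def iter_dderiv_translate[OF sm])
      also have "\<dots> = - (LINT x|lborel. g x * \<phi> (x - u *\<^sub>R h))" using w tr by (simp only: weak_dderiv_def)
      finally show "(LINT x|lborel. f x * d (x - u *\<^sub>R h)) = - (LINT x|lborel. g (x + u *\<^sub>R h) * \<phi> x)" by (simp add: shift)
    qed
    also have "- (LINT u|lborel. indicator {0..1} u * - (LINT x|lborel. g (x + u *\<^sub>R h) * \<phi> x)) =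
       (LINT u|lborel. indicator {0..1} u * (LINT x|lborel. g (x + u *\<^sub>R h) * \<phi> x))"
      by simp
    also have "\<dots> = (LINT x|lborel. LINT u|lborel. indicator {0..1} u * (g (x + u *\<^sub>R h) * \<phi> x))"
    proof -
      obtain B where B: "B < \<infinity>" "\<And>u. 0 \<le> u \<Longrightarrow> u \<le> 1 \<Longrightarrow> (\<integral>\<^sup>+x. ennreal \<bar>g (x + u *\<^sub>R h) * \<phi> x\<bar> \<partial>lborel) \<le> B"
        using bound[OF g t] by blast
      then show ?thesis
        by (intro integral_swap_unit_interval[of "\<lambda>u x. g (x + u *\<^sub>R h) * \<phi> x", symmetric]) (simp_all only: case_prod_beta', measurable)
    qed
    also have "\<dots> = (LINT x|lborel. A x * \<phi> x)"
      unfolding A_def by (intro Bochner_Integration.integral_cong) (simp_all flip: integral_mult_left_zero add: mult.assoc)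
    finally have "(LINT x|lborel. fdiff h f x * \<phi> x) = (LINT x|lborel. A x * \<phi> x)" .
    moreover have "integrable lborel (\<lambda>x. fdiff h f x * \<phi> x)" "integrable lborel (\<lambda>x. A x * \<phi> x)"
      unfolding fdiff_def by (auto intro!: locally_integrable_integrable_test t locally_integrable_diff locally_integrable_translate f A)
    ultimately show "(LINT x|lborel. (fdiff h f x - A x) * \<phi> x) = 0" by (simp add: left_diff_distrib)
  qed
  then show ?thesis unfolding A_def by simp
qed

lemma weak_dderiv_fdiff_le_line_avg:
  assumes w: "weak_dderiv h f g"
  shows "AE x in lborel. ennreal \<bar>fdiff h f x\<bar> \<le> line_avg h (\<lambda>x. ennreal \<bar>g x\<bar>) x"
  using weak_dderiv_fdiff_AE[OF w]
proof eventually_elim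
  case (elim x)
  have "ennreal \<bar>LINT u|lborel. indicator {0..1} u * g (x + u *\<^sub>R h)\<bar> \<le> (\<integral>\<^sup>+u. ennreal \<bar>indicator {0..1} u * g (x + u *\<^sub>R h)\<bar> \<partial>lborel)"
  proof (cases "integrable lborel (\<lambda>u. indicator {0..1} u * g (x + u *\<^sub>R h))")
    case True
    from integral_norm_bound_ennreal[OF this] show ?thesis by simp
  qed (simp add: not_integrable_integral_eq)
  also have "\<dots> = line_avg h (\<lambda>x. ennreal \<bar>g x\<bar>) x"
    unfolding line_avg_def
  proof (rule nn_integral_cong_AE)
    have "AE u in lborel. u \<noteq> (1::real)" by (rule AE_lborel_singleton)
    then show "AE u in lborel. ennreal \<bar>indicator {0..1} u * g (x + u *\<^sub>R h)\<bar> = ennreal \<bar>g (x + u *\<^sub>R h)\<bar> * indicator {0..<1} u"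
      by eventually_elim (auto split: split_indicator)
  qed
  finally show ?case using elim by simp
qed

section \<open>Iterated differences and iterated weak derivatives\<close>

lemma integral_translate_test:
  fixes F \<psi> :: "'a::euclidean_space \<Rightarrow> real"
  assumes [measurable]: "F \<in> borel_measurable borel" "\<psi> \<in> borel_measurable borel"
  shows "(LINT x|lborel. F (x + a) * \<psi> x) = (LINT x|lborel. F x * \<psi> (x - a))"
  using integral_lborel_translate[of "\<lambda>x. F x * \<psi> (x - a)" a] by simp

lemma integral_fdiff_test:
  assumes f: "locally_integrable f" and t: "test_function \<psi>"
  shows "(LINT x|lborel. fdiff k f x * \<psi> x) = (LINT x|lborel. f x * \<psi> (x - k)) - (LINT x|lborel. f x * \<psi> x)"
proof -
  have "(LINT x|lborel. fdiff k f x * \<psi> x) = (LINT x|lborel. f (x + k) * \<psi> x) - (LINT x|lborel. f x * \<psi> x)"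
    using locally_integrable_integrable_test[OF locally_integrable_translate[OF f] t, of k] locally_integrable_integrable_test[OF f t]
    by (simp add: fdiff_def left_diff_distrib)
  then show ?thesis
    using f t by (simp add: integral_translate_test locally_integrable_measurable test_function_measurable)
qed

lemma weak_dderiv_fdiff:
  assumes w: "weak_dderiv h f g"
  shows "weak_dderiv h (fdiff k f) (fdiff k g)"
  unfolding weak_dderiv_def
proof (intro conjI allI impI)
  have f: "locally_integrable f" and g: "locally_integrable g" using w by (auto simp: weak_dderiv_def)
  show "locally_integrable (fdiff k f)" "locally_integrable (fdiff k g)"
    unfolding fdiff_def by (intro locally_integrable_diff locally_integrable_translate f g)+
  fix \<phi> :: "'a \<Rightarrow> real" assume t: "test_function \<phi>"
  then have sm: "smooth_fun \<phi>" by (simp add: test_function_def)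
  have tr: "test_function (\<lambda>x. \<phi> (x - k))" using t by (rule test_function_translate)
  have "(LINT x|lborel. fdiff k f x * iter_dderiv [h] \<phi> x) =
     (LINT x|lborel. f x * iter_dderiv [h] (\<lambda>x. \<phi> (x - k)) x) - (LINT x|lborel. f x * iter_dderiv [h] \<phi> x)"
    by (simp only: integral_fdiff_test[OF f test_function_iter[OF t]] iter_dderiv_translate[OF sm])
  also have "\<dots> = - (LINT x|lborel. g x * \<phi> (x - k)) - - (LINT x|lborel. g x * \<phi> x)"
    using w t tr by (simp only: weak_dderiv_def)
  also have "\<dots> = - (LINT x|lborel. fdiff k g x * \<phi> x)"
    by (simp add: integral_fdiff_test[OF g t])
  finally show "(LINT x|lborel. fdiff k f x * iter_dderiv [h] \<phi> x) = - (LINT x|lborel. fdiff k g x * \<phi> x)" .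
qed

lemma weak_dderiv_scale:
  assumes w: "weak_dderiv h f g"
  shows "weak_dderiv (t *\<^sub>R h) (\<lambda>x. c * f x) (\<lambda>x. c * t * g x)"
  unfolding weak_dderiv_def
proof (intro conjI allI impI)
  have f: "locally_integrable f" and g: "locally_integrable g" using w by (auto simp: weak_dderiv_def)
  show "locally_integrable (\<lambda>x. c * f x)" "locally_integrable (\<lambda>x. c * t * g x)" by (intro locally_integrable_cmult f g)+
  fix \<phi> :: "'a \<Rightarrow> real" assume test: "test_function \<phi>"
  then have sm: "smooth_fun \<phi>" by (simp add: test_function_def)
  have "iter_dderiv [t *\<^sub>R h] \<phi> x = t * iter_dderiv [h] \<phi> x" for x
    using linear_scale[OF iter_dderiv_linear[OF sm, of x], of t h] by simp
  then have "(LINT x|lborel. c * f x * iter_dderiv [t *\<^sub>R h] \<phi> x) = (LINT x|lborel. (c * t) * (f x * iter_dderiv [h] \<phi> x))"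
    by (intro Bochner_Integration.integral_cong) auto
  also have "\<dots> = (c * t) * (LINT x|lborel. f x * iter_dderiv [h] \<phi> x)" by (rule integral_mult_right_zero)
  also have "\<dots> = - ((c * t) * (LINT x|lborel. g x * \<phi> x))" using w test by (simp only: weak_dderiv_def)
  also have "\<dots> = - (LINT x|lborel. (c * t) * (g x * \<phi> x))" by (simp only: integral_mult_right_zero)
  also have "\<dots> = - (LINT x|lborel. c * t * g x * \<phi> x)" by (simp only: mult.assoc)
  finally show "(LINT x|lborel. c * f x * iter_dderiv [t *\<^sub>R h] \<phi> x) = - (LINT x|lborel. c * t * g x * \<phi> x)" .
qed

text \<open>
  Almost every line of direction \<open>h\<close> meets the exceptional null set in a null set.
\<close>

lemma line_avg_mono_AE:
  assumes [measurable]: "g \<in> borel_measurable borel" "g' \<in> borel_measurable (borel :: 'a::euclidean_space measure)"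
    and le: "AE x in lborel. g x \<le> g' x"
  shows "AE x in lborel. line_avg h g x \<le> line_avg h g' x"
proof -
  have 1: "AE u in lborel. AE x in lborel. g (x + u *\<^sub>R h) \<le> g' (x + u *\<^sub>R h)"
  proof (rule AE_I2)
    fix u :: real
    have "AE x in distr lborel borel ((+) (u *\<^sub>R h)). g x \<le> g' x" using le by (subst lborel_distr_plus)
    then show "AE x in lborel. g (x + u *\<^sub>R h) \<le> g' (x + u *\<^sub>R h)"
      by (subst (asm) AE_distr_iff) (auto simp: add.commute)
  qed
  have "{w \<in> space (lborel \<Otimes>\<^sub>M lborel). g (snd w + fst w *\<^sub>R h) \<le> g' (snd w + fst w *\<^sub>R h)} \<in> sets (lborel \<Otimes>\<^sub>M lborel)"
    by (intro borel_measurable_le) measurable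
  from iffD1[OF lborel_pair.AE_commute[where P = "\<lambda>u x. g (x + u *\<^sub>R h) \<le> g' (x + u *\<^sub>R h)", OF this] 1]
  show ?thesis
  proof eventually_elim
    case (elim x)
    show ?case unfolding line_avg_def
      by (rule nn_integral_mono_AE, use elim in eventually_elim) (auto intro: mult_right_mono)
  qed
qed

lemma measurable_line_avg_iterate:
  "g \<in> borel_measurable borel \<Longrightarrow> (line_avg h ^^ k) g \<in> borel_measurable borel"
  by (induction k) (auto intro: measurable_line_avg)

lemma line_avg_iterate_mono_AE:
  assumes "g \<in> borel_measurable borel" "g' \<in> borel_measurable (borel :: 'a::euclidean_space measure)"
    and "AE x in lborel. g x \<le> g' x"
  shows "AE x in lborel. (line_avg h ^^ k) g x \<le> (line_avg h ^^ k) g' x"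
proof (induction k)
  case (Suc k)
  show ?case
    using line_avg_mono_AE[OF _ _ Suc, of h] assms by (simp add: measurable_line_avg_iterate)
qed (use assms in simp)

lemma line_avg_iterate_cmult:
  fixes g :: "'a::euclidean_space \<Rightarrow> ennreal"
  assumes g: "g \<in> borel_measurable borel"
  shows "(line_avg h ^^ k) (\<lambda>x. c * g x) = (\<lambda>x. c * (line_avg h ^^ k) g x)"
proof (induction k)
  case (Suc k)
  have "line_avg h (\<lambda>x. c * u x) x = c * line_avg h u x" if [measurable]: "u \<in> borel_measurable borel" for u x
    unfolding line_avg_def mult.assoc by (rule nn_integral_cmult) measurable
  from this[OF measurable_line_avg_iterate[OF g]]
  show ?case by (simp add: Suc)
qed simp

text \<open>
  Induction on \<open>k\<close>: the difference of a chain of weak derivatives is again such a chain, which is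
  shorter by one after its last member \<open>\<Delta>\<^sub>h F\<^sub>k\<close> is replaced by an average of \<open>F\<^sub>k\<^sub>+\<^sub>1\<close>.
\<close>

lemma fdiff_iterate_le_line_avg:
  assumes "\<And>j. j < k \<Longrightarrow> weak_dderiv h (F j) (F (Suc j))" "locally_integrable (F 0)"
  shows "AE x in lborel. ennreal \<bar>(fdiff h ^^ k) (F 0) x\<bar> \<le> (line_avg h ^^ k) (\<lambda>x. ennreal \<bar>F k x\<bar>) x"
  using assms
proof (induction k arbitrary: F)
  case (Suc k)
  have "AE x in lborel. ennreal \<bar>(fdiff h ^^ k) (fdiff h (F 0)) x\<bar> \<le> (line_avg h ^^ k) (\<lambda>x. ennreal \<bar>fdiff h (F k) x\<bar>) x"
  proof (rule Suc.IH[of "\<lambda>j. fdiff h (F j)"])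
    show "weak_dderiv h (fdiff h (F j)) (fdiff h (F (Suc j)))" if "j < k" for j
      using that by (intro weak_dderiv_fdiff Suc.prems) auto
    show "locally_integrable (fdiff h (F 0))" unfolding fdiff_def by (intro locally_integrable_diff locally_integrable_translate Suc.prems)
  qed
  moreover have "AE x in lborel. (line_avg h ^^ k) (\<lambda>x. ennreal \<bar>fdiff h (F k) x\<bar>) x
      \<le> (line_avg h ^^ k) (line_avg h (\<lambda>x. ennreal \<bar>F (Suc k) x\<bar>)) x"
  proof (rule line_avg_iterate_mono_AE)
    have w: "weak_dderiv h (F k) (F (Suc k))" by (rule Suc.prems) simp
    then have [measurable]: "F k \<in> borel_measurable borel" "F (Suc k) \<in> borel_measurable borel"
      by (auto simp: weak_dderiv_def locally_integrable_def)
    show "(\<lambda>x. ennreal \<bar>fdiff h (F k) x\<bar>) \<in> borel_measurable borel" unfolding fdiff_def by measurable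
    show "line_avg h (\<lambda>x. ennreal \<bar>F (Suc k) x\<bar>) \<in> borel_measurable borel" by measurable
    show "AE x in lborel. ennreal \<bar>fdiff h (F k) x\<bar> \<le> line_avg h (\<lambda>x. ennreal \<bar>F (Suc k) x\<bar>) x"
      using w by (rule weak_dderiv_fdiff_le_line_avg)
  qed
  ultimately show ?case
    by eventually_elim (simp add: funpow_Suc_right del: funpow.simps)
qed simp

lemma finite_basis_lists: "finite (basis_lists k)"
  unfolding basis_lists_def by (intro finite_lists_length_eq) auto

lemma basis_lists_Suc: "basis_lists (Suc k) = (\<lambda>(b, bs). b # bs) ` (Basis \<times> basis_lists k)"
  unfolding basis_lists_def by (auto simp: image_iff length_Suc_conv)

text \<open>
  Each derivative is linear in its direction, so \<open>h\<close> can be expanded in the basis one factor at a time,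
  with the order of differentiation kept.
\<close>

lemma iter_dderiv_replicate:
  fixes \<phi> :: "'a::euclidean_space \<Rightarrow> real"
  assumes "smooth_fun \<phi>"
  shows "iter_dderiv (replicate k h) \<phi> x = (\<Sum>bs\<in>basis_lists k. (\<Prod>i<k. h \<bullet> (bs ! i)) * iter_dderiv bs \<phi> x)"
proof (induction k arbitrary: x)
  case 0
  have "basis_lists 0 = {[] :: 'a list}" by (auto simp: basis_lists_def)
  then show ?case by simp
next
  case (Suc k)
  let ?c = "\<lambda>bs. \<Prod>i<k. h \<bullet> (bs ! i)"
  have D: "(iter_dderiv bs \<phi> has_derivative (\<lambda>v. iter_dderiv (v # bs) \<phi> x)) (at x)" for bs
    using smooth_fun_has_derivative[OF smooth_fun_iter[OF assms], of bs x] by simp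
  have "((\<lambda>x. \<Sum>bs\<in>basis_lists k. ?c bs * iter_dderiv bs \<phi> x) has_derivative
      (\<lambda>v. \<Sum>bs\<in>basis_lists k. ?c bs * iter_dderiv (v # bs) \<phi> x)) (at x)"
    by (intro has_derivative_sum has_derivative_mult_right D)
  moreover have "iter_dderiv (replicate k h) \<phi> = (\<lambda>x. \<Sum>bs\<in>basis_lists k. ?c bs * iter_dderiv bs \<phi> x)"
    using Suc by auto
  ultimately have "iter_dderiv (replicate (Suc k) h) \<phi> x = (\<Sum>bs\<in>basis_lists k. ?c bs * iter_dderiv (h # bs) \<phi> x)"
    by (simp add: frechet_derivative_at[symmetric])
  also have "\<dots> = (\<Sum>bs\<in>basis_lists k. \<Sum>b\<in>Basis. (h \<bullet> b * ?c bs) * iter_dderiv (b # bs) \<phi> x)"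
  proof (rule sum.cong[OF refl])
    fix bs
    have lin: "linear (\<lambda>v. iter_dderiv (v # bs) \<phi> x)" using D by (rule has_derivative_linear)
    have "iter_dderiv (h # bs) \<phi> x = iter_dderiv ((\<Sum>b\<in>Basis. (h \<bullet> b) *\<^sub>R b) # bs) \<phi> x"
      by (simp only: euclidean_representation)
    also have "\<dots> = (\<Sum>b\<in>Basis. (h \<bullet> b) *\<^sub>R iter_dderiv (b # bs) \<phi> x)"
      by (simp only: linear_sum[OF lin] linear_scale[OF lin])
    finally show "?c bs * iter_dderiv (h # bs) \<phi> x = (\<Sum>b\<in>Basis. (h \<bullet> b * ?c bs) * iter_dderiv (b # bs) \<phi> x)"
      by (simp only: sum_distrib_left real_scaleR_def mult_ac)
  qed
  also have "\<dots> = (\<Sum>(b, bs)\<in>Basis \<times> basis_lists k. (h \<bullet> b * ?c bs) * iter_dderiv (b # bs) \<phi> x)"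
    by (subst sum.swap) (simp add: sum.cartesian_product)
  also have "\<dots> = (\<Sum>bs\<in>basis_lists (Suc k). (\<Prod>i<Suc k. h \<bullet> (bs ! i)) * iter_dderiv bs \<phi> x)"
    unfolding basis_lists_Suc
    by (subst sum.reindex) (auto simp: inj_on_def prod.lessThan_Suc_shift simp del: prod.lessThan_Suc intro!: sum.cong)
  finally show ?case .
qed

lemma L1_loc_borel_representative:
  assumes "f \<in> L1_loc"
  obtains f' where "locally_integrable f'" "AE x in lborel. f x = f' x"
proof -
  have m: "f \<in> borel_measurable lebesgue" using assms by (simp add: L1_loc_def)
  then obtain f' where [measurable]: "f' \<in> borel_measurable lborel" and ae: "AE x in lborel. f x = f' x"
    using completion_ex_borel_measurable_real by blast
  have "(\<integral>\<^sup>+x. ennreal \<bar>f' x\<bar> * indicator (cball 0 R) x \<partial>lborel) < \<infinity>" for R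
  proof -
    have "set_integrable lebesgue (cball 0 R) f" using assms by (simp add: L1_loc_def)
    then have "(\<integral>\<^sup>+x. ennreal (norm (indicator (cball 0 R) x *\<^sub>R f x)) \<partial>lebesgue) < \<infinity>"
      unfolding set_integrable_def integrable_iff_bounded by simp
    also have "(\<integral>\<^sup>+x. ennreal (norm (indicator (cball 0 R) x *\<^sub>R f x)) \<partial>lebesgue) =
        (\<integral>\<^sup>+x. ennreal \<bar>f' x\<bar> * indicator (cball 0 R) x \<partial>lborel)"
      unfolding nn_integral_completion
      by (rule nn_integral_cong_AE, use ae in eventually_elim) (auto split: split_indicator)
    finally show ?thesis .
  qed
  then show thesis using ae by (intro that[of f']) (auto simp: locally_integrable_def)
qed

lemma integral_lebesgue_representative:
  fixes f f' \<psi> :: "'a::euclidean_space \<Rightarrow> real"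
  assumes f: "f \<in> borel_measurable lebesgue" and [measurable]: "f' \<in> borel_measurable borel" "\<psi> \<in> borel_measurable borel"
    and ae: "AE x in lborel. f x = f' x"
  shows "(LINT x|lebesgue. f x * \<psi> x) = (LINT x|lborel. f' x * \<psi> x)"
proof -
  have m: "\<psi> \<in> borel_measurable lebesgue" "f' \<in> borel_measurable lebesgue"
    by (auto intro!: measurable_completion)
  have "(LINT x|lebesgue. f x * \<psi> x) = (LINT x|lebesgue. f' x * \<psi> x)"
  proof (rule integral_cong_AE)
    show "AE x in lebesgue. f x * \<psi> x = f' x * \<psi> x"
      using AE_completion[OF ae] by eventually_elim simp
  qed (use f m in auto)
  also have "\<dots> = (LINT x|lborel. f' x * \<psi> x)" by (rule integral_completion) measurable
  finally show ?thesis .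
qed

text \<open>
  The functions \<open>F h j\<close> of the proof are Borel representatives of the \<open>j\<close>-th derivatives of \<open>f\<close> in direction
  \<open>h\<close>, with \<open>F h 0\<close> representing \<open>f\<close>. They are polynomial in \<open>h\<close>, hence jointly measurable, and they form a chain of
  weak derivatives in direction \<open>h\<close>.
\<close>

lemma sobolev_directional_derivative:
  fixes f :: "'a::euclidean_space \<Rightarrow> real"
  assumes f: "f \<in> Sobolev1_loc k" and k: "1 \<le> k"
  obtains f' g where "f' \<in> borel_measurable borel" "AE x in lborel. f x = f' x"
    "(\<lambda>(h, x). g h x) \<in> borel_measurable (borel \<Otimes>\<^sub>M borel)"
    "\<forall>h. AE x in lborel. weak_form k f x (replicate k h) = g h x"
    "\<forall>h t. 0 < t \<longrightarrow> (AE x in lborel. ennreal \<bar>(fdiff (t *\<^sub>R h) ^^ k) f' x\<bar>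
      \<le> ennreal (t ^ k) * (line_avg (t *\<^sub>R h) ^^ k) (\<lambda>x. ennreal \<bar>g h x\<bar>) x)"
proof -
  have fL: "f \<in> L1_loc" using f by (simp add: Sobolev1_loc_def)
  then obtain f' where f': "locally_integrable f'" and aef: "AE x in lborel. f x = f' x" by (rule L1_loc_borel_representative)
  note [measurable] = locally_integrable_measurable[OF f']
  have fm: "f \<in> borel_measurable lebesgue" using fL by (simp add: L1_loc_def)
  have wp: "has_weak_pderiv f bs (weak_pderiv f bs)" if "bs \<in> basis_lists j" "j \<le> k" for bs j
  proof -
    have "\<exists>g. has_weak_pderiv f bs g" using f that by (auto simp: Sobolev1_loc_def)
    then show ?thesis unfolding weak_pderiv_def by (rule someI_ex)
  qed
  have "\<exists>G. locally_integrable G \<and> (AE x in lborel. weak_pderiv f bs x = G x)" if "bs \<in> basis_lists j" "j \<le> k" for bs j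
  proof -
    have "weak_pderiv f bs \<in> L1_loc" using wp[OF that] by (simp add: has_weak_pderiv_def)
    then show ?thesis using L1_loc_borel_representative by metis
  qed
  then have "\<forall>bs. \<exists>G. (\<exists>j\<le>k. bs \<in> basis_lists j) \<longrightarrow> locally_integrable G \<and> (AE x in lborel. weak_pderiv f bs x = G x)" by blast
  then obtain G where "\<forall>bs. (\<exists>j\<le>k. bs \<in> basis_lists j) \<longrightarrow> locally_integrable (G bs) \<and> (AE x in lborel. weak_pderiv f bs x = G bs x)"
    by metis
  then have G: "locally_integrable (G bs)" "AE x in lborel. weak_pderiv f bs x = G bs x" if "bs \<in> basis_lists j" "j \<le> k" for bs j
    using that by blast+
  have Gint: "(LINT x|lborel. f' x * iter_dderiv bs \<phi> x) = (-1) ^ j * (LINT x|lborel. G bs x * \<phi> x)"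
    if bs: "bs \<in> basis_lists j" "j \<le> k" and t: "test_function \<phi>" for bs j \<phi>
  proof -
    note [measurable] = test_function_measurable[OF t] test_function_measurable[OF test_function_iter[OF t]]
    have "weak_pderiv f bs \<in> borel_measurable lebesgue"
      using wp[OF bs] by (simp add: has_weak_pderiv_def L1_loc_def)
    from integral_lebesgue_representative[OF this _ _ G(2)[OF bs], of \<phi>]
    have 1: "(LINT x|lebesgue. weak_pderiv f bs x * \<phi> x) = (LINT x|lborel. G bs x * \<phi> x)"
      using locally_integrable_measurable[OF G(1)[OF bs]] by simp
    have 2: "(LINT x|lebesgue. f x * iter_dderiv bs \<phi> x) = (LINT x|lborel. f' x * iter_dderiv bs \<phi> x)"
      by (rule integral_lebesgue_representative[OF fm _ _ aef]) measurable
    have "length bs = j" using bs by (simp add: basis_lists_def)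
    then show ?thesis using wp[OF bs] t 1 2 by (simp add: has_weak_pderiv_def)
  qed
  define F where "F h j x = (if j = 0 then f' x else \<Sum>bs\<in>basis_lists j. (\<Prod>i<j. h \<bullet> (bs ! i)) * G bs x)" for h j x
  have F: "locally_integrable (F h j)" if "j \<le> k" for h j
  proof (cases "j = 0")
    case False
    have "locally_integrable (\<lambda>x. \<Sum>bs\<in>basis_lists j. (\<Prod>i<j. h \<bullet> (bs ! i)) * G bs x)"
      using that by (intro locally_integrable_sum finite_basis_lists locally_integrable_cmult G) auto
    then show ?thesis using False by (simp add: F_def[abs_def])
  qed (use f' in \<open>simp add: F_def[abs_def]\<close>)
  have Fint: "(LINT x|lborel. f' x * iter_dderiv (replicate j h) \<phi> x) = (-1) ^ j * (LINT x|lborel. F h j x * \<phi> x)"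
    if j: "j \<le> k" and t: "test_function \<phi>" for h j \<phi>
  proof (cases "j = 0")
    case False
    have sm: "smooth_fun \<phi>" using t by (simp add: test_function_def)
    let ?c = "\<lambda>bs. \<Prod>i<j. h \<bullet> (bs ! i)"
    have "(LINT x|lborel. f' x * iter_dderiv (replicate j h) \<phi> x) =
        (LINT x|lborel. (\<Sum>bs\<in>basis_lists j. ?c bs * (f' x * iter_dderiv bs \<phi> x)))"
      unfolding iter_dderiv_replicate[OF sm] by (simp only: sum_distrib_left mult_ac)
    also have "\<dots> = (\<Sum>bs\<in>basis_lists j. LINT x|lborel. ?c bs * (f' x * iter_dderiv bs \<phi> x))"
      by (intro Bochner_Integration.integral_sum integrable_mult_right locally_integrable_integrable_test f' test_function_iter t)
    also have "\<dots> = (\<Sum>bs\<in>basis_lists j. ?c bs * ((-1) ^ j * (LINT x|lborel. G bs x * \<phi> x)))"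
      using Gint[OF _ j t] by (intro sum.cong refl) (simp only: integral_mult_right_zero)
    also have "\<dots> = (-1) ^ j * (\<Sum>bs\<in>basis_lists j. LINT x|lborel. ?c bs * (G bs x * \<phi> x))"
      by (simp only: sum_distrib_left integral_mult_right_zero) (simp only: mult.left_commute)
    also have "(\<Sum>bs\<in>basis_lists j. LINT x|lborel. ?c bs * (G bs x * \<phi> x)) = (LINT x|lborel. (\<Sum>bs\<in>basis_lists j. ?c bs * (G bs x * \<phi> x)))"
      by (intro Bochner_Integration.integral_sum[symmetric] integrable_mult_right locally_integrable_integrable_test G(1)[OF _ j] t)
    also have "\<dots> = (LINT x|lborel. F h j x * \<phi> x)"
      using False by (simp add: F_def sum_distrib_right mult.assoc)
    finally show ?thesis .
  qed (simp add: F_def)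
  have Fw: "weak_dderiv h (F h j) (F h (Suc j))" if j: "j < k" for h j
    unfolding weak_dderiv_def
  proof (intro conjI allI impI)
    show "locally_integrable (F h j)" "locally_integrable (F h (Suc j))" using j by (auto intro: F)
    fix \<phi> :: "'a \<Rightarrow> real" assume t: "test_function \<phi>"
    have "(-1) ^ j * (LINT x|lborel. F h j x * iter_dderiv [h] \<phi> x) = (LINT x|lborel. f' x * iter_dderiv (replicate j h @ [h]) \<phi> x)"
      using Fint[OF less_imp_le[OF j] test_function_iter[OF t], of h "[h]"] by (simp only: iter_dderiv_append)
    also have "\<dots> = (-1) ^ Suc j * (LINT x|lborel. F h (Suc j) x * \<phi> x)"
      using Fint[of "Suc j" \<phi> h] j t by (simp only: replicate_append_same replicate_Suc Suc_le_eq)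
    finally show "(LINT x|lborel. F h j x * iter_dderiv [h] \<phi> x) = - (LINT x|lborel. F h (Suc j) x * \<phi> x)"
      by (simp add: minus_one_power_iff split: if_splits)
  qed
  show thesis
  proof (rule that[of f' "\<lambda>h. F h k"])
    have "(\<lambda>w. \<Sum>bs\<in>basis_lists k. (\<Prod>i<k. fst w \<bullet> (bs ! i)) * G bs (snd w)) \<in> borel_measurable (borel \<Otimes>\<^sub>M borel)"
    proof (intro borel_measurable_sum borel_measurable_times borel_measurable_prod)
      fix bs :: "'a list" assume "bs \<in> basis_lists k"
      then have [measurable]: "G bs \<in> borel_measurable borel" by (intro locally_integrable_measurable G(1)[of _ k]) auto
      show "(\<lambda>w. G bs (snd w)) \<in> borel_measurable (borel \<Otimes>\<^sub>M borel)" by measurable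
    qed measurable
    then show "(\<lambda>(h, x). F h k x) \<in> borel_measurable (borel \<Otimes>\<^sub>M borel)"
      using k by (simp add: F_def case_prod_beta')
    show "\<forall>h. AE x in lborel. weak_form k f x (replicate k h) = F h k x"
    proof
      fix h
      have "AE x in lborel. \<forall>bs\<in>basis_lists k. weak_pderiv f bs x = G bs x"
        by (intro AE_finite_allI finite_basis_lists G(2)) auto
      then show "AE x in lborel. weak_form k f x (replicate k h) = F h k x"
      proof eventually_elim
        case (elim x)
        then show ?case using k by (auto simp: weak_form_def F_def intro!: sum.cong prod.cong)
      qed
    qed
    show "\<forall>h t. 0 < t \<longrightarrow> (AE x in lborel. ennreal \<bar>(fdiff (t *\<^sub>R h) ^^ k) f' x\<bar>
      \<le> ennreal (t ^ k) * (line_avg (t *\<^sub>R h) ^^ k) (\<lambda>x. ennreal \<bar>F h k x\<bar>) x)"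
    proof (intro allI impI)
      fix h and t :: real assume t: "0 < t"
      have "AE x in lborel. ennreal \<bar>(fdiff (t *\<^sub>R h) ^^ k) (\<lambda>x. t ^ 0 * F h 0 x) x\<bar>
        \<le> (line_avg (t *\<^sub>R h) ^^ k) (\<lambda>x. ennreal \<bar>t ^ k * F h k x\<bar>) x"
      proof (rule fdiff_iterate_le_line_avg[of k _ "\<lambda>j x. t ^ j * F h j x"])
        show "weak_dderiv (t *\<^sub>R h) (\<lambda>x. t ^ j * F h j x) (\<lambda>x. t ^ Suc j * F h (Suc j) x)" if "j < k" for j
          using weak_dderiv_scale[OF Fw[OF that], of t h "t ^ j"] by (simp add: mult.commute[of t])
        show "locally_integrable (\<lambda>x. t ^ 0 * F h 0 x)" by (intro locally_integrable_cmult F) simp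
      qed
      moreover have "(\<lambda>x. ennreal \<bar>t ^ k * F h k x\<bar>) = (\<lambda>x. ennreal (t ^ k) * ennreal \<bar>F h k x\<bar>)"
        using t by (simp add: abs_mult ennreal_mult)
      moreover have "(\<lambda>x. ennreal \<bar>F h k x\<bar>) \<in> borel_measurable borel"
        using locally_integrable_measurable[OF F[OF order_refl, of h]] by simp
      ultimately show "AE x in lborel. ennreal \<bar>(fdiff (t *\<^sub>R h) ^^ k) f' x\<bar>
      \<le> ennreal (t ^ k) * (line_avg (t *\<^sub>R h) ^^ k) (\<lambda>x. ennreal \<bar>F h k x\<bar>) x" by (simp add: line_avg_iterate_cmult F_def[of h 0])
    qed
  qed (use aef in auto)
qed

section \<open>Metric outer measures and Hausdorff measure\<close>

definition metric_outer_measure :: "('a::metric_space set \<Rightarrow> ennreal) \<Rightarrow> bool" where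
  "metric_outer_measure \<mu> \<longleftrightarrow> \<mu> {} = 0 \<and> (\<forall>A B. A \<subseteq> B \<longrightarrow> \<mu> A \<le> \<mu> B) \<and>
     (\<forall>A :: nat \<Rightarrow> _. \<mu> (\<Union>i. A i) \<le> (\<Sum>i. \<mu> (A i))) \<and>
     (\<forall>A B e. 0 < e \<longrightarrow> (\<forall>a\<in>A. \<forall>b\<in>B. e \<le> dist a b) \<longrightarrow> \<mu> A + \<mu> B \<le> \<mu> (A \<union> B))"

lemma metric_outer_measure_Un:
  assumes "metric_outer_measure \<mu>" shows "\<mu> (A \<union> B) \<le> \<mu> A + \<mu> B"
proof -
  have sub: "\<And>A :: nat \<Rightarrow> _. \<mu> (\<Union>i. A i) \<le> (\<Sum>i. \<mu> (A i))" and empty: "\<mu> {} = 0"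
    using assms unfolding metric_outer_measure_def by blast+
  let ?C = "\<lambda>i::nat. if i = 0 then A else if i = 1 then B else {}"
  have "A \<union> B = (\<Union>i. ?C i)" by (auto split: if_splits)
  then have "\<mu> (A \<union> B) \<le> (\<Sum>i. \<mu> (?C i))" using sub[of ?C] by simp
  also have "\<dots> = (\<Sum>i<2. \<mu> (?C i))" by (rule suminf_finite) (auto simp: empty)
  also have "\<dots> = \<mu> A + \<mu> B" by (simp add: numeral_2_eq_2)
  finally show ?thesis .
qed

text \<open>
  Additivity on separated sets, one set at a time; the distance from a finite union is a minimum of
  finitely many positive numbers.
\<close>

lemma metric_outer_measure_sum_separated:
  assumes m: "metric_outer_measure \<mu>"
    and sep: "\<And>j k. j < k \<Longrightarrow> \<exists>e>0. \<forall>a\<in>R j. \<forall>b\<in>R (k::nat). e \<le> dist a b"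
  shows "(\<Sum>j<n. \<mu> (R j)) \<le> \<mu> (\<Union>j<n. R j)"
proof (induction n)
  case (Suc n)
  have "\<exists>e>0. \<forall>j<k. \<forall>a\<in>R j. \<forall>b\<in>R n. e \<le> dist a b" if "k \<le> n" for k
    using that
  proof (induction k)
    case (Suc k)
    then obtain e where e: "e > 0" "\<forall>j<k. \<forall>a\<in>R j. \<forall>b\<in>R n. e \<le> dist a b" by auto
    obtain e' where e': "e' > 0" "\<forall>a\<in>R k. \<forall>b\<in>R n. e' \<le> dist a b" using sep[of k n] Suc.prems by auto
    show ?case using e e' by (intro exI[of _ "min e e'"]) (auto simp: less_Suc_eq min_le_iff_disj)
  qed (auto intro: zero_less_one)
  then obtain e where "e > 0" "\<forall>j<n. \<forall>a\<in>R j. \<forall>b\<in>R n. e \<le> dist a b" by blast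
  then have "\<mu> (\<Union>j<n. R j) + \<mu> (R n) \<le> \<mu> ((\<Union>j<n. R j) \<union> R n)"
  proof -
    have "\<forall>A B e. 0 < e \<longrightarrow> (\<forall>a\<in>A. \<forall>b\<in>B. e \<le> dist a b) \<longrightarrow> \<mu> A + \<mu> B \<le> \<mu> (A \<union> B)"
      using m unfolding metric_outer_measure_def by blast
    from this[rule_format, OF \<open>e > 0\<close>, of "\<Union>j<n. R j" "R n"] show ?thesis
      using \<open>\<forall>j<n. \<forall>a\<in>R j. \<forall>b\<in>R n. e \<le> dist a b\<close> by blast
  qed
  moreover have "(\<Union>j<n. R j) \<union> R n = (\<Union>j<Suc n. R j)" by (auto simp: less_Suc_eq)
  ultimately have "\<mu> (\<Union>j<n. R j) + \<mu> (R n) \<le> \<mu> (\<Union>j<Suc n. R j)" by simp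
  then show ?case using Suc by (auto intro: order_trans[OF add_right_mono])
qed simp

text \<open>
  Cut \<open>A - F\<close> into the shells \<open>R n\<close> of points at distance between \<open>1 / (n + 2)\<close> and \<open>1 / (n + 1)\<close> from
  \<open>F\<close>. Shells of equal parity are pairwise separated, so the sum of their measures is finite and the
  innermost shells contribute arbitrarily little; the rest of \<open>A - F\<close> is separated from \<open>F\<close>.
\<close>

lemma caratheodory_criterion:
  assumes m: "metric_outer_measure \<mu>" and F: "closed F"
  shows "\<mu> (F \<inter> A) + \<mu> (A - F) \<le> \<mu> A"
proof (cases "F = {} \<or> \<mu> A = top")
  case True
  then show ?thesis using m by (auto simp: metric_outer_measure_def)
next
  case False
  then have Fn: "F \<noteq> {}" and fin: "\<mu> A \<noteq> top" by auto
  have mono: "\<And>A B. A \<subseteq> B \<Longrightarrow> \<mu> A \<le> \<mu> B" and sub: "\<And>A :: nat \<Rightarrow> _. \<mu> (\<Union>i. A i) \<le> (\<Sum>i. \<mu> (A i))"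
    and metr: "\<And>A B e. 0 < e \<Longrightarrow> (\<forall>a\<in>A. \<forall>b\<in>B. e \<le> dist a b) \<Longrightarrow> \<mu> A + \<mu> B \<le> \<mu> (A \<union> B)"
    and empty: "\<mu> {} = 0"
    using m unfolding metric_outer_measure_def by blast+
  define D where "D n = {x\<in>A. 1 / real (Suc n) \<le> infdist x F}" for n
  define R where "R n = D (Suc n) - D n" for n
  have D_mono: "D n \<subseteq> D (Suc n)" for n
  proof -
    have "1 / real (Suc (Suc n)) \<le> 1 / real (Suc n)" by (intro divide_left_mono) auto
    then show ?thesis unfolding D_def by auto
  qed
  have sep: "\<exists>e>0. \<forall>a\<in>R j. \<forall>b\<in>R k. e \<le> dist a b" if "Suc j < k" for j k
  proof (intro exI conjI ballI)
    let ?e = "1 / real (Suc (Suc j)) - 1 / real (Suc k)"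
    have "1 / real (Suc k) < 1 / real (Suc (Suc j))" using that by (intro divide_strict_left_mono) auto
    then show "0 < ?e" by simp
    fix a b assume "a \<in> R j" "b \<in> R k"
    then have "1 / real (Suc (Suc j)) \<le> infdist a F" "infdist b F < 1 / real (Suc k)"
      unfolding R_def D_def by (auto simp del: of_nat_Suc)
    then show "?e \<le> dist a b" using infdist_triangle_abs[of a F b] by linarith
  qed
  have sumR: "(\<Sum>k<n. \<mu> (R k)) \<le> \<mu> A + \<mu> A" for n
  proof -
    have 1: "(\<Sum>k<n. \<mu> (R (2 * k + i))) \<le> \<mu> A" for i
    proof -
      have "(\<Sum>k<n. \<mu> (R (2 * k + i))) \<le> \<mu> (\<Union>k<n. R (2 * k + i))"
        by (rule metric_outer_measure_sum_separated[OF m]) (rule sep, simp)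
      also have "\<dots> \<le> \<mu> A" by (intro mono) (auto simp: R_def D_def)
      finally show ?thesis .
    qed
    have "(\<Sum>k<n. \<mu> (R k)) \<le> (\<Sum>k<2 * n. \<mu> (R k))" by (intro sum_mono2) auto
    also have "\<dots> = (\<Sum>k<n. \<mu> (R (2 * k + 0))) + (\<Sum>k<n. \<mu> (R (2 * k + 1)))"
      by (induction n) (auto simp: add_ac)
    also have "\<dots> \<le> \<mu> A + \<mu> A" using 1 by (intro add_mono)
    finally show ?thesis .
  qed
  have muR_fin: "\<mu> (R k) \<noteq> top" for k
  proof -
    have "R k \<subseteq> A" by (auto simp: R_def D_def)
    then show ?thesis using fin mono[of "R k" A] by (auto simp: top_unique)
  qed
  define r where "r k = enn2real (\<mu> (R k))" for k
  have r: "\<mu> (R k) = ennreal (r k)" "0 \<le> r k" for k using muR_fin[of k] by (auto simp: r_def less_top)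
  have "summable r"
  proof (rule summableI_nonneg_bounded)
    fix n
    have "ennreal (\<Sum>k<n. r k) \<le> \<mu> A + \<mu> A" using sumR[of n] r by (simp add: sum_ennreal)
    also have "\<dots> = ennreal (2 * enn2real (\<mu> A))"
      using fin by (cases "\<mu> A") (auto simp: ennreal_plus[symmetric] simp del: ennreal_plus)
    finally show "(\<Sum>k<n. r k) \<le> 2 * enn2real (\<mu> A)" by (simp add: ennreal_le_iff)
  qed (rule r)
  show ?thesis
  proof (rule ennreal_le_epsilon)
    fix e :: real assume "0 < e"
    from suminf_exist_split[OF this \<open>summable r\<close>] obtain n where n: "norm (\<Sum>i. r (i + n)) < e" by blast
    have sr: "summable (\<lambda>i. r (i + n))" using \<open>summable r\<close> by (simp add: summable_iff_shift)
    have "A - F \<subseteq> D n \<union> (\<Union>i. R (i + n))"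
    proof
      fix x assume x: "x \<in> A - F"
      then have "0 < infdist x F" using infdist_pos_not_in_closed[OF F Fn, of x] by auto
      then obtain k where "inverse (real (Suc k)) < infdist x F" using reals_Archimedean by blast
      then have k: "x \<in> D k" using x by (simp add: D_def inverse_eq_divide)
      show "x \<in> D n \<union> (\<Union>i. R (i + n))"
      proof (cases "x \<in> D n")
        case False
        define l where "l = (LEAST l. x \<in> D l)"
        have l: "x \<in> D l" unfolding l_def using k by (rule LeastI)
        have nl: "x \<notin> D j" if "j < l" for j using that unfolding l_def by (rule not_less_Least)
        have "D l \<subseteq> D n" if "l \<le> n" by (rule lift_Suc_mono_le[of D, OF D_mono that])
        then have "n < l" using l False by (meson not_less subsetD)
        then obtain i where i: "l = Suc (i + n)" by (metis add.commute less_iff_Suc_add)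
        then have "x \<in> R (i + n)" using l nl[of "i + n"] by (simp add: R_def)
        then show ?thesis by blast
      qed simp
    qed
    then have "\<mu> (A - F) \<le> \<mu> (D n \<union> (\<Union>i. R (i + n)))" by (rule mono)
    also have "\<dots> \<le> \<mu> (D n) + \<mu> (\<Union>i. R (i + n))"
      by (rule metric_outer_measure_Un[OF m])
    also have "\<mu> (\<Union>i. R (i + n)) \<le> (\<Sum>i. \<mu> (R (i + n)))" by (rule sub)
    also have "(\<Sum>i. \<mu> (R (i + n))) = ennreal (\<Sum>i. r (i + n))"
      using r sr by (simp add: suminf_ennreal2)
    also have "\<dots> \<le> ennreal e" using n by (intro ennreal_leI) simp
    finally have "\<mu> (A - F) \<le> \<mu> (D n) + ennreal e" by (simp add: add_left_mono)
    then have "\<mu> (F \<inter> A) + \<mu> (A - F) \<le> (\<mu> (F \<inter> A) + \<mu> (D n)) + ennreal e"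
      by (metis add.assoc add_left_mono)
    also have "\<mu> (F \<inter> A) + \<mu> (D n) \<le> \<mu> ((F \<inter> A) \<union> D n)"
    proof (rule metr)
      show "0 < 1 / real (Suc n)" by simp
      show "\<forall>a\<in>F \<inter> A. \<forall>b\<in>D n. 1 / real (Suc n) \<le> dist a b"
      proof (intro ballI)
        fix a b assume "a \<in> F \<inter> A" "b \<in> D n"
        then have "infdist b F \<le> dist b a" "1 / real (Suc n) \<le> infdist b F"
          by (auto simp: D_def intro: infdist_le)
        then show "1 / real (Suc n) \<le> dist a b" by (simp only: dist_commute)
      qed
    qed
    also have "\<dots> \<le> \<mu> A" by (intro mono) (auto simp: D_def)
    finally show "\<mu> (F \<inter> A) + \<mu> (A - F) \<le> \<mu> A + ennreal e" by (simp add: add_right_mono)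
  qed
qed

lemma metric_outer_measure_borel:
  assumes m: "metric_outer_measure \<mu>"
  shows "measure_space UNIV (sets borel) \<mu>"
proof -
  interpret P: sigma_algebra UNIV "Pow UNIV :: 'a set set" by (rule sigma_algebra_Pow)
  have sub: "\<And>A :: nat \<Rightarrow> _. \<mu> (\<Union>i. A i) \<le> (\<Sum>i. \<mu> (A i))" and mono: "\<And>A B. A \<subseteq> B \<Longrightarrow> \<mu> A \<le> \<mu> B" and empty: "\<mu> {} = 0"
    using m unfolding metric_outer_measure_def by blast+
  let ?L = "lambda_system UNIV (Pow UNIV) \<mu>"
  have "outer_measure_space (Pow UNIV) \<mu>"
    unfolding outer_measure_space_def positive_def increasing_def countably_subadditive_def
    using sub mono empty by auto
  then have L: "measure_space UNIV ?L \<mu>" by (rule P.caratheodory_lemma)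
  then interpret L: sigma_algebra UNIV ?L by (simp add: measure_space_def)
  have "Collect closed \<subseteq> ?L"
  proof
    fix F :: "'a set" assume "F \<in> Collect closed"
    then have F: "closed F" by simp
    have "\<mu> (F \<inter> x) + \<mu> ((UNIV - F) \<inter> x) = \<mu> x" for x
    proof (rule antisym)
      have eq: "(UNIV - F) \<inter> x = x - F" by auto
      show "\<mu> (F \<inter> x) + \<mu> ((UNIV - F) \<inter> x) \<le> \<mu> x"
        unfolding eq by (rule caratheodory_criterion[OF m F])
      have "x = F \<inter> x \<union> (x - F)" by auto
      then show "\<mu> x \<le> \<mu> (F \<inter> x) + \<mu> ((UNIV - F) \<inter> x)"
        using metric_outer_measure_Un[OF m, of "F \<inter> x" "x - F"] by (simp add: eq)
    qed
    then show "F \<in> ?L" by (simp add: lambda_system_def)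
  qed
  then have "sigma_sets UNIV (Collect closed) \<subseteq> ?L" by (rule L.sigma_sets_subset)
  then have "sets borel \<subseteq> ?L" by (simp add: borel_eq_closed)
  moreover have "sigma_algebra UNIV (sets (borel :: 'a measure))"
    using sets.sigma_algebra_axioms[of "borel :: 'a measure"] by simp
  ultimately show ?thesis using measure_down[OF L] by blast
qed

lemma hausdorff_content_mono: "A \<subseteq> B \<Longrightarrow> hausdorff_content d \<delta> A \<le> hausdorff_content d \<delta> B"
  unfolding hausdorff_content_def by (intro INF_superset_mono) auto

lemma hausdorff_content_antimono: "\<delta> \<le> \<delta>' \<Longrightarrow> hausdorff_content d \<delta>' A \<le> hausdorff_content d \<delta> A"
  unfolding hausdorff_content_def by (intro INF_superset_mono) (auto intro: order_trans)

lemma hausdorff_content_le_outer: "0 < \<delta> \<Longrightarrow> hausdorff_content d \<delta> A \<le> hausdorff_outer d A"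
  unfolding hausdorff_outer_def by (intro SUP_upper) auto

lemma hausdorff_content_le_sum:
  assumes "A \<subseteq> (\<Union>i. C i)" "\<And>i. bounded (C i)" "\<And>i. diameter (C i) \<le> \<delta>"
  shows "hausdorff_content d \<delta> A \<le> (\<Sum>i. hausdorff_gauge d (C i))"
  unfolding hausdorff_content_def by (rule INF_lower) (use assms in auto)

lemma hausdorff_content_subadditive:
  "hausdorff_content d \<delta> (\<Union>i::nat. A i) \<le> (\<Sum>i. hausdorff_content d \<delta> (A i))"
proof (rule ennreal_le_epsilon)
  fix e :: real assume e: "0 < e" "(\<Sum>n. hausdorff_content d \<delta> (A n)) < top"
  have "\<exists>B. A n \<subseteq> (\<Union>i. B i) \<and> (\<forall>i. bounded (B i) \<and> diameter (B i) \<le> \<delta>) \<and>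
      (\<Sum>i. hausdorff_gauge d (B i)) \<le> hausdorff_content d \<delta> (A n) + e * (1/2)^(Suc n)" for n :: nat
  proof -
    have "hausdorff_content d \<delta> (A n) < hausdorff_content d \<delta> (A n) + e * (1/2)^Suc n"
      using e by (auto simp add: less_top dest!: ennreal_suminf_lessD)
    then show ?thesis
      unfolding hausdorff_content_def[of d \<delta> "A n"] INF_less_iff
      by (auto intro: less_imp_le simp: hausdorff_content_def[of d \<delta> "A n"])
  qed
  then obtain B where B: "\<And>n. A n \<subseteq> (\<Union>i. B n i)" "\<And>n i. bounded (B n i)" "\<And>n i. diameter (B n i) \<le> \<delta>"
    "\<And>n. (\<Sum>i. hausdorff_gauge d (B n i)) \<le> hausdorff_content d \<delta> (A n) + e * (1/2)^(Suc n)"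
    by metis
  define C where "C = case_prod B o prod_decode"
  have A_C: "(\<Union>i. A i) \<subseteq> (\<Union>i. C i)"
    using B(1) by (auto simp add: C_def subset_eq) (metis prod.case prod_encode_inverse)
  have "hausdorff_content d \<delta> (\<Union>i. A i) \<le> (\<Sum>i. hausdorff_gauge d (C i))"
    by (rule hausdorff_content_le_sum[OF A_C]) (auto simp: C_def B split: prod.split)
  also have "\<dots> = (\<Sum>n. \<Sum>i. hausdorff_gauge d (B n i))"
    unfolding C_def comp_def by (intro suminf_ennreal_2dimen) auto
  also have "\<dots> \<le> (\<Sum>n. hausdorff_content d \<delta> (A n) + e * (1/2) ^ Suc n)"
    by (intro suminf_le allI B) auto
  also have "\<dots> = (\<Sum>n. hausdorff_content d \<delta> (A n)) + (\<Sum>n. ennreal e * ennreal ((1/2) ^ Suc n))"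
    using e by (subst suminf_add[symmetric])
       (auto simp del: ennreal_suminf_cmult simp add: ennreal_mult[symmetric])
  also have "\<dots> = (\<Sum>n. hausdorff_content d \<delta> (A n)) + e"
    unfolding ennreal_suminf_cmult
    by (subst suminf_ennreal_eq[OF zero_le_power power_half_series]) auto
  finally show "hausdorff_content d \<delta> (\<Union>i. A i) \<le> (\<Sum>n. hausdorff_content d \<delta> (A n)) + e" .
qed

text \<open>
  A covering set of small diameter cannot meet both sets, so a covering of the union splits. The
  discarded sets are replaced by the empty set, whose gauge is \<open>0\<close>.
\<close>

lemma hausdorff_content_separated:
  assumes sep: "\<forall>a\<in>A. \<forall>b\<in>B. e \<le> dist a b" and "0 < \<delta>" "\<delta> < e"
  shows "hausdorff_content d \<delta> A + hausdorff_content d \<delta> B \<le> hausdorff_content d \<delta> (A \<union> B)"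
  unfolding hausdorff_content_def[of d \<delta> "A \<union> B"]
proof (rule INF_greatest, clarsimp)
  fix C :: "nat \<Rightarrow> 'a set"
  assume cov: "A \<subseteq> (\<Union>i. C i)" "B \<subseteq> (\<Union>i. C i)" and C: "\<forall>i. bounded (C i) \<and> diameter (C i) \<le> \<delta>"
  define C1 where "C1 i = (if C i \<inter> A = {} then {} else C i)" for i
  define C2 where "C2 i = (if C i \<inter> B = {} then {} else C i)" for i
  have "hausdorff_content d \<delta> A \<le> (\<Sum>i. hausdorff_gauge d (C1 i))"
    by (rule hausdorff_content_le_sum) (use cov C \<open>0 < \<delta>\<close> in \<open>fastforce simp: C1_def\<close>)+
  moreover have "hausdorff_content d \<delta> B \<le> (\<Sum>i. hausdorff_gauge d (C2 i))"
    by (rule hausdorff_content_le_sum) (use cov C \<open>0 < \<delta>\<close> in \<open>fastforce simp: C2_def\<close>)+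
  moreover have "(\<Sum>i. hausdorff_gauge d (C1 i)) + (\<Sum>i. hausdorff_gauge d (C2 i)) \<le> (\<Sum>i. hausdorff_gauge d (C i))"
  proof (subst suminf_add, simp, simp, rule suminf_le)
    fix i
    have "C i \<inter> A = {} \<or> C i \<inter> B = {}"
    proof (rule ccontr)
      assume "\<not> ?thesis"
      then obtain a b where ab: "a \<in> C i" "a \<in> A" "b \<in> C i" "b \<in> B" by blast
      have "dist a b \<le> diameter (C i)" using C ab by (intro diameter_bounded_bound) auto
      moreover have "e \<le> dist a b" using sep ab by blast
      moreover have "diameter (C i) \<le> \<delta>" using C by blast
      ultimately show False using \<open>\<delta> < e\<close> by linarith
    qed
    then show "hausdorff_gauge d (C1 i) + hausdorff_gauge d (C2 i) \<le> hausdorff_gauge d (C i)"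
      by (auto simp: C1_def C2_def hausdorff_gauge_def)
  qed auto
  ultimately show "hausdorff_content d \<delta> A + hausdorff_content d \<delta> B \<le> (\<Sum>i. hausdorff_gauge d (C i))"
    by (meson add_mono order_trans)
qed

lemma metric_outer_measure_hausdorff: "metric_outer_measure (hausdorff_outer d)"
  unfolding metric_outer_measure_def
proof (intro conjI allI impI)
  have "hausdorff_content d \<delta> {} = 0" if "0 < \<delta>" for \<delta>
    using hausdorff_content_le_sum[of "{}" "\<lambda>_. {}" \<delta> d] that by (simp add: hausdorff_gauge_def)
  then have "hausdorff_outer d {} \<le> 0" unfolding hausdorff_outer_def by (intro SUP_least) auto
  then show "hausdorff_outer d {} = 0" by simp
  show "hausdorff_outer d A \<le> hausdorff_outer d B" if "A \<subseteq> B" for A B :: "'a set"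
    unfolding hausdorff_outer_def by (intro SUP_mono') (rule hausdorff_content_mono[OF that])
  show "hausdorff_outer d (\<Union>i. A i) \<le> (\<Sum>i. hausdorff_outer d (A i))" for A :: "nat \<Rightarrow> 'a set"
    unfolding hausdorff_outer_def[of d "\<Union>i. A i"]
  proof (rule SUP_least)
    fix \<delta> :: real assume "\<delta> \<in> {0<..}"
    then have "(\<Sum>i. hausdorff_content d \<delta> (A i)) \<le> (\<Sum>i. hausdorff_outer d (A i))"
      by (intro suminf_le hausdorff_content_le_outer) auto
    then show "hausdorff_content d \<delta> (\<Union>i. A i) \<le> (\<Sum>i. hausdorff_outer d (A i))"
      using hausdorff_content_subadditive[of d \<delta> A] by simp
  qed
  fix A B :: "'a set" and e :: real
  assume e: "0 < e" and sep: "\<forall>a\<in>A. \<forall>b\<in>B. e \<le> dist a b"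
  have le: "hausdorff_content d x A + hausdorff_content d y B \<le> hausdorff_outer d (A \<union> B)" if "0 < x" "0 < y" for x y
  proof -
    let ?\<delta> = "min (min x y) (e / 2)"
    have \<delta>: "0 < ?\<delta>" "?\<delta> < e" using that e by auto
    have "hausdorff_content d x A + hausdorff_content d y B \<le> hausdorff_content d ?\<delta> A + hausdorff_content d ?\<delta> B"
      by (intro add_mono hausdorff_content_antimono) auto
    also have "\<dots> \<le> hausdorff_content d ?\<delta> (A \<union> B)" by (rule hausdorff_content_separated[OF sep \<delta>])
    also have "\<dots> \<le> hausdorff_outer d (A \<union> B)" by (rule hausdorff_content_le_outer[OF \<delta>(1)])
    finally show ?thesis .
  qed
  have "hausdorff_outer d A + hausdorff_content d y B \<le> hausdorff_outer d (A \<union> B)" if y: "0 < y" for y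
    unfolding hausdorff_outer_def[of d A]
    by (subst ennreal_SUP_add_left[symmetric]) (auto intro!: SUP_least le y)
  then show "hausdorff_outer d A + hausdorff_outer d B \<le> hausdorff_outer d (A \<union> B)"
    unfolding hausdorff_outer_def[of d B]
    by (subst add.commute, subst ennreal_SUP_add_left[symmetric]) (auto intro!: SUP_least simp: add.commute)
qed

lemma sets_hausdorff_measure [simp, measurable_cong]: "sets (hausdorff_measure d :: 'a::metric_space measure) = sets borel"
proof -
  have "sigma_sets UNIV (sets (borel :: 'a measure)) = sets borel"
    using sets.sigma_sets_eq[of "borel :: 'a measure"] by simp
  then show ?thesis unfolding hausdorff_measure_def by (simp add: sets_measure_of_conv)
qed

lemma emeasure_hausdorff_measure:
  fixes A :: "'a::metric_space set"
  assumes "A \<in> sets borel" shows "emeasure (hausdorff_measure d) A = hausdorff_outer d A"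
proof (rule emeasure_measure_of[OF hausdorff_measure_def])
  have ms: "measure_space UNIV (sets (borel :: 'a measure)) (hausdorff_outer d)"
    by (rule metric_outer_measure_borel[OF metric_outer_measure_hausdorff])
  then show "positive (sets (hausdorff_measure d)) (hausdorff_outer d :: 'a set \<Rightarrow> ennreal)"
    "countably_additive (sets (hausdorff_measure d)) (hausdorff_outer d :: 'a set \<Rightarrow> ennreal)"
    by (simp_all add: measure_space_def)
qed (use assms in auto)

section \<open>The cone measure on the sphere\<close>

lemma measurable_sgn [measurable]: "sgn \<in> borel_measurable (borel :: 'a::euclidean_space measure)"
  unfolding sgn_div_norm[abs_def] by measurable

lemma ball_borel_measurable [measurable]: "ball a r \<in> sets borel" by simp

text \<open>
  Up to the factor \<open>N\<close> this is the surface measure of the unit sphere.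
\<close>

definition cone_measure :: "'a::euclidean_space measure" where
  "cone_measure = distr (density lborel (indicator (ball 0 1))) borel sgn"

lemma sets_cone_measure [simp, measurable_cong]: "sets cone_measure = sets borel"
  by (simp add: cone_measure_def)

lemma emeasure_cone_measure:
  assumes [measurable]: "A \<in> sets borel"
  shows "emeasure cone_measure A = emeasure lborel (ball 0 1 \<inter> sgn -` A)"
proof -
  have m[measurable]: "sgn -` A \<in> sets borel" using measurable_sets_borel[OF measurable_sgn assms] .
  have "emeasure cone_measure A = (\<integral>\<^sup>+x. indicator (ball 0 1) x * indicator (sgn -` A) x \<partial>lborel)"
  proof -
    have "emeasure cone_measure A = emeasure (density lborel (indicator (ball 0 1))) (sgn -` A)"
      unfolding cone_measure_def by (simp add: emeasure_distr)
    also have "\<dots> = (\<integral>\<^sup>+x. indicator (ball 0 1) x * indicator (sgn -` A) x \<partial>lborel)"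
      by (rule emeasure_density) measurable
    finally show ?thesis .
  qed
  also have "\<dots> = (\<integral>\<^sup>+x. indicator (ball 0 1 \<inter> sgn -` A) x \<partial>lborel)"
    by (intro nn_integral_cong) (auto split: split_indicator)
  also have "\<dots> = emeasure lborel (ball 0 1 \<inter> sgn -` A)" by (rule nn_integral_indicator) simp
  finally show ?thesis .
qed

lemma nn_integral_cone_measure:
  assumes [measurable]: "g \<in> borel_measurable borel"
  shows "(\<integral>\<^sup>+x. g x \<partial>cone_measure) = (\<integral>\<^sup>+x\<in>ball 0 1. g (sgn x) \<partial>lborel)"
proof -
  have "(\<integral>\<^sup>+x. g x \<partial>cone_measure) = (\<integral>\<^sup>+x. g (sgn x) \<partial>density lborel (indicator (ball 0 1)))"
    unfolding cone_measure_def by (rule nn_integral_distr) auto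
  also have "\<dots> = (\<integral>\<^sup>+x. indicator (ball 0 1) x * g (sgn x) \<partial>lborel)"
    by (rule nn_integral_density) measurable
  finally show ?thesis by (simp add: mult.commute)
qed

text \<open>
  The cone over a cap of radius \<open>r\<close> has width at least \<open>r / 4\<close> around the segment from \<open>a / 2\<close> to
  \<open>3 a / 4\<close>.
\<close>

lemma cap_contains_ball:
  fixes a y :: "'a::euclidean_space"
  assumes a: "norm a = 1" and \<rho>: "1/2 \<le> \<rho>" "\<rho> \<le> 3/4" and r: "0 < r" "r \<le> 1" and y: "dist (\<rho> *\<^sub>R a) y < r / 4"
  shows "y \<in> ball 0 1 \<inter> sgn -` cball a r"
proof -
  define w where "w = y - \<rho> *\<^sub>R a"
  have w: "norm w < r / 4" using y by (simp add: w_def dist_norm norm_minus_commute)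
  have na: "norm (\<rho> *\<^sub>R a) = \<rho>" using a \<rho> by simp
  have diff: "\<bar>norm y - \<rho>\<bar> \<le> norm w"
    using norm_triangle_ineq3[of y "\<rho> *\<^sub>R a"] na by (simp add: w_def)
  then have ny: "norm y < 1" "0 < norm y" using w r \<rho> by linarith+
  have "norm (sgn y - a) \<le> norm (sgn y - (1 / \<rho>) *\<^sub>R y) + norm ((1 / \<rho>) *\<^sub>R y - a)"
    using norm_triangle_ineq[of "sgn y - (1 / \<rho>) *\<^sub>R y" "(1 / \<rho>) *\<^sub>R y - a"] by simp
  also have "norm (sgn y - (1 / \<rho>) *\<^sub>R y) = \<bar>norm y - \<rho>\<bar> / \<rho>"
  proof -
    have "sgn y - (1 / \<rho>) *\<^sub>R y = (1 / norm y - 1 / \<rho>) *\<^sub>R y"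
      by (simp add: sgn_div_norm inverse_eq_divide scaleR_left_diff_distrib)
    then have "norm (sgn y - (1 / \<rho>) *\<^sub>R y) = \<bar>1 / norm y - 1 / \<rho>\<bar> * norm y" by simp
    also have "\<dots> = \<bar>(1 / norm y - 1 / \<rho>) * norm y\<bar>" by (simp add: abs_mult)
    also have "(1 / norm y - 1 / \<rho>) * norm y = (\<rho> - norm y) / \<rho>" using ny \<rho> by (simp add: field_simps)
    also have "\<bar>(\<rho> - norm y) / \<rho>\<bar> = \<bar>norm y - \<rho>\<bar> / \<rho>" using \<rho> by (simp add: abs_minus_commute)
    finally show ?thesis .
  qed
  also have "norm ((1 / \<rho>) *\<^sub>R y - a) = norm w / \<rho>"
  proof -
    have "(1 / \<rho>) *\<^sub>R y - a = (1 / \<rho>) *\<^sub>R w" using \<rho> by (simp add: w_def scaleR_right_diff_distrib)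
    then show ?thesis using \<rho> by simp
  qed
  also have "\<bar>norm y - \<rho>\<bar> / \<rho> + norm w / \<rho> \<le> 2 * norm w / \<rho>"
    using diff \<rho> by (simp add: field_simps)
  also have "\<dots> \<le> 4 * norm w" using mult_left_mono[OF \<rho>(1), of "4 * norm w"] \<rho> by (simp add: divide_le_eq)
  finally have "norm (sgn y - a) \<le> r" using w by simp
  then show ?thesis using ny by (simp add: dist_norm norm_minus_commute)
qed

text \<open>
  About \<open>1 / r\<close> disjoint balls of radius \<open>r / 4\<close> are lined up along the axis of the cone.
\<close>

lemma cone_measure_cap_ge:
  fixes a :: "'a::euclidean_space"
  assumes a: "norm a = 1" and r: "0 < r" "r \<le> 1"
  shows "ennreal (unit_ball_vol (real DIM('a)) / (2 * 4 ^ DIM('a)) * r ^ (DIM('a) - 1)) \<le> emeasure cone_measure (cball a r)"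
proof -
  let ?v = "unit_ball_vol (real DIM('a))"
  define n where "n = Suc (nat \<lfloor>1 / (2 * r)\<rfloor>)"
  define \<rho> where "\<rho> j = 1 / 2 + real j * (r / 2)" for j :: nat
  have n: "1 / (2 * r) \<le> real n" unfolding n_def using r by (simp add: of_nat_nat) linarith
  have \<rho>: "1/2 \<le> \<rho> j" "\<rho> j \<le> 3/4" if "j < n" for j
  proof -
    show "1/2 \<le> \<rho> j" using r by (simp add: \<rho>_def)
    have "j \<le> nat \<lfloor>1 / (2 * r)\<rfloor>" using that by (simp add: n_def)
    then have "real j \<le> real (nat \<lfloor>1 / (2 * r)\<rfloor>)" by (rule of_nat_mono)
    also have "\<dots> = of_int \<lfloor>1 / (2 * r)\<rfloor>" using r by (simp add: of_nat_nat)
    also have "\<dots> \<le> 1 / (2 * r)" by (rule of_int_floor_le)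
    finally have "real j \<le> 1 / (2 * r)" .
    then have "real j * (r / 2) \<le> 1 / 4" using r by (simp add: field_simps)
    then show "\<rho> j \<le> 3/4" by (simp add: \<rho>_def)
  qed
  have disj: "disjoint_family_on (\<lambda>j. ball (\<rho> j *\<^sub>R a) (r / 4)) {..<n}"
    unfolding disjoint_family_on_def
  proof (intro ballI impI)
    fix i j :: nat assume "i \<noteq> j"
    have "dist (\<rho> i *\<^sub>R a) (\<rho> j *\<^sub>R a) = \<bar>\<rho> i - \<rho> j\<bar>"
      using a by (simp add: dist_norm flip: scaleR_left_diff_distrib)
    also have "\<rho> i - \<rho> j = (real i - real j) * (r / 2)" by (simp add: \<rho>_def algebra_simps)
    also have "\<bar>(real i - real j) * (r / 2)\<bar> = \<bar>real i - real j\<bar> * (r / 2)" using r by (simp add: abs_mult)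
    also have "1 * (r / 2) \<le> \<bar>real i - real j\<bar> * (r / 2)"
      using \<open>i \<noteq> j\<close> r by (intro mult_right_mono) auto
    finally have d: "r / 2 \<le> dist (\<rho> i *\<^sub>R a) (\<rho> j *\<^sub>R a)" by simp
    show "ball (\<rho> i *\<^sub>R a) (r / 4) \<inter> ball (\<rho> j *\<^sub>R a) (r / 4) = {}"
    proof (rule ccontr)
      assume "\<not> ?thesis"
      then obtain y where "dist (\<rho> i *\<^sub>R a) y < r / 4" "dist (\<rho> j *\<^sub>R a) y < r / 4" by auto
      then show False using d dist_triangle2[of "\<rho> i *\<^sub>R a" "\<rho> j *\<^sub>R a" y] by linarith
    qed
  qed
  have "ennreal (?v / (2 * 4 ^ DIM('a)) * r ^ (DIM('a) - 1)) \<le> ennreal (real n * (?v * (r / 4) ^ DIM('a)))"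
  proof (rule ennreal_leI)
    have D: "r ^ DIM('a) = r * r ^ (DIM('a) - 1)" by (metis DIM_positive Suc_diff_1 power_Suc)
    have "?v / (2 * 4 ^ DIM('a)) * r ^ (DIM('a) - 1) = (1 / (2 * r)) * (?v * (r / 4) ^ DIM('a))"
      using r by (simp add: power_divide D field_simps)
    also have "\<dots> \<le> real n * (?v * (r / 4) ^ DIM('a))"
      using n r by (intro mult_right_mono) auto
    finally show "?v / (2 * 4 ^ DIM('a)) * r ^ (DIM('a) - 1) \<le> real n * (?v * (r / 4) ^ DIM('a))" .
  qed
  also have "\<dots> = (\<Sum>j<n. emeasure lborel (ball (\<rho> j *\<^sub>R a) (r / 4)))"
    using r by (simp add: emeasure_ball ennreal_mult' ennreal_of_nat_eq_real_of_nat)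
  also have "\<dots> = emeasure lborel (\<Union>j<n. ball (\<rho> j *\<^sub>R a) (r / 4))"
    by (rule sum_emeasure[OF _ disj]) auto
  also have "\<dots> \<le> emeasure lborel (ball 0 1 \<inter> sgn -` cball a r)"
  proof (rule emeasure_mono)
    show "(\<Union>j<n. ball (\<rho> j *\<^sub>R a) (r / 4)) \<subseteq> ball 0 1 \<inter> sgn -` cball a r"
      using cap_contains_ball[OF a \<rho> r] by auto
    show "ball 0 1 \<inter> sgn -` cball a r \<in> sets lborel"
      using measurable_sets_borel[OF measurable_sgn, of "cball a r"] by auto
  qed
  also have "\<dots> = emeasure cone_measure (cball a r)" by (simp add: emeasure_cone_measure)
  finally show ?thesis .
qed

text \<open>
  The cone is covered by about \<open>1 / r\<close> balls of radius \<open>2 r\<close> with centres on its axis.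
\<close>

lemma cone_measure_cap_le:
  fixes a :: "'a::euclidean_space"
  assumes a: "norm a = 1" and r: "0 < r" "r \<le> 1"
  shows "emeasure cone_measure (cball a r) \<le> ennreal (unit_ball_vol (real DIM('a)) * 2 ^ Suc DIM('a) * r ^ (DIM('a) - 1))"
proof -
  let ?v = "unit_ball_vol (real DIM('a))"
  define n where "n = nat \<lfloor>1 / r\<rfloor>"
  have n: "real n \<le> 1 / r" using r by (simp add: n_def of_nat_nat)
  have sub: "ball 0 1 \<inter> sgn -` cball a r \<subseteq> (\<Union>j\<le>n. cball ((real j * r) *\<^sub>R a) (2 * r))"
  proof
    fix x assume x: "x \<in> ball 0 1 \<inter> sgn -` cball a r"
    define j where "j = nat \<lfloor>norm x / r\<rfloor>"
    have "norm x / r \<le> 1 / r" using x r by (intro divide_right_mono) auto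
    then have "j \<le> n" unfolding j_def n_def by (intro nat_mono floor_mono)
    have "real j = of_int \<lfloor>norm x / r\<rfloor>" using r by (simp add: j_def of_nat_nat)
    then have "real j \<le> norm x / r" "norm x / r < real j + 1" by linarith+
    then have j: "real j * r \<le> norm x" "norm x \<le> real j * r + r" using r by (simp_all add: field_simps)
    have xs: "x = norm x *\<^sub>R sgn x" by (cases "x = 0") (simp_all add: sgn_div_norm)
    have "norm (x - (real j * r) *\<^sub>R a) = norm (norm x *\<^sub>R (sgn x - a) + (norm x - real j * r) *\<^sub>R a)"
      by (subst xs) (simp add: algebra_simps)
    also have "\<dots> \<le> norm (norm x *\<^sub>R (sgn x - a)) + norm ((norm x - real j * r) *\<^sub>R a)" by (rule norm_triangle_ineq)
    also have "\<dots> = norm x * norm (sgn x - a) + \<bar>norm x - real j * r\<bar>" using a by simp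
    also have "\<dots> \<le> 1 * r + r"
      using x j by (intro add_mono mult_mono) (auto simp: dist_norm norm_minus_commute)
    finally have "norm (x - (real j * r) *\<^sub>R a) \<le> 2 * r" by simp
    then show "x \<in> (\<Union>j\<le>n. cball ((real j * r) *\<^sub>R a) (2 * r))"
      using \<open>j \<le> n\<close> by (auto simp: dist_norm norm_minus_commute)
  qed
  have "emeasure cone_measure (cball a r) \<le> emeasure lborel (\<Union>j\<le>n. cball ((real j * r) *\<^sub>R a) (2 * r))"
    by (subst emeasure_cone_measure) (auto intro!: emeasure_mono[OF sub])
  also have "\<dots> \<le> (\<Sum>j\<le>n. emeasure lborel (cball ((real j * r) *\<^sub>R a) (2 * r)))"
    by (rule emeasure_subadditive_finite) auto
  also have "\<dots> = ennreal (real (Suc n) * (?v * (2 * r) ^ DIM('a)))"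
    using r by (simp add: emeasure_cball ennreal_mult' ennreal_of_nat_eq_real_of_nat del: of_nat_Suc)
  also have "\<dots> \<le> ennreal (?v * 2 ^ Suc DIM('a) * r ^ (DIM('a) - 1))"
  proof (rule ennreal_leI)
    have D: "r ^ DIM('a) = r * r ^ (DIM('a) - 1)" by (metis DIM_positive Suc_diff_1 power_Suc)
    have "1 \<le> 1 / r" using r by simp
    then have "real (Suc n) \<le> 2 / r" using n by simp
    then have "real (Suc n) * (?v * (2 * r) ^ DIM('a)) \<le> 2 / r * (?v * (2 * r) ^ DIM('a))"
      using r by (intro mult_right_mono) auto
    also have "\<dots> = ?v * 2 ^ Suc DIM('a) * r ^ (DIM('a) - 1)"
      using r by (simp add: power_mult_distrib D field_simps)
    finally show "real (Suc n) * (?v * (2 * r) ^ DIM('a)) \<le> ?v * 2 ^ Suc DIM('a) * r ^ (DIM('a) - 1)" .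
  qed
  finally show ?thesis .
qed

lemma emeasure_cone_measure_sphere:
  "emeasure (cone_measure :: 'a::euclidean_space measure) (sphere 0 1) = ennreal (unit_ball_vol (real DIM('a)))"
proof -
  have "emeasure (cone_measure :: 'a measure) (sphere 0 1) = emeasure lborel (ball (0::'a) 1)"
  proof (subst emeasure_cone_measure, simp, rule emeasure_eq_AE)
    have "AE x in lborel. x \<noteq> (0::'a)" by (rule AE_lborel_singleton)
    then show "AE x in lborel. (x \<in> ball 0 1 \<inter> sgn -` sphere 0 1) = (x \<in> ball (0::'a) 1)"
      by eventually_elim (auto simp: norm_sgn)
  qed (use measurable_sets_borel[OF measurable_sgn, of "sphere 0 (1::real)"] in auto)
  then show ?thesis by (simp add: emeasure_ball)
qed

lemma finite_cone_measure: "emeasure (cone_measure :: 'a::euclidean_space measure) UNIV < \<infinity>"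
proof -
  have "emeasure (cone_measure :: 'a measure) UNIV = emeasure lborel (ball (0::'a) 1)"
    by (subst emeasure_cone_measure) auto
  then show ?thesis by (simp add: emeasure_ball)
qed

section \<open>Comparison of Hausdorff measure with the cone measure\<close>

text \<open>
  Each covering set lies in a cap whose cone measure is bounded by a multiple of its gauge, so a
  covering cannot have less total gauge than a fixed multiple of the cone measure of the sphere.
\<close>

lemma hausdorff_sphere_pos:
  assumes "2 \<le> DIM('a::euclidean_space)"
  shows "0 < hausdorff_outer (DIM('a) - 1) (sphere (0::'a) 1)"
proof -
  let ?d = "DIM('a) - 1" and ?v = "unit_ball_vol (real DIM('a))"
  have d: "1 \<le> ?d" using assms by simp
  define k where "k = ?v * 2 ^ Suc DIM('a)"
  have k: "0 < k" by (simp add: k_def)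
  have cap: "emeasure cone_measure (cball a D) \<le> ennreal (k * D ^ ?d)" if a: "norm a = 1" and D: "0 \<le> D" "D \<le> 1" for a :: 'a and D
  proof (cases "D = 0")
    case False
    then show ?thesis using cone_measure_cap_le[OF a, of D] D by (simp add: k_def)
  next
    case True
    have "emeasure cone_measure (cball a D) \<le> 0"
    proof (rule ennreal_le_epsilon)
      fix e :: real assume e: "0 < e"
      \<comment> \<open>a point has cone measure \<open>0\<close>, since the exponent \<open>N - 1\<close> is positive\<close>
      define r where "r = min 1 (e / k)"
      have r: "0 < r" "r \<le> 1" "k * r \<le> e" using e k by (auto simp: r_def min_def field_simps)
      have "emeasure cone_measure (cball a D) \<le> emeasure cone_measure (cball a r)"
        using True r by (intro emeasure_mono) auto
      also have "\<dots> \<le> ennreal (k * r ^ ?d)" using cone_measure_cap_le[OF a r(1,2)] by (simp add: k_def)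
      also have "\<dots> \<le> ennreal e"
      proof (rule ennreal_leI)
        have "r ^ ?d \<le> r ^ 1" using r d by (intro power_decreasing) auto
        then have "k * r ^ ?d \<le> k * r" using k by simp
        then show "k * r ^ ?d \<le> e" using r(3) by simp
      qed
      finally show "emeasure cone_measure (cball a D) \<le> 0 + ennreal e" by simp
    qed
    then show ?thesis by simp
  qed
  define c where "c = k * 2 ^ ?d / unit_ball_vol (real ?d)"
  have c: "0 < c" using k by (simp add: c_def)
  have gauge: "k * D ^ ?d = c * (unit_ball_vol (real ?d) * (D / 2) ^ ?d)" for D
  proof -
    have "unit_ball_vol (real ?d) \<noteq> 0" using unit_ball_vol_pos[of "real ?d"] by linarith
    then show ?thesis unfolding c_def by (simp add: power_divide)
  qed
  have "ennreal (?v / c) \<le> hausdorff_content ?d 1 (sphere (0::'a) 1)"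
    unfolding hausdorff_content_def
  proof (rule INF_greatest, clarify)
    fix C :: "nat \<Rightarrow> 'a set"
    assume cov: "sphere 0 1 \<subseteq> (\<Union>i. C i)" and C: "\<forall>i. bounded (C i) \<and> diameter (C i) \<le> 1"
    have "\<exists>B\<in>sets borel. C i \<inter> sphere 0 1 \<subseteq> B \<and> emeasure cone_measure B \<le> ennreal c * hausdorff_gauge ?d (C i)" for i
    proof (cases "C i \<inter> sphere 0 1 = {}")
      case True
      then show ?thesis by (intro bexI[of _ "{}"]) auto
    next
      case False
      then obtain a where a: "a \<in> C i" "norm a = 1" by auto
      have D0: "0 \<le> diameter (C i)" using C by (intro diameter_ge_0) auto
      have "C i \<subseteq> cball a (diameter (C i))"
      proof
        fix x assume "x \<in> C i"
        then have "dist a x \<le> diameter (C i)" using C a by (intro diameter_bounded_bound) auto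
        then show "x \<in> cball a (diameter (C i))" by simp
      qed
      moreover have "emeasure cone_measure (cball a (diameter (C i))) \<le> ennreal (k * diameter (C i) ^ ?d)"
        using C D0 by (intro cap a) auto
      moreover have "ennreal (k * diameter (C i) ^ ?d) = ennreal c * hausdorff_gauge ?d (C i)"
        using a c D0 unfolding gauge hausdorff_gauge_def by (auto intro!: ennreal_mult)
      ultimately show ?thesis by (intro bexI[of _ "cball a (diameter (C i))"]) auto
    qed
    then obtain B where B: "\<And>i. B i \<in> sets borel" "\<And>i. C i \<inter> sphere 0 1 \<subseteq> B i"
      "\<And>i. emeasure cone_measure (B i) \<le> ennreal c * hausdorff_gauge ?d (C i)" by metis
    have "ennreal ?v = emeasure cone_measure (sphere (0::'a) 1)" by (simp add: emeasure_cone_measure_sphere)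
    also have "\<dots> \<le> emeasure cone_measure (\<Union>i. B i)"
    proof (rule emeasure_mono)
      show "sphere 0 1 \<subseteq> (\<Union>i. B i)" using cov B(2) by blast
    qed (use B in auto)
    also have "\<dots> \<le> (\<Sum>i. emeasure cone_measure (B i))"
      using B by (intro emeasure_subadditive_countably) auto
    also have "\<dots> \<le> (\<Sum>i. ennreal c * hausdorff_gauge ?d (C i))"
      by (intro suminf_le B) auto
    also have "\<dots> = ennreal c * (\<Sum>i. hausdorff_gauge ?d (C i))" by simp
    finally have "ennreal (1 / c) * ennreal ?v \<le> ennreal (1 / c) * (ennreal c * (\<Sum>i. hausdorff_gauge ?d (C i)))"
      by (rule mult_left_mono) simp
    then show "ennreal (?v / c) \<le> (\<Sum>i. hausdorff_gauge ?d (C i))"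
      using c by (simp add: mult.assoc[symmetric] ennreal_mult[symmetric])
  qed
  also have "\<dots> \<le> hausdorff_outer ?d (sphere (0::'a) 1)" by (rule hausdorff_content_le_outer) simp
  finally have le: "ennreal (?v / c) \<le> hausdorff_outer ?d (sphere (0::'a) 1)" .
  have "0 < ?v / c" using c by (intro divide_pos_pos) auto
  then have "0 < ennreal (?v / c)" by (simp only: ennreal_less_zero_iff)
  then show ?thesis using le by (rule less_le_trans)
qed

text \<open>
  The gauge of a ball of radius \<open>5 r\<close>, divided by the lower bound for the cone measure of a cap of
  radius \<open>r\<close>.
\<close>

definition sphere_constant :: "'a::euclidean_space itself \<Rightarrow> real" where
  "sphere_constant _ = unit_ball_vol (real (DIM('a) - 1)) * 5 ^ (DIM('a) - 1) * (2 * 4 ^ DIM('a)) / unit_ball_vol (real DIM('a))"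

text \<open>
  Vitali's covering lemma provides disjoint small caps inside \<open>U\<close> whose fivefold enlargements cover
  \<open>A\<close>. The gauges of the enlargements are bounded by the cone measures of the disjoint caps.
\<close>

lemma hausdorff_content_le_cone_measure:
  fixes A U :: "'a::euclidean_space set"
  assumes A: "A \<subseteq> sphere 0 1" and U: "open U" "A \<subseteq> U" and \<delta>: "0 < \<delta>"
  shows "hausdorff_content (DIM('a) - 1) \<delta> A \<le> ennreal (sphere_constant TYPE('a)) * emeasure cone_measure U"
proof -
  let ?d = "DIM('a) - 1" and ?v = "unit_ball_vol (real DIM('a))" and ?c = "sphere_constant TYPE('a)"
  have v: "0 < ?v" by simp
  have c: "0 < ?c" by (simp add: sphere_constant_def)
  have "\<exists>r. 0 < r \<and> r \<le> min 1 (\<delta> / 10) \<and> cball x r \<subseteq> U" if "x \<in> A" for x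
  proof -
    obtain e where "0 < e" "cball x e \<subseteq> U" using U \<open>x \<in> A\<close> open_contains_cball by blast
    then show ?thesis using \<delta> by (intro exI[of _ "min e (min 1 (\<delta> / 10))"]) auto
  qed
  then obtain r where r: "\<And>x. x \<in> A \<Longrightarrow> 0 < r x" "\<And>x. x \<in> A \<Longrightarrow> r x \<le> min 1 (\<delta> / 10)" "\<And>x. x \<in> A \<Longrightarrow> cball x (r x) \<subseteq> U"
    by metis
  have cov0: "A \<subseteq> (\<Union>x\<in>A. cball x (r x))" using r(1) by force
  obtain C where C: "countable C" "C \<subseteq> A" "pairwise (\<lambda>i j. disjnt (cball i (r i)) (cball j (r j))) C"
    "A \<subseteq> (\<Union>x\<in>C. cball x (5 * r x))"
    by (rule Vitali_covering_lemma_cballs[OF cov0, of 1]) (use r in auto)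
  \<comment> \<open>an enumeration of \<open>C\<close> without repetitions; all other indices get the empty set, of gauge \<open>0\<close>\<close>
  define ix where "ix i = (if i \<in> to_nat_on C ` C then Some (from_nat_into C i) else None)" for i
  have ix: "x \<in> C" "to_nat_on C x = i" if "ix i = Some x" for i x
    using that C(1) by (auto simp: ix_def split: if_splits)
  have ix_to: "ix (to_nat_on C x) = Some x" if "x \<in> C" for x using that C(1) by (simp add: ix_def)
  define B where "B i = (case ix i of None \<Rightarrow> {} | Some x \<Rightarrow> cball x (r x))" for i
  define E where "E i = (case ix i of None \<Rightarrow> {} | Some x \<Rightarrow> cball x (5 * r x))" for i
  have "hausdorff_content ?d \<delta> A \<le> (\<Sum>i. hausdorff_gauge ?d (E i))"
  proof (rule hausdorff_content_le_sum)
    show "A \<subseteq> (\<Union>i. E i)"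
    proof
      fix y assume "y \<in> A"
      then obtain x where "x \<in> C" "y \<in> cball x (5 * r x)" using C(4) by auto
      then have "y \<in> E (to_nat_on C x)" by (simp add: E_def ix_to)
      then show "y \<in> (\<Union>i. E i)" by blast
    qed
    show "bounded (E i)" for i by (auto simp: E_def split: option.split)
    show "diameter (E i) \<le> \<delta>" for i
    proof (cases "ix i")
      case (Some x)
      then have "x \<in> A" using ix C(2) by blast
      then show ?thesis using Some r[of x] by (auto simp: E_def)
    qed (use \<delta> in \<open>simp add: E_def\<close>)
  qed
  also have "\<dots> \<le> (\<Sum>i. ennreal ?c * emeasure cone_measure (B i))"
  proof (intro suminf_le)
    fix i
    show "hausdorff_gauge ?d (E i) \<le> ennreal ?c * emeasure cone_measure (B i)"
    proof (cases "ix i")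
      case (Some x)
      then have x: "x \<in> A" using ix C(2) by blast
      then have nx: "norm x = 1" using A by auto
      have "hausdorff_gauge ?d (E i) = ennreal (unit_ball_vol (real ?d) * (5 * r x) ^ ?d)"
        using Some r(1)[OF x] by (auto simp: E_def hausdorff_gauge_def)
      also have "unit_ball_vol (real ?d) * (5 * r x) ^ ?d = ?c * (?v / (2 * 4 ^ DIM('a)) * r x ^ ?d)"
      proof -
        have "?v \<noteq> 0" using v by linarith
        then show ?thesis by (simp add: sphere_constant_def power_mult_distrib)
      qed
      also have "ennreal \<dots> = ennreal ?c * ennreal (?v / (2 * 4 ^ DIM('a)) * r x ^ ?d)"
        using c r(1)[OF x] by (intro ennreal_mult) auto
      also have "\<dots> \<le> ennreal ?c * emeasure cone_measure (cball x (r x))"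
        using r(1,2)[OF x] by (intro mult_left_mono cone_measure_cap_ge nx) auto
      finally show ?thesis using Some by (simp add: B_def)
    qed (simp add: E_def hausdorff_gauge_def)
  qed auto
  also have "\<dots> = ennreal ?c * (\<Sum>i. emeasure cone_measure (B i))" by simp
  also have "(\<Sum>i. emeasure cone_measure (B i)) = emeasure cone_measure (\<Union>i. B i)"
  proof (rule suminf_emeasure)
    show "range B \<subseteq> sets cone_measure" by (auto simp: B_def split: option.split)
    show "disjoint_family B"
      unfolding disjoint_family_on_def
    proof (intro ballI impI)
      fix i j :: nat assume ij: "i \<noteq> j"
      show "B i \<inter> B j = {}"
      proof (cases "ix i"; cases "ix j")
        fix x y assume xy: "ix i = Some x" "ix j = Some y"
        have "x \<in> C" "y \<in> C" using ix(1) xy by blast+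
        moreover have "x \<noteq> y" using ix(2)[OF xy(1)] ix(2)[OF xy(2)] ij by blast
        ultimately have "disjnt (cball x (r x)) (cball y (r y))" using C(3) by (auto simp: pairwise_def)
        then show ?thesis using xy by (simp add: B_def disjnt_def)
      qed (auto simp: B_def)
    qed
  qed
  also have "\<dots> \<le> emeasure cone_measure U"
  proof (rule emeasure_mono)
    show "(\<Union>i. B i) \<subseteq> U"
    proof (rule UN_least)
      fix i show "B i \<subseteq> U"
      proof (cases "ix i")
        case (Some x)
        then have "x \<in> A" using ix C(2) by blast
        then show ?thesis using Some r(3) by (simp add: B_def)
      qed (simp add: B_def)
    qed
  qed (use U in auto)
  finally show ?thesis by (simp add: mult_left_mono)
qed

text \<open>
  By outer regularity of the finite cone measure, the open set \<open>U\<close> of the content estimate can be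
  shrunk to \<open>A\<close>.
\<close>

lemma hausdorff_le_cone_measure:
  fixes A :: "'a::euclidean_space set"
  assumes A: "A \<subseteq> sphere 0 1" and [measurable]: "A \<in> sets borel"
  shows "hausdorff_outer (DIM('a) - 1) A \<le> ennreal (sphere_constant TYPE('a)) * emeasure cone_measure A"
proof -
  let ?c = "sphere_constant TYPE('a)"
  have c: "0 < ?c" by (simp add: sphere_constant_def)
  have eq: "emeasure cone_measure A = (INF U \<in> {U. A \<subseteq> U \<and> open U}. emeasure cone_measure U)"
    by (rule outer_regular) (use finite_cone_measure[where 'a = 'a] in \<open>auto simp: cone_measure_def\<close>)
  have le: "ennreal (1 / ?c) * hausdorff_outer (DIM('a) - 1) A \<le> emeasure cone_measure A"
    unfolding eq
  proof (rule INF_greatest, clarify)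
    fix U assume "A \<subseteq> U" "open U"
    then have "hausdorff_outer (DIM('a) - 1) A \<le> ennreal ?c * emeasure cone_measure U"
      unfolding hausdorff_outer_def
      by (intro SUP_least hausdorff_content_le_cone_measure A) auto
    then have "ennreal (1 / ?c) * hausdorff_outer (DIM('a) - 1) A \<le> ennreal (1 / ?c) * (ennreal ?c * emeasure cone_measure U)"
      by (rule mult_left_mono) simp
    then show "ennreal (1 / ?c) * hausdorff_outer (DIM('a) - 1) A \<le> emeasure cone_measure U"
      using c by (simp add: mult.assoc[symmetric] ennreal_mult[symmetric])
  qed
  have "ennreal ?c * (ennreal (1 / ?c) * hausdorff_outer (DIM('a) - 1) A) \<le> ennreal ?c * emeasure cone_measure A"
    using le by (rule mult_left_mono) simp
  then show ?thesis using c by (simp add: mult.assoc[symmetric] ennreal_mult[symmetric])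
qed

lemma nn_integral_sphere_le_cone:
  fixes g :: "'a::euclidean_space \<Rightarrow> ennreal"
  assumes [measurable]: "g \<in> borel_measurable borel"
  shows "(\<integral>\<^sup>+\<xi>\<in>sphere 0 1. g \<xi> \<partial>hausdorff_measure (DIM('a) - 1))
    \<le> ennreal (sphere_constant TYPE('a)) * (\<integral>\<^sup>+x\<in>ball 0 1. g (sgn x) \<partial>lborel)"
proof -
  let ?H = "hausdorff_measure (DIM('a) - 1) :: 'a measure" and ?c = "ennreal (sphere_constant TYPE('a))"
  have [measurable]: "sphere (0::'a) 1 \<in> sets borel" by simp
  have "(\<integral>\<^sup>+\<xi>\<in>sphere 0 1. g \<xi> \<partial>?H) = (\<integral>\<^sup>+\<xi>. g \<xi> \<partial>density ?H (indicator (sphere 0 1)))"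
    by (subst nn_integral_density) (auto simp: mult.commute)
  also have "\<dots> \<le> (\<integral>\<^sup>+\<xi>. g \<xi> \<partial>scale_measure ?c cone_measure)"
  proof (rule nn_integral_mono_measure)
    show "sets (density ?H (indicator (sphere 0 1))) = sets (scale_measure ?c cone_measure)" by simp
    have "emeasure (density ?H (indicator (sphere 0 1))) A \<le> emeasure (scale_measure ?c cone_measure) A"
      if A[measurable]: "A \<in> sets borel" for A
    proof -
      have "emeasure (density ?H (indicator (sphere 0 1))) A = emeasure ?H (sphere 0 1 \<inter> A)"
        by (subst emeasure_density) (auto simp: indicator_inter_arith[symmetric])
      also have "\<dots> = hausdorff_outer (DIM('a) - 1) (sphere 0 1 \<inter> A)" by (simp add: emeasure_hausdorff_measure)
      also have "\<dots> \<le> ?c * emeasure cone_measure (sphere 0 1 \<inter> A)" by (rule hausdorff_le_cone_measure) auto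
      also have "\<dots> \<le> ?c * emeasure cone_measure A" by (intro mult_left_mono emeasure_mono) auto
      finally show ?thesis by simp
    qed
    then have *: "emeasure (density ?H (indicator (sphere 0 1))) A \<le> emeasure (scale_measure ?c cone_measure) A" for A
      by (cases "A \<in> sets borel") (auto simp: emeasure_notin_sets)
    show "density ?H (indicator (sphere 0 1)) \<le> scale_measure ?c cone_measure"
    proof (subst le_measure_iff)
      have "space ?H = UNIV" "space (cone_measure :: 'a measure) = UNIV"
        using sets_eq_imp_space_eq[of ?H borel] sets_eq_imp_space_eq[of "cone_measure :: 'a measure" borel] by simp_all
      with * show "if space (density ?H (indicator (sphere 0 1))) = space (scale_measure ?c cone_measure)
        then if sets (density ?H (indicator (sphere 0 1))) = sets (scale_measure ?c cone_measure)
          then emeasure (density ?H (indicator (sphere 0 1))) \<le> emeasure (scale_measure ?c cone_measure)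
          else sets (density ?H (indicator (sphere 0 1))) \<subseteq> sets (scale_measure ?c cone_measure)
        else space (density ?H (indicator (sphere 0 1))) \<subseteq> space (scale_measure ?c cone_measure)"
        by (simp add: le_fun_def space_scale_measure)
    qed
  qed
  also have "\<dots> = ?c * (\<integral>\<^sup>+x\<in>ball 0 1. g (sgn x) \<partial>lborel)"
    by (simp add: nn_integral_scale_measure nn_integral_cone_measure)
  finally show ?thesis .
qed

section \<open>Polar coordinates for homogeneous functions\<close>

lemma epowr_cmult_ennreal:
  assumes "0 < c" "b \<noteq> 0"
  shows "epowr (ennreal c * y) b = ennreal (c powr b) * epowr y b"
proof (cases y)
  case (real r)
  have c: "ennreal c * ennreal r = ennreal (c * r)" using assms real by (simp add: ennreal_mult)
  show ?thesis
  proof (cases "r = 0")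
    case True then show ?thesis using assms real by (auto simp: epowr_def ennreal_mult_top)
  next
    case False
    then have r: "0 < r" using real by simp
    have "epowr (ennreal c * y) b = ennreal ((c * r) powr b)"
      using assms r real by (simp add: epowr_def c)
    also have "(c * r) powr b = c powr b * r powr b" using assms r by (simp add: powr_mult)
    also have "ennreal \<dots> = ennreal (c powr b) * ennreal (r powr b)" by (rule ennreal_mult) auto
    also have "ennreal (r powr b) = epowr y b" using assms r real by (simp add: epowr_def)
    finally show ?thesis .
  qed
next
  case top
  have "ennreal c * top = top" using assms by (simp add: ennreal_mult_top)
  moreover have "ennreal (c powr b) * top = top" using assms by (simp add: ennreal_mult_top)
  ultimately show ?thesis using assms top by (simp add: epowr_def)
qed

lemma epowr_neg_antimono:
  assumes "x \<le> y" "b < 0" shows "epowr y b \<le> epowr x b"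
proof (cases "x = 0 \<or> y = top")
  case True then show ?thesis using assms by (auto simp: epowr_def top_unique)
next
  case False
  then obtain u v where "x = ennreal u" "y = ennreal v" "0 < u" "0 \<le> v" using assms(1)
    by (cases x; cases y) (auto simp: top_unique less_le)
  moreover have "u \<le> v" using calculation assms(1) by simp
  ultimately show ?thesis using assms(2)
    by (auto simp: epowr_def intro!: ennreal_leI powr_mono2')
qed

lemma epowr_neg_le_radial_integral:
  assumes "0 < a" "0 < N"
  shows "epowr y (- N / a) \<le> (\<integral>\<^sup>+u\<in>{0<..}. ennreal (N * u powr (N - 1)) * indicator {u. ennreal (u powr a) * y \<le> 1} u \<partial>lborel)"
proof (cases y)
  case (real r)
  show ?thesis
  proof (cases "r = 0")
    case True
    have "top = epowr top N" using assms by simp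
    also have "\<dots> = (\<integral>\<^sup>+l. ennreal (N * l powr (N - 1)) * indicator {l. 0 < l \<and> ennreal l < top} l \<partial>lborel)"
      by (rule epowr_layer_cake[symmetric]) fact
    also have "\<dots> \<le> (\<integral>\<^sup>+u\<in>{0<..}. ennreal (N * u powr (N - 1)) * indicator {u. ennreal (u powr a) * y \<le> 1} u \<partial>lborel)"
      using True real by (intro nn_integral_mono) (auto split: split_indicator)
    finally show ?thesis by (simp add: top_unique)
  next
    case False
    then have r: "0 < r" using real by simp
    let ?R = "r powr (- 1 / a)"
    have "epowr y (- N / a) = ennreal (?R powr N)"
    proof -
      have "- N / a \<noteq> 0" using assms by simp
      then show ?thesis using r real by (simp add: epowr_def powr_powr)
    qed
    also have "\<dots> = (\<integral>\<^sup>+l\<in>{0<..<?R}. ennreal (N * l powr (N - 1)) \<partial>lborel)"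
      using assms by (intro nn_integral_powr_below[symmetric]) auto
    also have "\<dots> \<le> (\<integral>\<^sup>+u\<in>{0<..}. ennreal (N * u powr (N - 1)) * indicator {u. ennreal (u powr a) * y \<le> 1} u \<partial>lborel)"
    proof (rule nn_integral_mono)
      fix u
      have "ennreal (u powr a) * y \<le> 1" if u: "0 < u" "u < ?R"
      proof -
        have "u powr a \<le> ?R powr a" using u assms by (intro powr_mono2) auto
        also have "\<dots> = r powr (- 1)" using assms by (simp add: powr_powr)
        also have "\<dots> = 1 / r" using r by (simp add: powr_minus_divide)
        finally have "u powr a * r \<le> 1" using r by (simp add: field_simps)
        then have "ennreal (u powr a * r) \<le> ennreal 1" by (rule ennreal_leI)
        then show ?thesis using real r by (simp add: ennreal_mult)
      qed
      then show "ennreal (N * u powr (N - 1)) * indicator {0<..<?R} u \<le>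
        ennreal (N * u powr (N - 1)) * indicator {u. ennreal (u powr a) * y \<le> 1} u * indicator {0<..} u"
        by (auto split: split_indicator)
    qed
    finally show ?thesis .
  qed
next
  case top
  have "- N / a < 0" using assms by (simp add: divide_neg_pos)
  then show ?thesis using top by (auto simp: epowr_def)
qed

lemma radial_tail_integral:
  assumes "0 < r" "0 < N"
  shows "(\<integral>\<^sup>+u\<in>{r..}. ennreal (N * u powr (- N - 1)) \<partial>lborel) = ennreal (r powr (- N))"
proof -
  have "(\<integral>\<^sup>+u. ennreal (N * u powr (- N - 1)) * indicator {r..} u \<partial>lborel) = ennreal (0 - - (r powr (- N)))"
  proof (rule nn_integral_FTC_atLeast)
    show "((\<lambda>u. - (u powr (- N))) has_real_derivative N * u powr (- N - 1)) (at u)" if "r \<le> u" for u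
      using that assms by (auto intro!: derivative_eq_intros)
    show "((\<lambda>u. - (u powr (- N))) \<longlongrightarrow> 0) at_top"
      using tendsto_minus[OF tendsto_neg_powr[of "- N" "\<lambda>u. u" at_top]] assms by (simp add: filterlim_ident)
  qed (use assms in auto)
  then show ?thesis by simp
qed

text \<open>
  Polar coordinates, obtained from dilations and Tonelli's theorem alone: \<open>I x\<close> to the power \<open>- N / a\<close> is
  the radial integral over those \<open>u\<close> for which \<open>u x\<close> lies in the set \<open>{I \<le> 1}\<close>. After exchanging the
  integrals and substituting \<open>y = u x\<close>, the integral in \<open>u\<close> runs over \<open>u \<ge> norm y\<close> and
  cancels the factor \<open>norm y\<close> to the power \<open>N\<close>.
\<close>

lemma cone_integral_le_unit_set:
  fixes I :: "'a::euclidean_space \<Rightarrow> ennreal"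
  defines "N \<equiv> real DIM('a)"
  assumes [measurable]: "I \<in> borel_measurable borel" and a: "0 < a"
    and hom: "\<And>t x. 0 < t \<Longrightarrow> I (t *\<^sub>R x) = ennreal (t powr a) * I x"
  shows "(\<integral>\<^sup>+x\<in>ball 0 1. epowr (I (sgn x)) (- N / a) \<partial>lborel) \<le> emeasure lborel {x. I x \<le> 1}"
proof -
  have N: "0 < N" by (simp add: N_def)
  have b: "- N / a \<noteq> 0" using N a by simp
  let ?B = "indicator (ball (0::'a) 1) :: 'a \<Rightarrow> ennreal" and ?S = "indicator {x. I x \<le> 1} :: 'a \<Rightarrow> ennreal"
  let ?w = "\<lambda>u. ennreal (N * u powr (N - 1)) * indicator {0<..} u"
  have "(\<integral>\<^sup>+x. epowr (I (sgn x)) (- N / a) * ?B x \<partial>lborel) \<le>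
      (\<integral>\<^sup>+x. \<integral>\<^sup>+u. ?w u * (?B x * ennreal (norm x powr N) * ?S (u *\<^sub>R x)) \<partial>lborel \<partial>lborel)"
  proof (rule nn_integral_mono_AE)
    have "AE x in lborel. x \<noteq> (0::'a)" by (rule AE_lborel_singleton)
    then show "AE x in lborel. epowr (I (sgn x)) (- N / a) * ?B x \<le>
      (\<integral>\<^sup>+u. ?w u * (?B x * ennreal (norm x powr N) * ?S (u *\<^sub>R x)) \<partial>lborel)"
    proof eventually_elim
      case (elim x)
      have "I (sgn x) = ennreal ((1 / norm x) powr a) * I x"
        using hom[of "1 / norm x" x] elim by (simp add: sgn_div_norm inverse_eq_divide)
      then have "epowr (I (sgn x)) (- N / a) = ennreal (((1 / norm x) powr a) powr (- N / a)) * epowr (I x) (- N / a)"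
        using elim b by (simp add: epowr_cmult_ennreal)
      also have "((1 / norm x) powr a) powr (- N / a) = norm x powr N"
        using elim a by (simp add: powr_powr powr_divide powr_minus)
      finally have "epowr (I (sgn x)) (- N / a) * ?B x = (?B x * ennreal (norm x powr N)) * epowr (I x) (- N / a)"
        by (simp add: mult_ac)
      also have "\<dots> \<le> (?B x * ennreal (norm x powr N)) *
          (\<integral>\<^sup>+u\<in>{0<..}. ennreal (N * u powr (N - 1)) * indicator {u. ennreal (u powr a) * I x \<le> 1} u \<partial>lborel)"
        by (intro mult_left_mono epowr_neg_le_radial_integral a N) simp
      also have "\<dots> = (\<integral>\<^sup>+u. (?B x * ennreal (norm x powr N)) *
          (ennreal (N * u powr (N - 1)) * indicator {u. ennreal (u powr a) * I x \<le> 1} u * indicator {0<..} u) \<partial>lborel)"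
        by (rule nn_integral_cmult[symmetric]) measurable
      also have "\<dots> = (\<integral>\<^sup>+u. ?w u * (?B x * ennreal (norm x powr N) * ?S (u *\<^sub>R x)) \<partial>lborel)"
        by (intro nn_integral_cong) (auto simp: hom mult_ac split: split_indicator)
      finally show ?case .
    qed
  qed
  also have "\<dots> = (\<integral>\<^sup>+u. \<integral>\<^sup>+x. ?w u * (?B x * ennreal (norm x powr N) * ?S (u *\<^sub>R x)) \<partial>lborel \<partial>lborel)"
    by (rule lborel_pair.Fubini') (simp only: case_prod_beta', measurable)
  also have "\<dots> \<le> (\<integral>\<^sup>+u. \<integral>\<^sup>+y. ennreal (N * u powr (- N - 1)) * (if norm y \<le> u then 1 else 0) * (ennreal (norm y powr N) * ?S y) * indicator {0<..} u \<partial>lborel \<partial>lborel)"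
  proof (rule nn_integral_mono)
    fix u :: real
    show "(\<integral>\<^sup>+x. ?w u * (?B x * ennreal (norm x powr N) * ?S (u *\<^sub>R x)) \<partial>lborel) \<le>
      (\<integral>\<^sup>+y. ennreal (N * u powr (- N - 1)) * (if norm y \<le> u then 1 else 0) * (ennreal (norm y powr N) * ?S y) * indicator {0<..} u \<partial>lborel)"
    proof (cases "0 < u")
      case u: True
      define F where "F y = ennreal (N * u powr (N - 1)) * ((if norm y \<le> u then 1 else 0) * ennreal ((norm y / u) powr N) * ?S y)" for y :: 'a
      have [measurable]: "F \<in> borel_measurable borel" unfolding F_def by measurable
      have "(\<integral>\<^sup>+x. ?w u * (?B x * ennreal (norm x powr N) * ?S (u *\<^sub>R x)) \<partial>lborel) \<le> (\<integral>\<^sup>+x. F (0 + u *\<^sub>R x) \<partial>lborel)"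
        using u by (intro nn_integral_mono) (auto simp: F_def mult_left_le split: split_indicator)
      also have "\<dots> = ennreal (1 / u ^ DIM('a)) * (\<integral>\<^sup>+y. F y \<partial>lborel)"
        using u by (intro nn_integral_lborel_affine) auto
      also have "\<dots> = (\<integral>\<^sup>+y. ennreal (1 / u ^ DIM('a)) * F y \<partial>lborel)" by (rule nn_integral_cmult[symmetric]) simp
      also have "\<dots> = (\<integral>\<^sup>+y. ennreal (N * u powr (- N - 1)) * (if norm y \<le> u then 1 else 0) * (ennreal (norm y powr N) * ?S y) * indicator {0<..} u \<partial>lborel)"
      proof (rule nn_integral_cong)
        fix y :: 'a
        have "1 / u ^ DIM('a) * (N * u powr (N - 1)) * (norm y / u) powr N = N * u powr (- N - 1) * norm y powr N"
        proof -
          have "u ^ DIM('a) = u powr N" using u by (simp add: N_def powr_realpow)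
          then show ?thesis using u by (simp add: powr_divide powr_diff powr_minus field_simps)
        qed
        then have "ennreal (1 / u ^ DIM('a)) * ennreal (N * u powr (N - 1)) * ennreal ((norm y / u) powr N) =
            ennreal (N * u powr (- N - 1)) * ennreal (norm y powr N)"
          using u N by (simp add: ennreal_mult[symmetric])
        then show "ennreal (1 / u ^ DIM('a)) * F y = ennreal (N * u powr (- N - 1)) * (if norm y \<le> u then 1 else 0) * (ennreal (norm y powr N) * ?S y) * indicator {0<..} u"
          using u unfolding F_def by (auto simp: mult.assoc split: split_indicator)
      qed
      finally show ?thesis .
    qed simp
  qed
  also have "\<dots> = (\<integral>\<^sup>+y. \<integral>\<^sup>+u. ennreal (N * u powr (- N - 1)) * (if norm y \<le> u then 1 else 0) * (ennreal (norm y powr N) * ?S y) * indicator {0<..} u \<partial>lborel \<partial>lborel)"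
    by (rule lborel_pair.Fubini'[symmetric]) (simp only: case_prod_beta', measurable)
  also have "\<dots> \<le> (\<integral>\<^sup>+y. ?S y \<partial>lborel)"
  proof (rule nn_integral_mono_AE)
    have "AE y in lborel. y \<noteq> (0::'a)" by (rule AE_lborel_singleton)
    then show "AE y in lborel. (\<integral>\<^sup>+u. ennreal (N * u powr (- N - 1)) * (if norm y \<le> u then 1 else 0) * (ennreal (norm y powr N) * ?S y) * indicator {0<..} u \<partial>lborel) \<le> ?S y"
    proof eventually_elim
      case (elim y)
      have "(\<integral>\<^sup>+u. ennreal (N * u powr (- N - 1)) * (if norm y \<le> u then 1 else 0) * (ennreal (norm y powr N) * ?S y) * indicator {0<..} u \<partial>lborel)
        \<le> (\<integral>\<^sup>+u. (ennreal (N * u powr (- N - 1)) * indicator {norm y..} u) * (ennreal (norm y powr N) * ?S y) \<partial>lborel)"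
        by (intro nn_integral_mono) (auto split: split_indicator)
      also have "\<dots> = ennreal (norm y powr (- N)) * (ennreal (norm y powr N) * ?S y)"
        using radial_tail_integral[of "norm y" N] elim N by (subst nn_integral_multc) auto
      also have "\<dots> = ?S y"
        using elim by (simp add: mult.assoc[symmetric] ennreal_mult[symmetric] powr_add[symmetric])
      finally show ?case .
    qed
  qed
  also have "\<dots> = emeasure lborel {x. I x \<le> 1}" by simp
  finally show ?thesis .
qed

text \<open>
  The unit set may a priori have infinite volume; its bounded parts exhaust it.
\<close>

lemma unit_set_measure_bound:
  fixes I :: "'a::euclidean_space \<Rightarrow> ennreal"
  assumes [measurable]: "I \<in> borel_measurable borel"
    and e: "0 < e" and A: "0 < A'" and K: "0 < K"
    and bd: "\<And>R V. 0 < V \<Longrightarrow> emeasure lborel ({x. I x \<le> 1} \<inter> cball 0 R) = ennreal V \<Longrightarrow> V powr e * A' \<le> K"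
  shows "emeasure lborel {x. I x \<le> 1} \<le> ennreal ((K / A') powr (1 / e))"
proof -
  let ?S = "\<lambda>n::nat. {x. I x \<le> 1} \<inter> cball 0 (real n)"
  have "{x. I x \<le> 1} = (\<Union>n. ?S n)"
    by (auto intro: real_arch_simple)
  moreover have "incseq ?S" unfolding incseq_def by auto
  ultimately have "emeasure lborel {x. I x \<le> 1} = (SUP n. emeasure lborel (?S n))"
    by (subst SUP_emeasure_incseq) auto
  also have "\<dots> \<le> ennreal ((K / A') powr (1 / e))"
  proof (rule SUP_least)
    fix n :: nat
    have "emeasure lborel (?S n) \<le> emeasure lborel (cball (0::'a) (real n))" by (intro emeasure_mono) auto
    also have "\<dots> < \<infinity>" by (rule emeasure_lborel_cball_finite)
    finally have fin: "emeasure lborel (?S n) < top" by simp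
    define V where "V = enn2real (emeasure lborel (?S n))"
    have V: "emeasure lborel (?S n) = ennreal V" "0 \<le> V" using fin by (auto simp: V_def)
    show "emeasure lborel (?S n) \<le> ennreal ((K / A') powr (1 / e))"
    proof (cases "V = 0")
      case False
      then have V0: "0 < V" using V by simp
      have "V powr e \<le> K / A'" using bd[OF V0 V(1)] A by (simp add: field_simps)
      then have "(V powr e) powr (1 / e) \<le> (K / A') powr (1 / e)" using e by (intro powr_mono2) auto
      then have "V \<le> (K / A') powr (1 / e)" using V0 e by (simp add: powr_powr)
      then show ?thesis using V by (simp add: ennreal_leI)
    qed (use V in simp)
  qed
  finally show ?thesis .
qed

section \<open>The affine Sobolev inequality\<close>

definition affine_constant :: "real \<Rightarrow> real \<Rightarrow> 'a::euclidean_space itself \<Rightarrow> real \<Rightarrow> real" where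
  "affine_constant s p T K =
     (let N = real DIM('a); \<sigma> = measure (hausdorff_measure (DIM('a) - 1) :: 'a measure) (sphere 0 1)
      in sphere_constant TYPE('a) powr (s / N) * K powr (1 / p) / \<sigma> powr ((N + s * p) / (N * p)))"

lemma hausdorff_sphere_measure:
  assumes "2 \<le> DIM('a::euclidean_space)"
  shows "emeasure (hausdorff_measure (DIM('a) - 1) :: 'a measure) (sphere 0 1)
      = ennreal (measure (hausdorff_measure (DIM('a) - 1) :: 'a measure) (sphere 0 1))"
    "0 < measure (hausdorff_measure (DIM('a) - 1) :: 'a measure) (sphere 0 1)"
proof -
  let ?H = "hausdorff_measure (DIM('a) - 1) :: 'a measure"
  have eq: "emeasure ?H (sphere 0 1) = hausdorff_outer (DIM('a) - 1) (sphere (0::'a) 1)"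
    by (rule emeasure_hausdorff_measure) simp
  have "hausdorff_outer (DIM('a) - 1) (sphere (0::'a) 1) \<le> ennreal (sphere_constant TYPE('a)) * emeasure cone_measure (sphere (0::'a) 1)"
    by (rule hausdorff_le_cone_measure) auto
  also have "\<dots> < top" by (simp add: emeasure_cone_measure_sphere ennreal_mult_less_top)
  finally have fin: "emeasure ?H (sphere 0 1) \<noteq> top" unfolding eq by simp
  then show e: "emeasure ?H (sphere 0 1) = ennreal (measure ?H (sphere 0 1))" by (rule emeasure_eq_ennreal_measure)
  have "0 < emeasure ?H (sphere 0 1)" unfolding eq by (rule hausdorff_sphere_pos[OF assms])
  then show "0 < measure ?H (sphere 0 1)" unfolding e by simp
qed

text \<open>
  The assumption bounds the volume of the unit set of \<open>I\<close>, polar coordinates bound the integral over the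
  sphere by this volume, and the affine energy contains a negative power of that integral. The exponents match
  because \<open>1 / q = (1 - s p / N) / p\<close>.
\<close>

lemma affine_energy_lower_bound:
  fixes I :: "'a::euclidean_space \<Rightarrow> ennreal" and s p K A q :: real
  defines "N \<equiv> real DIM('a)"
  assumes dim: "2 \<le> DIM('a)" and Im[measurable]: "I \<in> borel_measurable borel"
    and s: "0 < s" and p: "1 \<le> p" and sp: "s * p < N" and q: "q = N * p / (N - s * p)"
    and hom: "\<And>t x. 0 < t \<Longrightarrow> I (t *\<^sub>R x) = ennreal (t powr (s * p)) * I x"
    and A: "0 < A" and K: "0 < K"
    and bd: "\<And>R V. 0 < V \<Longrightarrow> emeasure lborel ({x. I x \<le> 1} \<inter> cball 0 R) = ennreal V \<Longrightarrow>
        V powr (s * p / N) * A powr (1 - s * p / N) \<le> K"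
  shows "ennreal (A powr (1 / q)) \<le> ennreal (affine_constant s p TYPE('a) K) *
    (epowr (emeasure (hausdorff_measure (DIM('a) - 1) :: 'a measure) (sphere 0 1)) ((N + s * p) / (N * p))
     * epowr (\<integral>\<^sup>+\<xi>\<in>sphere 0 1. epowr (I \<xi>) (- N / (s * p)) \<partial>hausdorff_measure (DIM('a) - 1)) (- s / N))"
proof -
  let ?H = "hausdorff_measure (DIM('a) - 1) :: 'a measure" and ?c = "sphere_constant TYPE('a)"
  define a where "a = s * p"
  have a: "0 < a" "a < N" using s p sp by (auto simp: a_def)
  have N: "0 < N" by (simp add: N_def)
  have c: "0 < ?c" by (simp add: sphere_constant_def)
  define A' where "A' = A powr (1 - a / N)"
  have A': "0 < A'" using A by (simp add: A'_def)
  define W where "W = ?c * (K / A') powr (N / a)"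
  have W: "0 < W" using c K A' by (simp add: W_def)
  define \<sigma> where "\<sigma> = measure ?H (sphere 0 1)"
  have \<sigma>: "emeasure ?H (sphere 0 1) = ennreal \<sigma>" "0 < \<sigma>"
    using hausdorff_sphere_measure[OF dim] by (auto simp: \<sigma>_def)
  have "(\<integral>\<^sup>+\<xi>\<in>sphere 0 1. epowr (I \<xi>) (- N / a) \<partial>?H)
      \<le> ennreal ?c * (\<integral>\<^sup>+x\<in>ball 0 1. epowr (I (sgn x)) (- N / a) \<partial>lborel)"
    by (rule nn_integral_sphere_le_cone) measurable
  also have "(\<integral>\<^sup>+x\<in>ball 0 1. epowr (I (sgn x)) (- N / a) \<partial>lborel) \<le> emeasure lborel {x. I x \<le> 1}"
    unfolding N_def by (rule cone_integral_le_unit_set[OF Im a(1)]) (simp add: hom a_def)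
  also have "\<dots> \<le> ennreal ((K / A') powr (1 / (a / N)))"
    by (rule unit_set_measure_bound[OF Im _ A' K]) (use a N bd in \<open>auto simp: A'_def a_def\<close>)
  also have "1 / (a / N) = N / a" by simp
  also have "ennreal ?c * ennreal ((K / A') powr (N / a)) = ennreal W"
    using c by (simp add: W_def ennreal_mult)
  finally have J: "(\<integral>\<^sup>+\<xi>\<in>sphere 0 1. epowr (I \<xi>) (- N / a) \<partial>?H) \<le> ennreal W"
    by (simp add: mult_left_mono)
  define J where "J = (\<integral>\<^sup>+\<xi>\<in>sphere 0 1. epowr (I \<xi>) (- N / a) \<partial>?H)"
  have sN: "- s / N < 0" using s N by (simp add: divide_neg_pos)
  have "epowr (ennreal W) (- s / N) \<le> epowr J (- s / N)"
    using J sN unfolding J_def by (intro epowr_neg_antimono) auto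
  then have J2: "ennreal (W powr (- s / N)) \<le> epowr J (- s / N)"
  proof -
    have "epowr (ennreal W) (- s / N) = ennreal (W powr (- s / N))" using W sN by (auto simp: epowr_def)
    with \<open>epowr (ennreal W) (- s / N) \<le> epowr J (- s / N)\<close> show ?thesis by (simp only:)
  qed
  have e1: "0 < (N + s * p) / (N * p)" using N p s by (intro divide_pos_pos add_pos_pos mult_pos_pos) auto
  have "A powr (1 / q) = ?c powr (s / N) * K powr (1 / p) * W powr (- s / N)"
  proof -
    have 1: "1 / q = (1 - a / N) / p" using N a by (simp add: q a_def field_simps)
    have 2: "N / a * (- s / N) = - (1 / p)" using N s p by (simp add: a_def)
    have "W powr (- s / N) = ?c powr (- s / N) * ((K / A') powr (N / a)) powr (- s / N)"
      using c K A' by (simp add: W_def powr_mult)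
    also have "((K / A') powr (N / a)) powr (- s / N) = (K / A') powr (- (1 / p))" by (simp only: powr_powr 2)
    also have "\<dots> = A' powr (1 / p) / K powr (1 / p)"
      using K A' by (simp add: powr_minus powr_divide)
    also have "A' powr (1 / p) = A powr (1 / q)" by (simp add: A'_def powr_powr 1)
    finally have "W powr (- s / N) = ?c powr (- s / N) * (A powr (1 / q) / K powr (1 / p))" .
    then show ?thesis using c K by (simp add: powr_minus)
  qed
  also have "\<dots> = affine_constant s p TYPE('a) K * (\<sigma> powr ((N + s * p) / (N * p)) * W powr (- s / N))"
    unfolding affine_constant_def Let_def \<sigma>_def[symmetric] N_def[symmetric] using \<sigma>(2) by simp
  finally have "ennreal (A powr (1 / q)) = ennreal (affine_constant s p TYPE('a) K * (\<sigma> powr ((N + s * p) / (N * p)) * W powr (- s / N)))"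
    by simp
  also have "\<dots> = ennreal (affine_constant s p TYPE('a) K) * (ennreal (\<sigma> powr ((N + s * p) / (N * p))) * ennreal (W powr (- s / N)))"
  proof -
    have "0 \<le> affine_constant s p TYPE('a) K" by (simp add: affine_constant_def Let_def)
    then show ?thesis by (simp only: ennreal_mult powr_ge_zero mult_nonneg_nonneg)
  qed
  also have "\<dots> \<le> ennreal (affine_constant s p TYPE('a) K) * (epowr (ennreal \<sigma>) ((N + s * p) / (N * p)) * epowr J (- s / N))"
    using \<sigma> e1 by (intro mult_left_mono mult_mono J2) (auto simp: epowr_ennreal)
  finally show ?thesis unfolding \<sigma>(1) J_def a_def .
qed

lemma unit_set_star:
  fixes I :: "'a::euclidean_space \<Rightarrow> ennreal"
  assumes hom: "\<And>t x. 0 < t \<Longrightarrow> I (t *\<^sub>R x) = ennreal (t powr a) * I x" and a: "0 < a"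
    and h: "h \<in> {x. I x \<le> 1} \<inter> cball 0 R" and r: "0 < r" "r \<le> 1"
  shows "r *\<^sub>R h \<in> {x. I x \<le> 1} \<inter> cball 0 R"
proof -
  have "ennreal (r powr a) * I h \<le> ennreal 1 * 1"
    using h r a by (intro mult_mono ennreal_leI) (auto intro: powr_le1)
  moreover have "norm (r *\<^sub>R h) \<le> R"
    using h r mult_left_le_one_le[of "norm h" r] by simp
  ultimately show ?thesis using r by (simp add: hom)
qed

lemma Lp_energy_representative:
  assumes "AE x in lborel. f x = f' x"
  shows "Lp_energy p f = (\<integral>\<^sup>+x. ennreal (\<bar>f' x\<bar> powr p) \<partial>lborel)"
  unfolding Lp_energy_def nn_integral_completion
  by (rule nn_integral_cong_AE, use assms in eventually_elim) simp

lemma AE_translate: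
  fixes P :: "'a::euclidean_space \<Rightarrow> bool"
  assumes "AE x in lborel. P x" shows "AE x in lborel. P (x + a)"
proof -
  obtain Z where Z: "{x \<in> space lborel. \<not> P x} \<subseteq> Z" "Z \<in> null_sets lborel"
    using assms by (auto elim!: AE_E3 simp: eventually_ae_filter)
  have [measurable]: "Z \<in> sets borel" using Z(2) by auto
  have "(\<integral>\<^sup>+x. indicator Z (x + a) \<partial>lborel) = 0"
    using Z(2) nn_integral_lborel_translate[of "indicator Z" a] by (simp add: null_sets_def)
  then have "AE x in lborel. indicator Z (x + a) = (0::ennreal)"
    by (subst (asm) nn_integral_0_iff_AE) auto
  then show ?thesis
  proof eventually_elim
    case (elim x)
    then have "x + a \<notin> Z" by (auto simp: indicator_def split: if_splits)
    then show ?case using Z(1) by auto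
  qed
qed

text \<open>
  For a Borel representative the differences are jointly measurable in the point and the step, which
  Tonelli's theorem requires.
\<close>

lemma Lp_energy_fdiff_representative:
  fixes f f' :: "'a::euclidean_space \<Rightarrow> real"
  assumes ae: "AE x in lborel. f x = f' x"
  shows "Lp_energy p ((fdiff h ^^ m) f) = (\<integral>\<^sup>+x. ennreal (\<bar>(fdiff h ^^ m) f' x\<bar> powr p) \<partial>lborel)"
proof (rule Lp_energy_representative)
  have "AE x in lborel. \<forall>j\<in>{..m}. f (x + real j *\<^sub>R h) = f' (x + real j *\<^sub>R h)"
    by (intro AE_finite_allI AE_translate[OF ae]) auto
  then show "AE x in lborel. (fdiff h ^^ m) f x = (fdiff h ^^ m) f' x"
    by eventually_elim (auto simp: fdiff_iterate intro!: sum.cong)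
qed

definition sobolev_constant :: "real \<Rightarrow> real \<Rightarrow> real \<Rightarrow> real" where
  "sobolev_constant s p N =
    (let q = N * p / (N - s * p); k = nat \<lfloor>s\<rfloor>
     in if s \<notin> \<int> then 4 powr p * 2 powr (s * p) * (4 * 2 ^ (k + 1)) powr (q * (s * p / N)) * (2 powr (s * p + 1) * 2 powr N)
        else if p = 1 then 2 * q * 2 powr (1 / N)
        else 4 powr p * 2 powr (s * p) * (4 * 2 ^ k) powr (q * (s * p / N)) * (2 powr p * p / (p - 1)) ^ k)"

lemma sobolev_constant_pos:
  assumes "0 < s" "1 \<le> p" "s * p < N" shows "0 < sobolev_constant s p N"
proof -
  have "0 < N" using assms by (smt (verit) mult_pos_pos)
  then show ?thesis using assms by (auto simp: sobolev_constant_def Let_def intro!: mult_pos_pos divide_pos_pos)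
qed

lemma directional_energy_bound_noninteger:
  fixes f :: "'a::euclidean_space \<Rightarrow> real"
  defines "N \<equiv> real DIM('a)"
  assumes s: "0 < s" "s \<notin> \<int>" and p: "1 \<le> p" and sp: "s * p < N" and q: "q = N * p / (N - s * p)"
    and f: "f \<in> borel_measurable lebesgue" and A: "Lp_energy q f = ennreal A" "0 < A"
  defines "I \<equiv> directional_energy s p f"
  shows "I \<in> borel_measurable borel"
    "\<And>t x. 0 < t \<Longrightarrow> I (t *\<^sub>R x) = ennreal (t powr (s * p)) * I x"
    "\<And>R V. 0 < V \<Longrightarrow> emeasure lborel ({x. I x \<le> 1} \<inter> cball 0 R) = ennreal V \<Longrightarrow>
        V powr (s * p / N) * A powr (1 - s * p / N) \<le> sobolev_constant s p N"
proof -
  let ?m = "nat \<lfloor>s\<rfloor> + 1"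
  obtain f' where [measurable]: "f' \<in> borel_measurable lborel" and ae: "AE x in lborel. f x = f' x"
    using completion_ex_borel_measurable_real[OF f] by blast
  have f'm: "f' \<in> borel_measurable borel" by simp
  have I: "I h = (\<integral>\<^sup>+t\<in>{0<..}. ennreal (t powr (- s * p - 1)) *
      (\<integral>\<^sup>+x. ennreal (\<bar>(fdiff (t *\<^sub>R h) ^^ ?m) f' x\<bar> powr p) \<partial>lborel) \<partial>lborel)" for h
    unfolding I_def directional_energy_def
    by (simp only: s(2) if_False nn_integral_completion Lp_energy_fdiff_representative[OF ae])
  define E where "E h = (\<integral>\<^sup>+x. ennreal (\<bar>(fdiff h ^^ ?m) f' x\<bar> powr p) \<partial>lborel)" for h
  have [measurable]: "E \<in> borel_measurable borel"
  proof -
    have "(\<lambda>h. \<integral>\<^sup>+x. ennreal (\<bar>(fdiff h ^^ ?m) f' x\<bar> powr p) \<partial>lborel) \<in> borel_measurable lborel"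
      by (rule lborel.borel_measurable_nn_integral) (simp only: case_prod_beta', measurable)
    then show ?thesis unfolding E_def by simp
  qed
  have IE: "I h = (\<integral>\<^sup>+t\<in>{0<..}. ennreal (t powr (- s * p - 1)) * E (t *\<^sub>R h) \<partial>lborel)" for h
    unfolding I E_def ..
  show Im: "I \<in> borel_measurable borel"
  proof -
    have "(\<lambda>h. \<integral>\<^sup>+t\<in>{0<..}. ennreal (t powr (- s * p - 1)) * E (t *\<^sub>R h) \<partial>lborel) \<in> borel_measurable lborel"
      by (rule lborel.borel_measurable_nn_integral) (simp only: case_prod_beta', measurable)
    then show ?thesis unfolding IE[abs_def] by simp
  qed
  show hom: "I (t *\<^sub>R h) = ennreal (t powr (s * p)) * I h" if t: "0 < t" for t h
  proof -
    let ?F = "\<lambda>u. ennreal (u powr (- s * p - 1)) * E (u *\<^sub>R h) * indicator {0<..} u"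
    have "I (t *\<^sub>R h) = (\<integral>\<^sup>+u. ennreal (t powr (s * p + 1)) * ?F (0 + t *\<^sub>R u) \<partial>lborel)"
      unfolding IE
    proof (rule nn_integral_cong)
      fix u :: real
      show "ennreal (u powr (- s * p - 1)) * E (u *\<^sub>R t *\<^sub>R h) * indicator {0<..} u = ennreal (t powr (s * p + 1)) * ?F (0 + t *\<^sub>R u)"
      proof (cases "0 < u")
        case True
        have "t powr (s * p + 1) * (t * u) powr (- s * p - 1) = u powr (- s * p - 1)"
          using t True by (simp add: powr_mult mult.assoc[symmetric] powr_add[symmetric])
        then have "ennreal (t powr (s * p + 1)) * ennreal ((t * u) powr (- s * p - 1)) = ennreal (u powr (- s * p - 1))"
          by (simp add: ennreal_mult[symmetric])
        then show ?thesis using True t by (simp add: mult.assoc[symmetric] mult.commute[of u])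
      qed (use t in \<open>simp add: zero_less_mult_iff\<close>)
    qed
    also have "\<dots> = ennreal (t powr (s * p + 1)) * (\<integral>\<^sup>+u. ?F (0 + t *\<^sub>R u) \<partial>lborel)"
      by (rule nn_integral_cmult) measurable
    also have "(\<integral>\<^sup>+u. ?F (0 + t *\<^sub>R u) \<partial>lborel) = ennreal (1 / t ^ DIM(real)) * (\<integral>\<^sup>+u. ?F u \<partial>lborel)"
      using t by (intro nn_integral_lborel_affine) measurable
    also have "\<dots> = ennreal (1 / t) * I h" unfolding IE by simp
    also have "ennreal (t powr (s * p + 1)) * (ennreal (1 / t) * I h) = ennreal (t powr (s * p)) * I h"
      using t by (simp add: mult.assoc[symmetric] ennreal_mult[symmetric] powr_add)
    finally show ?thesis .
  qed
  fix R V :: real assume V: "0 < V" and SV: "emeasure lborel ({x. I x \<le> 1} \<inter> cball 0 R) = ennreal V"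
  define S where "S = {x. I x \<le> 1} \<inter> cball 0 R"
  have S[measurable]: "S \<in> sets borel" unfolding S_def using Im by measurable
  have SV': "emeasure lborel S = ennreal V" using SV by (simp add: S_def)
  have sp0: "0 < s * p" using s p by simp
  have star: "\<And>h r. h \<in> S \<Longrightarrow> 0 < r \<Longrightarrow> r \<le> 1 \<Longrightarrow> r *\<^sub>R h \<in> S"
    unfolding S_def using hom sp0 by (rule unit_set_star)
  have I1: "\<And>h. h \<in> S \<Longrightarrow> (\<integral>\<^sup>+\<tau>\<in>{0<..}. ennreal (\<tau> powr (- s * p - 1)) *
      (\<integral>\<^sup>+x. ennreal (\<bar>(fdiff (\<tau> *\<^sub>R h) ^^ ?m) f' x\<bar> powr p) \<partial>lborel) \<partial>lborel) \<le> 1"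
    by (simp add: S_def I)
  obtain G where G: "G \<in> borel_measurable borel"
    "\<And>x t. 0 < t \<Longrightarrow> (\<integral>\<^sup>+h\<in>S. ennreal (\<bar>(fdiff (t *\<^sub>R h) ^^ ?m) f' x\<bar> powr p) \<partial>lborel)
        \<le> ennreal (V * t powr (s * p)) * G x"
    "(\<integral>\<^sup>+x. G x \<partial>lborel) \<le> ennreal (2 powr (s * p + 1) * 2 ^ DIM('a))"
    by (rule fractional_majorant[OF f'm S SV' V star I1 s(1)]) (use p in auto)
  have A': "Lp_energy q f' = ennreal A"
    using A(1) unfolding Lp_energy_representative[OF ae] by (simp add: Lp_energy_def nn_integral_completion)
  have "V powr (s * p / N) * A powr (1 - s * p / N) \<le>
    4 powr p * 2 powr (s * p) * (4 * 2 ^ ?m) powr (q * (s * p / N)) * (2 powr (s * p + 1) * 2 ^ DIM('a))"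
    unfolding N_def
    by (rule sobolev_from_scaled_differences[OF f'm S SV' V p s(1) sp[unfolded N_def] q[unfolded N_def] A' A(2) _ G(1) G(3)])
       (use G(2) in auto)
  then show "V powr (s * p / N) * A powr (1 - s * p / N) \<le> sobolev_constant s p N"
    using s by (simp add: sobolev_constant_def Let_def q N_def powr_realpow)
qed

lemma weak_form_scale:
  "weak_form k f x (replicate k (t *\<^sub>R h)) = t ^ k * weak_form k f x (replicate k h)"
proof -
  have "(\<Prod>i<k. (replicate k (t *\<^sub>R h) ! i) \<bullet> (bs ! i)) = t ^ k * (\<Prod>i<k. (replicate k h ! i) \<bullet> (bs ! i))" for bs :: "'a list"
    by (simp add: prod.distrib)
  then show ?thesis by (simp add: weak_form_def sum_distrib_left mult.assoc)
qed

lemma directional_energy_bound_integer: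
  fixes f :: "'a::euclidean_space \<Rightarrow> real"
  defines "N \<equiv> real DIM('a)"
  assumes s: "0 < s" "s \<in> \<int>" and p: "1 \<le> p" and sp: "s * p < N" and q: "q = N * p / (N - s * p)"
    and ex: "\<not> (p = 1 \<and> s \<in> \<int> \<and> s \<ge> 2)"
    and f: "f \<in> Sobolev1_loc (nat \<lfloor>s\<rfloor>)" and A: "Lp_energy q f = ennreal A" "0 < A"
  defines "I \<equiv> directional_energy s p f"
  shows "I \<in> borel_measurable borel"
    "\<And>t x. 0 < t \<Longrightarrow> I (t *\<^sub>R x) = ennreal (t powr (s * p)) * I x"
    "\<And>R V. 0 < V \<Longrightarrow> emeasure lborel ({x. I x \<le> 1} \<inter> cball 0 R) = ennreal V \<Longrightarrow>
        V powr (s * p / N) * A powr (1 - s * p / N) \<le> sobolev_constant s p N"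
proof -
  define k where "k = nat \<lfloor>s\<rfloor>"
  have sk: "s = real k" using s unfolding k_def by (auto elim: Ints_cases)
  have k: "1 \<le> k" using s(1) sk by simp
  obtain f' g where f'm[measurable]: "f' \<in> borel_measurable borel" and ae: "AE x in lborel. f x = f' x"
    and g[measurable]: "(\<lambda>(h, x). g h x) \<in> borel_measurable (borel \<Otimes>\<^sub>M borel)"
    and gae0: "\<forall>h. AE x in lborel. weak_form k f x (replicate k h) = g h x"
    and gbd0: "\<forall>h t. 0 < t \<longrightarrow> (AE x in lborel. ennreal \<bar>(fdiff (t *\<^sub>R h) ^^ k) f' x\<bar>
      \<le> ennreal (t ^ k) * (line_avg (t *\<^sub>R h) ^^ k) (\<lambda>x. ennreal \<bar>g h x\<bar>) x)"
    by (rule sobolev_directional_derivative[OF f[folded k_def] k])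
  note gae = gae0[rule_format] and gbd = gbd0[rule_format]
  have g1[measurable]: "g h \<in> borel_measurable borel" for h
    using measurable_compose[OF _ g, of "\<lambda>x. (h, x)" borel] by simp
  have gp: "(\<lambda>w. g (fst w) (snd w)) \<in> borel_measurable (lborel \<Otimes>\<^sub>M lborel)"
    using g by (simp add: case_prod_beta')
  have Iw: "I h = Lp_energy p (\<lambda>x. weak_form k f x (replicate k h))" for h
    using s(2) by (simp add: I_def directional_energy_def k_def)
  have I: "I h = (\<integral>\<^sup>+x. ennreal (\<bar>g h x\<bar> powr p) \<partial>lborel)" for h
    unfolding Iw by (rule Lp_energy_representative[OF gae])
  show Im: "I \<in> borel_measurable borel"
  proof -
    have "(\<lambda>h. \<integral>\<^sup>+x. ennreal (\<bar>g h x\<bar> powr p) \<partial>lborel) \<in> borel_measurable lborel"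
      using gp by (intro lborel.borel_measurable_nn_integral) (simp add: case_prod_beta')
    then show ?thesis unfolding I[abs_def] by simp
  qed
  show hom: "I (t *\<^sub>R h) = ennreal (t powr (s * p)) * I h" if t: "0 < t" for t h
  proof -
    have "\<bar>t ^ k * w\<bar> powr p = t powr (s * p) * \<bar>w\<bar> powr p" for w :: real
      using t by (simp add: abs_mult powr_mult powr_powr sk flip: powr_realpow)
    then show ?thesis
      unfolding I[of h] Iw[of "t *\<^sub>R h"] weak_form_scale
      by (subst Lp_energy_representative[where f' = "\<lambda>x. t ^ k * g h x"])
         (use gae[of h] in \<open>auto simp: ennreal_mult nn_integral_cmult elim: eventually_mono\<close>)
  qed
  fix R V :: real assume V: "0 < V" and SV: "emeasure lborel ({x. I x \<le> 1} \<inter> cball 0 R) = ennreal V"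
  define S where "S = {x. I x \<le> 1} \<inter> cball 0 R"
  have S[measurable]: "S \<in> sets borel" unfolding S_def using Im by measurable
  have SV': "emeasure lborel S = ennreal V" using SV by (simp add: S_def)
  have A': "Lp_energy q f' = ennreal A"
    using A(1) unfolding Lp_energy_representative[OF ae] by (simp add: Lp_energy_def nn_integral_completion)
  show "V powr (s * p / N) * A powr (1 - s * p / N) \<le> sobolev_constant s p N"
  proof (cases "p = 1")
    case True
    then have s1: "s = 1" using ex s sk k by (cases "k = 1") auto
    then have k1: "k = 1" using sk by simp
    have N1: "1 < N" using sp s1 True by simp
    have "(\<integral>\<^sup>+x. ennreal \<bar>fdiff (r *\<^sub>R h) f' x\<bar> \<partial>lborel) \<le> ennreal r" if h: "h \<in> S" and r: "0 < r" for h r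
    proof -
      have "(\<integral>\<^sup>+x. ennreal \<bar>fdiff (r *\<^sub>R h) f' x\<bar> \<partial>lborel)
          \<le> (\<integral>\<^sup>+x. ennreal r * line_avg (r *\<^sub>R h) (\<lambda>x. ennreal \<bar>g h x\<bar>) x \<partial>lborel)"
        using gbd[OF r, of h] by (intro nn_integral_mono_AE) (simp add: k1)
      also have "\<dots> = ennreal r * (\<integral>\<^sup>+x. line_avg (r *\<^sub>R h) (\<lambda>x. ennreal \<bar>g h x\<bar>) x \<partial>lborel)"
        by (rule nn_integral_cmult) measurable
      also have "(\<integral>\<^sup>+x. line_avg (r *\<^sub>R h) (\<lambda>x. ennreal \<bar>g h x\<bar>) x \<partial>lborel) = I h"
        unfolding I using True by (subst nn_integral_line_avg) simp_all
      also have "ennreal r * I h \<le> ennreal r * 1" using h by (intro mult_left_mono) (auto simp: S_def)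
      finally show ?thesis by simp
    qed
    then have "V powr (1 / N) * A powr (1 - 1 / N) \<le> 2 * q * 2 powr (1 / N)"
      using sobolev_from_level_sets[OF f'm S SV' V _ _ A' A(2)] N1 q s1 True by (simp add: N_def)
    then show ?thesis using s1 True by (simp add: sobolev_constant_def Let_def q)
  next
    case False
    then have p1: "1 < p" using p by simp
    have gm: "(\<lambda>(h, x). ennreal \<bar>g h x\<bar>) \<in> borel_measurable (borel \<Otimes>\<^sub>M borel)"
      using g by (simp add: case_prod_beta')
    have I1: "(\<integral>\<^sup>+x. epowr (ennreal \<bar>g h x\<bar>) p \<partial>lborel) \<le> 1" if "h \<in> S" for h
      using that p1 by (simp add: S_def I epowr_ennreal)
    obtain G where G: "G \<in> borel_measurable borel"
      "AE x in lborel. \<forall>i::int. (\<integral>\<^sup>+h\<in>S. ennreal (\<bar>(fdiff ((2 powr i) *\<^sub>R h) ^^ k) f' x\<bar> powr p) \<partial>lborel)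
        \<le> ennreal (V * (2 powr i) powr (real k * p)) * G x"
      "(\<integral>\<^sup>+x. G x \<partial>lborel) \<le> ennreal ((2 powr p * p / (p - 1)) ^ k)"
      by (rule integer_majorant[OF f'm S SV' V p1 gm gbd I1])
    have "V powr (s * p / N) * A powr (1 - s * p / N) \<le>
      4 powr p * 2 powr (s * p) * (4 * 2 ^ k) powr (q * (s * p / N)) * (2 powr p * p / (p - 1)) ^ k"
      unfolding N_def
      by (rule sobolev_from_scaled_differences[OF f'm S SV' V p s(1) sp[unfolded N_def] q[unfolded N_def] A' A(2) _ G(1) G(3)])
         (use G(2) p1 in \<open>auto simp: sk\<close>)
    then show ?thesis using False s by (simp add: sobolev_constant_def Let_def q k_def)
  qed
qed

theorem affine_sobolev_inequality:
  fixes f :: "'a::euclidean_space \<Rightarrow> real"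
  defines "N \<equiv> real DIM('a)"
  assumes dim: "2 \<le> DIM('a)" and s: "0 < s" and p: "1 \<le> p" and sp: "s * p < N"
    and ex: "\<not> (p = 1 \<and> s \<in> \<int> \<and> s \<ge> 2)" and f: "f \<in> hom_sobolev s p"
  shows "Lp_norm (N * p / (N - s * p)) f
    \<le> ennreal (affine_constant s p TYPE('a) (sobolev_constant s p N)) * affine_energy s p f"
proof -
  define q where "q = N * p / (N - s * p)"
  have q0: "0 < q" using s p sp by (auto simp: q_def N_def intro!: divide_pos_pos mult_pos_pos)
  have fm: "f \<in> borel_measurable lebesgue" and fin: "Lp_norm q f < \<infinity>" and fS: "s \<in> \<int> \<Longrightarrow> f \<in> Sobolev1_loc (nat \<lfloor>s\<rfloor>)"
    using f by (auto simp: hom_sobolev_def q_def N_def)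
  have "Lp_energy q f \<noteq> top"
    using fin q0 by (auto simp: Lp_norm_def)
  then obtain A where A: "Lp_energy q f = ennreal A" "0 \<le> A" by (cases "Lp_energy q f") auto
  have norm: "Lp_norm q f = ennreal (A powr (1 / q))" using A q0 by (simp add: Lp_norm_def epowr_ennreal)
  show ?thesis
  proof (cases "A = 0")
    case True
    then show ?thesis using norm by (simp add: q_def)
  next
    case False
    then have A0: "0 < A" using A by simp
    let ?I = "directional_energy s p f"
    have I: "?I \<in> borel_measurable borel \<and> (\<forall>t x. 0 < t \<longrightarrow> ?I (t *\<^sub>R x) = ennreal (t powr (s * p)) * ?I x) \<and>
      (\<forall>R V. 0 < V \<longrightarrow> emeasure lborel ({x. ?I x \<le> 1} \<inter> cball 0 R) = ennreal V \<longrightarrow>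
        V powr (s * p / N) * A powr (1 - s * p / N) \<le> sobolev_constant s p N)"
    proof (cases "s \<in> \<int>")
      case True
      show ?thesis
        using directional_energy_bound_integer[OF s True p sp[unfolded N_def] q_def[unfolded N_def] ex fS[OF True] A(1) A0]
        unfolding N_def by blast
    next
      case False
      show ?thesis
        using directional_energy_bound_noninteger[OF s False p sp[unfolded N_def] q_def[unfolded N_def] fm A(1) A0]
        unfolding N_def by blast
    qed
    have "ennreal (A powr (1 / q)) \<le> ennreal (affine_constant s p TYPE('a) (sobolev_constant s p N)) *
      (epowr (emeasure (hausdorff_measure (DIM('a) - 1) :: 'a measure) (sphere 0 1)) ((N + s * p) / (N * p))
       * epowr (\<integral>\<^sup>+\<xi>\<in>sphere 0 1. epowr (?I \<xi>) (- N / (s * p)) \<partial>hausdorff_measure (DIM('a) - 1)) (- s / N))"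
      unfolding N_def
      by (rule affine_energy_lower_bound[OF dim _ s p sp[unfolded N_def] q_def[unfolded N_def] _ A0])
         (use I sobolev_constant_pos[OF s p sp] in \<open>auto simp: N_def\<close>)
    then show ?thesis unfolding norm[unfolded q_def N_def] affine_energy_def Let_def N_def q_def .
  qed
qed

theorem theorem1p1:
  fixes s p :: real
  assumes "CARD('n::finite) \<ge> 2"
    and "s > 0" and "1 \<le> p" and "s * p < real CARD('n)"
    and "\<not> (p = 1 \<and> s \<in> \<int> \<and> s \<ge> 2)"
  shows "\<exists>K::real. 0 \<le> K \<and>
    (\<forall>f :: real ^ 'n \<Rightarrow> real. f \<in> hom_sobolev s p \<longrightarrow>
      Lp_norm (real CARD('n) * p / (real CARD('n) - s * p)) f \<le> ennreal K * affine_energy s p f)"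
proof (intro exI conjI allI impI)
  show "0 \<le> affine_constant s p TYPE(real ^ 'n) (sobolev_constant s p (real CARD('n)))"
    by (simp add: affine_constant_def Let_def)
  fix f :: "real ^ 'n \<Rightarrow> real" assume "f \<in> hom_sobolev s p"
  then show "Lp_norm (real CARD('n) * p / (real CARD('n) - s * p)) f
      \<le> ennreal (affine_constant s p TYPE(real ^ 'n) (sobolev_constant s p (real CARD('n)))) * affine_energy s p f"
    using affine_sobolev_inequality[of s p f] assms by simp
qed

end
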